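(* Let $k$ be an algebraically closed field of characteristic zero. Let $m,r\geq1$, and let $T:\mathbb A^m_k\to\mathbb A^m_k$ be an étale polynomial endomorphism. Let $M(u)\in\operatorname{GL}_r(k[u_1,\ldots,u_m])$. Fix $d\geq2$ and $$0\neq\rho(u,\boldsymbol z)\in(z_1,\ldots,z_r)^{d-1}\,k[u_1,\ldots,u_m,z_1,\ldots,z_r],$$ and define $F(u,\boldsymbol z)=\bigl(T(u),\rho(u,\boldsymbol z)M(u)\boldsymbol z\bigr)$ on $\mathbb A^{m+r}_k$. Let $Z=\mathbb A^m\times\{0\}$ and let $C=V\bigl(\det D_{\boldsymbol z}(\rho(u,\boldsymbol z)M(u)\boldsymbol z)\bigr)\subseteq\mathbb A^{m+r}_k$ be the vertical critical locus of $F$. Suppose that there are $q,\ell\geq1$ such that $$\deg(T^q)<d^q\qquad\text{and}\qquad F^\ell(C)\subseteq Z$$ set-theoretically. Then $F$ satisfies the Dynamical Mordell–Lang conjecture: for every $x\in\mathbb A^{m+r}(k)$ and every closed subvariety $V\subseteq\mathbb A^{m+r}_k$, the set $\{n\in\mathbb N_0:F^n(x)\in V\}$ is a finite union of arithmetic progressions.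
   Context: $\mathbb N_0=\{0,1,2,\ldots\}$; an arithmetic progression is a set $a+b\mathbb N_0$ with $a,b\in\mathbb N_0$, where $b=0$ (a singleton) is allowed. $u=(u_1,\ldots,u_m)$ and $\boldsymbol z=(z_1,\ldots,z_r)$ (a column vector) are the base and fiber coordinates. A self-map of affine space is étale if its differential is everywhere invertible. $M\in\operatorname{GL}_r(k[u])$ means that $M$ and $M^{-1}$ have polynomial entries. $(z_1,\ldots,z_r)^{d-1}$ consists of the polynomials all of whose monomials have total degree at least $d-1$ in $z_1,\ldots,z_r$. $D_{\boldsymbol z}$ is the Jacobian matrix with respect to $\boldsymbol z$ with $u$ fixed; $V(h)$ is the zero set of $h$. The degree of a polynomial map is the maximum of the total degrees of its nonzero coordinate polynomials, and $\deg(T^q)$ is the degree of the $q$-th iterate (composed map). *)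

theory Defs
  imports "HOL-Analysis.Analysis" "HOL-Library.Poly_Mapping"
begin

section \<open>Multivariate polynomials\<close>

text \<open>
  A polynomial with coefficients in \<open>'k\<close> and variables indexed by \<open>'v\<close> is a finitely supported
  function from exponent vectors to coefficients; the ring structure is the convolution structure
  of \<^theory>\<open>HOL-Library.Poly_Mapping\<close>.
\<close>

type_synonym ('v, 'k) mpoly = "('v \<Rightarrow>\<^sub>0 nat) \<Rightarrow>\<^sub>0 'k"

definition mconst :: "'k::zero \<Rightarrow> ('v, 'k) mpoly"
  where "mconst c = Poly_Mapping.single 0 c"

definition mvar :: "'v \<Rightarrow> ('v, 'k::zero_neq_one) mpoly"
  where "mvar v = Poly_Mapping.single (Poly_Mapping.single v 1) 1"

text \<open>Send coefficients through \<open>h\<close> and the variable \<open>v\<close> to \<open>s v\<close>.\<close>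

definition minsert :: "('k::zero \<Rightarrow> 'a::comm_semiring_1) \<Rightarrow> ('v \<Rightarrow> 'a) \<Rightarrow> ('v, 'k) mpoly \<Rightarrow> 'a"
  where "minsert h s p =
    (\<Sum>e\<in>Poly_Mapping.keys p. h (Poly_Mapping.lookup p e) *
       (\<Prod>v\<in>Poly_Mapping.keys e. s v ^ Poly_Mapping.lookup e v))"

definition meval :: "'k^'v \<Rightarrow> ('v::finite, 'k::comm_semiring_1) mpoly \<Rightarrow> 'k"
  where "meval x = minsert (\<lambda>c. c) (\<lambda>v. x $ v)"

definition msubst ::
  "('v \<Rightarrow> ('w, 'k) mpoly) \<Rightarrow> ('v, 'k::comm_semiring_1) mpoly \<Rightarrow> ('w, 'k) mpoly"
  where "msubst s = minsert mconst s"

text \<open>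
  If \<open>v\<close> does not occur in the monomial \<open>e\<close>, the truncated difference below is \<open>e\<close> itself, but the
  coefficient is zero.
\<close>

definition mpderiv :: "'v \<Rightarrow> ('v, 'k::comm_semiring_1) mpoly \<Rightarrow> ('v, 'k) mpoly"
  where "mpderiv v p =
    (\<Sum>e\<in>Poly_Mapping.keys p.
       Poly_Mapping.single (e - Poly_Mapping.single v 1)
         (of_nat (Poly_Mapping.lookup e v) * Poly_Mapping.lookup p e))"

definition monom_degree :: "('v \<Rightarrow>\<^sub>0 nat) \<Rightarrow> nat"
  where "monom_degree e = (\<Sum>v\<in>Poly_Mapping.keys e. Poly_Mapping.lookup e v)"

definition total_degree :: "('v, 'k::zero) mpoly \<Rightarrow> nat"
  where "total_degree p = Max (insert 0 (monom_degree ` Poly_Mapping.keys p))"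


section \<open>Polynomial maps of affine spaces\<close>

text \<open>
  A polynomial map from the affine space with coordinates indexed by \<open>'v\<close> to the one with
  coordinates indexed by \<open>'w\<close> is the vector of its coordinate polynomials.
\<close>

type_synonym ('v, 'k, 'w) pmap = "('v, 'k) mpoly ^ 'w"

definition pmap_eval :: "('v::finite, 'k::comm_semiring_1, 'w::finite) pmap \<Rightarrow> 'k^'v \<Rightarrow> 'k^'w"
  where "pmap_eval f x = (\<chi> i. meval x (f $ i))"

definition pmap_id :: "('v::finite, 'k::comm_semiring_1, 'v) pmap"
  where "pmap_id = (\<chi> v. mvar v)"

definition pmap_compose ::
  "('v::finite, 'k::comm_semiring_1, 'w::finite) pmap \<Rightarrow> ('u, 'k, 'v) pmap \<Rightarrow> ('u, 'k, 'w) pmap"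
  where "pmap_compose g f = (\<chi> i. msubst (\<lambda>v. f $ v) (g $ i))"

definition pmap_iterate ::
  "nat \<Rightarrow> ('v::finite, 'k::comm_semiring_1, 'v) pmap \<Rightarrow> ('v, 'k, 'v) pmap"
  where "pmap_iterate n f = (pmap_compose f ^^ n) pmap_id"

text \<open>Inserting \<open>0\<close> only matters for the zero map, whose degree is thereby \<open>0\<close>.\<close>

definition pmap_degree :: "('v, 'k::zero, 'w::finite) pmap \<Rightarrow> nat"
  where "pmap_degree f = Max (insert 0 {total_degree (f $ i) | i. f $ i \<noteq> 0})"

definition jacobian ::
  "('v::finite, 'k::comm_semiring_1, 'w::finite) pmap \<Rightarrow> ('v, 'k) mpoly ^ 'v ^ 'w"
  where "jacobian f = (\<chi> i v. mpderiv v (f $ i))"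

definition etale :: "('v::finite, 'k::comm_semiring_1, 'v) pmap \<Rightarrow> bool"
  where "etale f \<longleftrightarrow> (\<forall>x. invertible (map_matrix (meval x) (jacobian f)))"

definition zero_locus :: "('v::finite, 'k::comm_semiring_1) mpoly set \<Rightarrow> ('k^'v) set"
  where "zero_locus P = {x. \<forall>p\<in>P. meval x p = 0}"

definition closed_subvariety :: "('k::comm_semiring_1 ^ 'v::finite) set \<Rightarrow> bool"
  where "closed_subvariety V \<longleftrightarrow> (\<exists>P. V = zero_locus P)"


section \<open>The skew product over a base endomorphism\<close>

text \<open>
  The coordinates of the total space are indexed by \<open>'m + 'r\<close>: \<open>Inl i\<close> is the base coordinate
  \<open>u\<^sub>i\<close> and \<open>Inr j\<close> the fiber coordinate \<open>z\<^sub>j\<close>.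
\<close>

definition pull_base :: "('m, 'k::comm_semiring_1) mpoly \<Rightarrow> ('m + 'r, 'k) mpoly"
  where "pull_base = msubst (\<lambda>i. mvar (Inl i))"

definition fiber_coords :: "('m + 'r, 'k::comm_semiring_1, 'r::finite) pmap"
  where "fiber_coords = (\<chi> j. mvar (Inr j))"

text \<open>The ideal \<open>(z\<^sub>1,\<dots>,z\<^sub>r)\<^sup>n\<close>.\<close>

definition fiber_ideal_power :: "nat \<Rightarrow> ('m + 'r::finite, 'k::zero) mpoly set"
  where "fiber_ideal_power n =
    {p. \<forall>e\<in>Poly_Mapping.keys p. n \<le> (\<Sum>j\<in>UNIV. Poly_Mapping.lookup e (Inr j))}"

definition fiber_part ::
  "('m + 'r, 'k) mpoly \<Rightarrow> ('m, 'k) mpoly ^ 'r ^ 'r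
    \<Rightarrow> ('m + 'r, 'k::comm_semiring_1, 'r::finite) pmap"
  where "fiber_part \<rho> M = \<rho> *s (map_matrix pull_base M *v fiber_coords)"

definition skew_product ::
  "('m, 'k, 'm) pmap \<Rightarrow> ('m + 'r, 'k) mpoly \<Rightarrow> ('m, 'k) mpoly ^ 'r ^ 'r
    \<Rightarrow> ('m::finite + 'r::finite, 'k::comm_semiring_1, 'm + 'r) pmap"
  where "skew_product T \<rho> M =
    (\<chi> c. case c of Inl i \<Rightarrow> pull_base (T $ i) | Inr j \<Rightarrow> fiber_part \<rho> M $ j)"

definition vertical_jacobian ::
  "('m + 'r::finite, 'k::comm_semiring_1, 'r) pmap \<Rightarrow> ('m + 'r, 'k) mpoly ^ 'r ^ 'r"
  where "vertical_jacobian g = (\<chi> i j. mpderiv (Inr j) (g $ i))"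

definition vertical_critical_locus ::
  "('m + 'r, 'k) mpoly \<Rightarrow> ('m, 'k) mpoly ^ 'r ^ 'r
    \<Rightarrow> ('k::comm_ring_1 ^ ('m::finite + 'r::finite)) set"
  where "vertical_critical_locus \<rho> M = zero_locus {det (vertical_jacobian (fiber_part \<rho> M))}"

definition zero_section :: "('k::zero ^ ('m::finite + 'r::finite)) set"
  where "zero_section = {x. \<forall>j. x $ Inr j = 0}"


section \<open>The dynamical Mordell--Lang property\<close>

definition arithmetic_progression :: "nat set \<Rightarrow> bool"
  where "arithmetic_progression A \<longleftrightarrow> (\<exists>a b. A = {a + b * n | n. True})"

definition finite_union_of_progressions :: "nat set \<Rightarrow> bool"
  where "finite_union_of_progressions S \<longleftrightarrow>
    (\<exists>\<A>. finite \<A> \<and> (\<forall>A\<in>\<A>. arithmetic_progression A) \<and> S = \<Union>\<A>)"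

definition dynamical_Mordell_Lang :: "('v::finite, 'k::comm_semiring_1, 'v) pmap \<Rightarrow> bool"
  where "dynamical_Mordell_Lang F \<longleftrightarrow>
    (\<forall>x V. closed_subvariety V \<longrightarrow>
      finite_union_of_progressions {n. (pmap_eval F ^^ n) x \<in> V})"

end

theory Submission
  imports Defs
begin

text \<open>
  Along an orbit the fiber coordinate is \<open>z\<^sub>n = \<lambda>\<^sub>n w\<^sub>n\<close> with \<open>w\<^sub>n\<^sub>+\<^sub>1 = M(u\<^sub>n) w\<^sub>n\<close> and a scalar \<open>\<lambda>\<^sub>n\<close>, so it
  shadows an orbit of the map \<open>(u, w) \<mapsto> (T(u), M(u) w)\<close>, which is etale. All data lie in a finitely
  generated subring \<open>R\<close> of \<open>k\<close>, in which one chooses a filtration that behaves like the one of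
  \<open>\<int>[t]\<close> by the powers of \<open>(p, t)\<close>, and a prime \<open>P\<close>.

  If the orbit avoids \<open>C\<close> modulo \<open>P\<close>, then the \<open>p\<close>-adic arc method applies to \<open>F\<close> itself; interpolation
  is done with Newton series and divisibility only, in the spirit of Hansel's proof of the
  Skolem--Mahler--Lech theorem. Otherwise \<open>F\<^sup>l(C) \<subseteq> Z\<close> and the Nullstellensatz show that the orbit meets
  \<open>Z\<close> modulo \<open>P\<close>, whence \<open>\<lambda>\<^sub>n\<close> is divisible by about \<open>d\<^sup>n\<close> factors. The sizes of \<open>u\<^sub>n\<close> and \<open>w\<^sub>n\<close> grow
  more slowly because \<open>deg (T\<^sup>q) < d\<^sup>q\<close>, so by a Liouville inequality a polynomial vanishing at a late
  \<open>(u\<^sub>n, z\<^sub>n)\<close> has all its \<open>z\<close>-homogeneous parts vanishing at \<open>(u\<^sub>n, w\<^sub>n)\<close>, and the arc method applies to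
  the etale map. Orbits that hit \<open>Z\<close> are orbits of that map as well.
\<close>

section \<open>Filtered rings\<close>

text \<open>The two cases make opposite demands. The arc method wants finite quotients and a prime
  \<open>p\<close> that raises the order by exactly one. The Liouville argument wants highly
  divisible elements of small size to vanish. An embedding of \<open>R\<close> into a p-adic field
  serves the arc method, but there an element involving transcendental parameters can be far closer
  to 0 than its size explains. So no completion is taken: \<open>R\<close> itself carries a
  filtration and a size, and both are extended whenever an element is adjoined. The residue ring of
  an integral extension can have nilpotents and several maximal ideals, so \<open>P\<close> is
  chosen only when the tower is complete. Until then the Liouville inequality carries a multiplier,
  which finally becomes a denominator outside \<open>P\<close>. The critical locus enters through
  det D_z(\<rho> M z) = det M \<rho>^(r-1) \<sigma> with \<sigma> = \<rho> + z . grad \<rho>, a rank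
  one update of \<rho> M. Modulo \<open>P\<close> an orbit avoiding the zeros of \<rho> and \<sigma>
  sees an etale map, and a zero of either leads into \<open>Z\<close>.\<close>

locale subring_of =
  fixes R :: "'a::comm_ring_1 set"
  assumes one_mem: "1 \<in> R"
    and diff_mem: "a \<in> R \<Longrightarrow> b \<in> R \<Longrightarrow> a - b \<in> R"
    and mult_mem: "a \<in> R \<Longrightarrow> b \<in> R \<Longrightarrow> a * b \<in> R"
begin

lemma zero_mem: "0 \<in> R"
  using diff_mem[OF one_mem one_mem] by simp

lemma uminus_mem: "a \<in> R \<Longrightarrow> - a \<in> R"
  using diff_mem[OF zero_mem, of a] by simp

lemma add_mem: "a \<in> R \<Longrightarrow> b \<in> R \<Longrightarrow> a + b \<in> R"
  using diff_mem[of a "- b"] uminus_mem[of b] by simp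

lemma power_mem: "a \<in> R \<Longrightarrow> a ^ n \<in> R"
  by (induction n) (auto intro: one_mem mult_mem)

lemma sum_mem: "(\<And>x. x \<in> A \<Longrightarrow> f x \<in> R) \<Longrightarrow> sum f A \<in> R"
  by (induction A rule: infinite_finite_induct) (auto intro: zero_mem add_mem)

lemma prod_mem: "(\<And>x. x \<in> A \<Longrightarrow> f x \<in> R) \<Longrightarrow> prod f A \<in> R"
  by (induction A rule: infinite_finite_induct) (auto intro: one_mem mult_mem)

lemma of_nat_mem: "of_nat n \<in> R"
  by (induction n) (auto intro: zero_mem one_mem add_mem)

lemma of_int_mem: "of_int n \<in> R"
  by (cases n) (auto simp del: of_nat_Suc intro: of_nat_mem uminus_mem)

lemmas ring_mems = one_mem zero_mem diff_mem add_mem uminus_mem mult_mem power_mem sum_mem prod_mem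
  of_nat_mem of_int_mem

end

locale filtered_ring = subring_of R for R :: "'a::comm_ring_1 set" +
  fixes I :: "nat \<Rightarrow> 'a set"
  assumes fil_0: "I 0 = R"
    and fil_Suc: "I (Suc c) \<subseteq> I c"
    and fil_diff: "a \<in> I c \<Longrightarrow> b \<in> I c \<Longrightarrow> a - b \<in> I c"
    and fil_mult: "a \<in> I i \<Longrightarrow> b \<in> I j \<Longrightarrow> a * b \<in> I (i + j)"
    and fil_zero: "0 \<in> I c"
begin

lemma fil_uminus: "a \<in> I c \<Longrightarrow> - a \<in> I c"
  using fil_diff[OF fil_zero, of a] by simp

lemma fil_add: "a \<in> I c \<Longrightarrow> b \<in> I c \<Longrightarrow> a + b \<in> I c"
  using fil_diff[of a c "- b"] fil_uminus[of b] by simp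

lemma fil_sum: "(\<And>x. x \<in> A \<Longrightarrow> f x \<in> I c) \<Longrightarrow> sum f A \<in> I c"
  by (induction A rule: infinite_finite_induct) (auto intro: fil_zero fil_add)

lemma fil_mono: "i \<le> j \<Longrightarrow> I j \<subseteq> I i"
  by (rule lift_Suc_antimono_le[where f = I]) (rule fil_Suc)

lemma fil_antimono: "a \<in> I j \<Longrightarrow> i \<le> j \<Longrightarrow> a \<in> I i"
  using fil_mono by blast

lemma fil_mem: "a \<in> I c \<Longrightarrow> a \<in> R"
  using fil_mono[of 0 c] fil_0 by auto

lemma fil_mult_left: "r \<in> R \<Longrightarrow> a \<in> I c \<Longrightarrow> r * a \<in> I c"
  using fil_mult[of r 0 a c] fil_0 by simp

lemma fil_mult_right: "r \<in> R \<Longrightarrow> a \<in> I c \<Longrightarrow> a * r \<in> I c"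
  using fil_mult_left[of r a c] by (simp add: mult.commute)

lemma fil_power: "a \<in> I c \<Longrightarrow> a ^ n \<in> I (c * n)"
proof (induction n)
  case (Suc n)
  then show ?case using fil_mult[of a c "a ^ n" "c * n"] by simp
qed (simp add: fil_0 one_mem)

lemma fil_power_diff:
  assumes "a \<in> R" "b \<in> R" "a - b \<in> I c"
  shows "a ^ n - b ^ n \<in> I c"
proof (induction n)
  case (Suc n)
  have "a ^ Suc n - b ^ Suc n = a * (a ^ n - b ^ n) + b ^ n * (a - b)"
    by (simp add: algebra_simps)
  then show ?case
    using Suc assms by (auto intro!: fil_add fil_mult_left power_mem)
qed (simp add: fil_zero)

end

text \<open>By \<open>p_cancel\<close> multiplication by \<open>p\<close> raises the order by
  exactly one, so dividing by an integer costs no more than its multiplicity. \<open>p_gt_2\<close>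
  keeps the multiplicity of i! at or below i/2, and \<open>finite_quot\<close> feeds the pigeonhole
  arguments.\<close>

locale padic_ring = filtered_ring R I for R :: "'a::field_char_0 set" and I +
  fixes p :: nat
  assumes prime_p: "prime p" and p_gt_2: "p > 2"
    and p_mem: "of_nat p \<in> I 1"
    and p_cancel: "a \<in> R \<Longrightarrow> of_nat p * a \<in> I (Suc i) \<Longrightarrow> a \<in> I i"
    and finite_quot: "\<exists>F. finite F \<and> (\<forall>a\<in>R. \<exists>b\<in>F. a - b \<in> I c)"
begin

lemma p_power_mem: "of_nat (p ^ c) \<in> I c"
  using fil_power[OF p_mem, of c] by simp

lemma p_power_cancel: "a \<in> R \<Longrightarrow> of_nat (p ^ e) * a \<in> I (e + i) \<Longrightarrow> a \<in> I i"
proof (induction e arbitrary: i)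
  case (Suc e)
  have "of_nat p * (of_nat (p ^ e) * a) \<in> I (Suc (e + i))"
    using Suc.prems(2) by (simp add: mult.assoc)
  then have "of_nat (p ^ e) * a \<in> I (e + i)"
    by (rule p_cancel[rotated]) (intro mult_mem of_nat_mem Suc.prems(1))
  then show ?case by (rule Suc.IH[OF Suc.prems(1)])
qed simp

text \<open>By Bezout \<open>u\<close> is invertible modulo p^i, and p^i lies in
  \<open>I i\<close>.\<close>

lemma coprime_cancel:
  assumes "a \<in> R" "of_nat u * a \<in> I i" "coprime u p"
  shows "a \<in> I i"
proof -
  have "coprime (int u) (int (p ^ i))" using assms(3) by (simp add: coprime_power_right_iff)
  then obtain s t where st: "s * int u + t * int (p ^ i) = 1"
    using bezout_int[of "int u" "int (p ^ i)"] by auto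
  have "a = of_int (s * int u + t * int (p ^ i)) * a" unfolding st by simp
  also have "\<dots> = of_int s * (of_nat u * a) + of_int t * a * of_nat (p ^ i)"
    by (simp add: algebra_simps)
  also have "\<dots> \<in> I i"
    by (intro fil_add fil_mult_left ring_mems assms p_power_mem)
  finally show ?thesis .
qed

lemma nat_cancel:
  assumes "a \<in> R" "of_nat n * a \<in> I (multiplicity p n + i)" "n > 0"
  shows "a \<in> I i"
proof -
  obtain u where u: "n = p ^ multiplicity p n * u" "\<not> p dvd u"
    by (rule multiplicity_decompose'[of n p]) (use assms(3) prime_gt_1_nat[OF prime_p] in simp_all)
  have "(of_nat n :: 'a) = of_nat (p ^ multiplicity p n * u)" using u(1) by (rule arg_cong)
  then have "of_nat n * a = of_nat (p ^ multiplicity p n) * (of_nat u * a)"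
    by (simp only: of_nat_mult mult.assoc)
  then have "of_nat (p ^ multiplicity p n) * (of_nat u * a) \<in> I (multiplicity p n + i)"
    using assms(2) by (simp only:)
  then have "of_nat u * a \<in> I i"
    by (rule p_power_cancel[rotated]) (intro mult_mem of_nat_mem assms(1))
  moreover have "coprime u p"
    using prime_imp_coprime[OF prime_p u(2)] by (simp add: coprime_commute)
  ultimately show ?thesis using assms(1) coprime_cancel by blast
qed

lemma nat_mem: "of_nat n \<in> I (multiplicity p n)"
proof -
  obtain u where "n = p ^ multiplicity p n * u"
    using multiplicity_dvd[of p n] by (elim dvdE)
  then have "(of_nat n :: 'a) = of_nat (p ^ multiplicity p n * u)" by (rule arg_cong)
  then have "(of_nat n :: 'a) = of_nat u * of_nat (p ^ multiplicity p n)"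
    by (simp only: of_nat_mult mult.commute)
  then show ?thesis by (simp only: fil_mult_left[OF of_nat_mem p_power_mem])
qed

end

text \<open>Only multiples of \<open>p\<close> contribute: with q = i div p the multiplicity is q
  plus that of q!. Induction bounds this by q + q/2, and 3q \<le> i because p > 2. What remains of
  order i after division by i! is at least i/2, which is why Newton series with terms of order i
  converge.\<close>

lemma multiplicity_fact_le:
  fixes p :: nat
  assumes "prime p" "p > 2"
  shows "multiplicity p (fact i :: nat) \<le> i div 2"
proof (induction i rule: less_induct)
  case (less i)
  show ?case
  proof (cases "i = 0")
    case False
    define q where "q = i div p"
    have inj: "inj_on ((*) p) {1..q}" using assms by (auto simp: inj_on_def)
    have img: "{j \<in> {1..i}. p dvd j} = (*) p ` {1..q}"
    proof (intro set_eqI iffI)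
      fix j assume "j \<in> {j \<in> {1..i}. p dvd j}"
      then obtain m where m: "j = p * m" "1 \<le> p * m" "p * m \<le> i" by auto
      then have "m \<le> q" using assms by (simp add: q_def less_eq_div_iff_mult_less_eq mult.commute)
      moreover have "1 \<le> m" using m(2) by (cases m) auto
      ultimately show "j \<in> (*) p ` {1..q}" using m(1) by auto
    next
      fix j assume "j \<in> (*) p ` {1..q}"
      then obtain m where m: "m \<in> {1..q}" "j = p * m" by (elim imageE)
      then have "p * m \<le> i" using assms by (simp add: q_def less_eq_div_iff_mult_less_eq mult.commute)
      then show "j \<in> {j \<in> {1..i}. p dvd j}" using m assms by simp
    qed
    have "multiplicity p (fact i :: nat) = multiplicity p (\<Prod>{1..i})"
      by (simp add: fact_prod)
    also have "\<dots> = (\<Sum>j\<in>{1..i}. multiplicity p j)"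
      using assms by (subst prime_elem_multiplicity_prod_distrib) auto
    also have "\<dots> = (\<Sum>j\<in>{j \<in> {1..i}. p dvd j}. multiplicity p j)"
      by (rule sum.mono_neutral_right) (auto simp: not_dvd_imp_multiplicity_0)
    also have "\<dots> = (\<Sum>j\<in>{1..q}. multiplicity p (p * j))"
      unfolding img by (subst sum.reindex[OF inj]) (simp add: o_def)
    also have "\<dots> = (\<Sum>j\<in>{1..q}. Suc (multiplicity p j))"
      using assms by (intro sum.cong) (auto simp: multiplicity_times_same not_prime_unit)
    also have "\<dots> = q + (\<Sum>j\<in>{1..q}. multiplicity p j)"
      by (subst sum_Suc) simp
    also have "(\<Sum>j\<in>{1..q}. multiplicity p j) = multiplicity p (\<Prod>{1..q})"
      using assms by (subst prime_elem_multiplicity_prod_distrib) auto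
    also have "\<dots> = multiplicity p (fact q :: nat)"
      by (simp add: fact_prod)
    also have "\<dots> \<le> q div 2"
      using False assms by (intro less) (simp add: q_def)
    finally have "multiplicity p (fact i :: nat) \<le> q + q div 2" by simp
    moreover have "3 * q \<le> i"
      using assms mult_le_mono1[of 3 p q] times_div_less_eq_dividend[of p i]
      unfolding q_def by linarith
    ultimately show ?thesis by linarith
  qed simp
qed

section \<open>Zeros of Newton series\<close>

context padic_ring
begin

text \<open>Each coefficient of the quotient is built from coefficients of \<open>h\<close> of
  larger index only, so the bound improves by one in the index, that is by half a unit of
  order.\<close>

lemma poly_root_division:
  fixes h :: "'a poly"
  assumes "\<And>i. coeff h i \<in> I (e + (i + t) div 2)" and "c \<in> R" and "poly h c = 0"
  obtains g where "h = [:- c, 1:] * g" "\<And>i. coeff g i \<in> I (e + (i + Suc t) div 2)"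
proof
  show "h = [:- c, 1:] * synthetic_div h c"
    using synthetic_div_correct'[of c h] assms(3) unfolding assms(3) by (simp only: pCons_0_0 add_0_right)
  \<comment> \<open>\<open>t\<close> is quantified because removing the constant coefficient shifts
    all indices by one. The value at \<open>c\<close> is bounded at the same time since it is the
    constant coefficient of the next larger quotient.\<close>
  have *: "\<forall>t. (\<forall>i. coeff h i \<in> I (e + (i + t) div 2)) \<longrightarrow>
     (\<forall>i. coeff (synthetic_div h c) i \<in> I (e + (i + Suc t) div 2)) \<and> poly h c \<in> I (e + t div 2)"
  proof (induction h)
    case (pCons a h)
    show ?case
    proof (intro allI impI conjI)
      fix t
      assume "\<forall>i. coeff (pCons a h) i \<in> I (e + (i + t) div 2)"
      then have *: "coeff (pCons a h) i \<in> I (e + (i + t) div 2)" for i by blast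
      have a: "a \<in> I (e + t div 2)" using *[of 0] by simp
      have h: "coeff h i \<in> I (e + (i + Suc t) div 2)" for i using *[of "Suc i"] by simp
      have IH: "coeff (synthetic_div h c) i \<in> I (e + (i + Suc (Suc t)) div 2)"
         "poly h c \<in> I (e + (Suc t) div 2)" for i
        using pCons(2)[rule_format, OF h] by simp_all
      show "coeff (synthetic_div (pCons a h) c) i \<in> I (e + (i + Suc t) div 2)" for i
        using IH by (cases i) simp_all
      show "poly (pCons a h) c \<in> I (e + t div 2)"
      proof -
        have "poly h c \<in> I (e + t div 2)" using IH(2) by (rule fil_antimono) simp
        then show ?thesis using a assms(2) by (simp add: fil_add fil_mult_left)
      qed
    qed
  qed (auto intro: fil_zero)
  show "coeff (synthetic_div h c) i \<in> I (e + (i + Suc t) div 2)" for i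
    using *[rule_format, OF assms(1)] by (rule conjunct1[THEN spec])
qed

lemma poly_roots_value:
  fixes h :: "'a poly"
  assumes "finite A" "\<And>i. coeff h i \<in> I (e + (i + t) div 2)"
    and "\<And>n. n \<in> A \<Longrightarrow> poly h (of_nat n) = 0"
  shows "poly h (of_nat m) \<in> I (e + (t + card A) div 2)"
  using assms
proof (induction A arbitrary: h t rule: finite_induct)
  case empty
  have "poly h (of_nat m) = (\<Sum>i\<le>degree h. coeff h i * of_nat m ^ i)"
    by (rule poly_altdef)
  also have "\<dots> \<in> I (e + t div 2)"
    by (intro fil_sum fil_mult_right ring_mems fil_antimono[OF empty(1)]) simp
  finally show ?case by simp
next
  case (insert n A)
  obtain g where g: "h = [:- of_nat n, 1:] * g" "\<And>i. coeff g i \<in> I (e + (i + Suc t) div 2)"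
    using poly_root_division[of h e t "of_nat n"] insert.prems of_nat_mem by blast
  have "poly g (of_nat k) = 0" if "k \<in> A" for k
  proof -
    have "k \<noteq> n" using insert.hyps(2) that by blast
    then show ?thesis
      using insert.prems(2)[of k] that by (simp add: g(1) of_nat_diff algebra_simps)
  qed
  then have "poly g (of_nat m) \<in> I (e + (Suc t + card A) div 2)"
    by (rule insert.IH[OF g(2)])
  moreover have "poly h (of_nat m) = (of_nat m - of_nat n) * poly g (of_nat m)"
    by (simp add: g(1) algebra_simps)
  ultimately show ?case
    using insert.hyps by (simp add: fil_mult_left ring_mems)
qed

text \<open>
  Up to any given argument, \<open>a\<close> is interpolated by a polynomial whose coefficients are increasingly
  divisible, and dividing by \<open>x - n\<close> for a root \<open>n\<close> makes them more so by half a step.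
\<close>

lemma newton_series_zero:
  fixes a b :: "nat \<Rightarrow> 'a"
  assumes a: "\<And>n. a n = (\<Sum>i\<le>n. of_nat (n choose i) * b i)"
    and b: "\<And>i. b i \<in> I i"
    and inf: "infinite {n. a n = 0}"
    and haus: "\<And>x. (\<And>c. x \<in> I c) \<Longrightarrow> x = 0"
  shows "a m = 0"
proof (rule haus)
  fix c
  \<comment> \<open>Each root gains half a unit of order, so 2c of them gain
    \<open>c\<close>.\<close>
  obtain A where A: "finite A" "card A = 2 * c" "A \<subseteq> {n. a n = 0}"
    using inf infinite_arbitrarily_large by blast
  define N where "N = Max (insert m A)"
  define e where "e = multiplicity p (fact N :: nat)"
  define ff :: "nat \<Rightarrow> 'a poly" where "ff i = (\<Prod>j<i. [:- of_nat j, 1:])" for i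
  have ff_val: "poly (ff i) (of_nat n) = fact i * of_nat (n choose i)" for i n
    unfolding ff_def poly_prod by (simp add: gbinomial_mult_fact binomial_gbinomial lessThan_atLeast0)
  have ff_deg: "degree (ff i) = i" for i
    unfolding ff_def by (subst degree_prod_sum_eq) auto
  have ff_R: "coeff (ff i) j \<in> R" for i j
  proof (induction i arbitrary: j)
    case 0
    show ?case by (simp add: ff_def zero_mem one_mem)
  next
    case (Suc i)
    have "ff (Suc i) = smult (- of_nat i) (ff i) + pCons 0 (ff i)"
      by (simp add: ff_def mult.commute)
    then show ?case using Suc
      by (cases j) (auto simp del: mult_minus_left intro!: ring_mems)
  qed
  \<comment> \<open>N! times the sum of the terms (b_i / i!) x(x-1)...(x-i+1). It takes the value N!
    a_n at every n \<le> N, in particular at \<open>m\<close> and on \<open>A\<close>, and its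
    coefficients are formed without dividing in \<open>R\<close>.\<close>
  define h where "h = (\<Sum>i\<le>N. smult (of_nat (fact N div fact i) * b i) (ff i))"
  have h_val: "poly h (of_nat n) = fact N * a n" if "n \<le> N" for n
  proof -
    have "poly h (of_nat n) = (\<Sum>i\<le>N. fact N * (of_nat (n choose i) * b i))"
      unfolding h_def poly_sum
    proof (intro sum.cong refl)
      fix i assume "i \<in> {..N}"
      then have "of_nat (fact N div fact i :: nat) * (fact i :: 'a) = fact N"
        by (metis atMost_iff dvd_div_mult_self fact_dvd of_nat_fact of_nat_mult)
      then show "poly (smult (of_nat (fact N div fact i) * b i) (ff i)) (of_nat n) =
         fact N * (of_nat (n choose i) * b i)"
        by (simp add: ff_val)
    qed
    also have "\<dots> = (\<Sum>i\<le>n. fact N * (of_nat (n choose i) * b i))"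
      using that by (intro sum.mono_neutral_right) auto
    finally show ?thesis by (simp add: a sum_distrib_left)
  qed
  have "coeff h j \<in> I (e + (j + 0) div 2)" for j
    unfolding h_def coeff_sum
  proof (rule fil_sum)
    fix i assume i: "i \<in> {..N}"
    show "coeff (smult (of_nat (fact N div fact i) * b i) (ff i)) j \<in> I (e + (j + 0) div 2)"
    proof (cases "j \<le> i")
      case True
      define k where "k = (fact N div fact i :: nat)"
      have k: "fact N = k * fact i" using i by (simp add: k_def fact_dvd)
      then have "k \<noteq> 0" by (metis fact_nonzero mult_zero_left)
      then have "e = multiplicity p k + multiplicity p (fact i :: nat)"
        unfolding e_def k by (subst prime_elem_multiplicity_mult_distrib) (use prime_p in auto)
      \<comment> \<open>N!/i! has multiplicity \<open>e\<close> minus that of i!, which is at most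
        i/2, while \<open>b i\<close> has order i \<ge> j.\<close>
      then have "e + j div 2 \<le> multiplicity p k + i"
        using multiplicity_fact_le[OF prime_p p_gt_2, of i] True by linarith
      then have "of_nat k * b i \<in> I (e + (j + 0) div 2)"
        using fil_mult[OF nat_mem[of k] b[of i]] by (auto elim: fil_antimono)
      then show ?thesis using ff_R by (simp add: k_def fil_mult_right)
    next
      case False
      then show ?thesis using ff_deg[of i] by (simp add: coeff_eq_0 fil_zero)
    qed
  qed
  moreover have "poly h (of_nat n) = 0" if "n \<in> A" for n
    using that A h_val[of n] by (auto simp: N_def)
  ultimately have "poly h (of_nat m) \<in> I (e + (0 + card A) div 2)"
    using poly_roots_value[OF A(1)] by blast
  then have "of_nat (fact N) * a m \<in> I (multiplicity p (fact N :: nat) + c)"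
    using A h_val[of m] by (simp add: N_def e_def)
  moreover have "a m \<in> R"
    unfolding a using fil_mem[OF b] by (intro ring_mems)
  ultimately show "a m \<in> I c" using nat_cancel[of "a m" "fact N" c] by simp
qed

end

section \<open>Subrings with a size function\<close>

definition coeffs_in :: "'a::comm_ring_1 set \<Rightarrow> 'a poly set"
  where "coeffs_in R = {A. \<forall>i. coeff A i \<in> R}"

definition adjoin :: "'a::comm_ring_1 set \<Rightarrow> 'a \<Rightarrow> 'a set"
  where "adjoin R x = (\<lambda>A. poly A x) ` coeffs_in R"

context subring_of
begin

lemma coeffs_in_subring: "subring_of (coeffs_in R)"
proof
  show "1 \<in> coeffs_in R"
    by (auto simp: coeffs_in_def intro: zero_mem one_mem)
  show "A - B \<in> coeffs_in R" if "A \<in> coeffs_in R" "B \<in> coeffs_in R" for A B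
    using that by (auto simp: coeffs_in_def intro: diff_mem)
  show "A * B \<in> coeffs_in R" if "A \<in> coeffs_in R" "B \<in> coeffs_in R" for A B
    using that by (auto simp: coeffs_in_def coeff_mult intro!: sum_mem mult_mem)
qed

lemmas polys_one_mem = subring_of.one_mem[OF coeffs_in_subring]
  and polys_zero_mem = subring_of.zero_mem[OF coeffs_in_subring]
  and polys_diff_mem = subring_of.diff_mem[OF coeffs_in_subring]
  and polys_mult_mem = subring_of.mult_mem[OF coeffs_in_subring]
  and polys_ring_mems = subring_of.ring_mems[OF coeffs_in_subring]

lemma const_in: "a \<in> R \<Longrightarrow> [:a:] \<in> coeffs_in R"
  by (auto simp: coeffs_in_def coeff_pCons zero_mem split: nat.splits)

lemma monom_in: "a \<in> R \<Longrightarrow> monom a n \<in> coeffs_in R"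
  by (auto simp: coeffs_in_def zero_mem)

lemma smult_in: "a \<in> R \<Longrightarrow> A \<in> coeffs_in R \<Longrightarrow> smult a A \<in> coeffs_in R"
  by (auto simp: coeffs_in_def mult_mem)

lemma pCons_in_iff: "pCons a A \<in> coeffs_in R \<longleftrightarrow> a \<in> R \<and> A \<in> coeffs_in R"
  by (auto simp: coeffs_in_def coeff_pCons split: nat.splits)

lemma coeff_in: "A \<in> coeffs_in R \<Longrightarrow> coeff A i \<in> R"
  by (auto simp: coeffs_in_def)

lemma poly_mem: "A \<in> coeffs_in R \<Longrightarrow> x \<in> R \<Longrightarrow> poly A x \<in> R"
  by (auto simp: poly_altdef intro!: ring_mems coeff_in)

lemma adjoin_subring: "subring_of (adjoin R x)"
proof
  show "1 \<in> adjoin R x"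
    unfolding adjoin_def by (rule image_eqI[OF _ polys_one_mem]) simp
  show "a - b \<in> adjoin R x" if "a \<in> adjoin R x" "b \<in> adjoin R x" for a b
    using that unfolding adjoin_def by (auto simp flip: poly_diff intro: polys_diff_mem)
  show "a * b \<in> adjoin R x" if "a \<in> adjoin R x" "b \<in> adjoin R x" for a b
    using that unfolding adjoin_def by (auto simp flip: poly_mult intro: polys_mult_mem)
qed

lemma subset_adjoin: "R \<subseteq> adjoin R x"
  unfolding adjoin_def by (auto intro!: image_eqI const_in)

lemma generator_in_adjoin: "x \<in> adjoin R x"
  unfolding adjoin_def by (rule image_eqI[OF _ monom_in[OF one_mem, of 1]]) (simp add: poly_monom)

lemma adjoin_least: "subring_of R' \<Longrightarrow> R \<subseteq> R' \<Longrightarrow> x \<in> R' \<Longrightarrow> adjoin R x \<subseteq> R'"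
  using subring_of.poly_mem[of R' _ x] by (auto simp: adjoin_def coeffs_in_def)

end

text \<open>An integer valued substitute for a sum of absolute values of coefficients;
  \<open>\<nu> 1\<close> may exceed 1. Bounds are written 2^S below, so that products add
  exponents.\<close>

locale normed_subring = subring_of R for R :: "'a::field_char_0 set" +
  fixes \<nu> :: "'a \<Rightarrow> nat"
  assumes nu_0: "\<nu> 0 = 0"
    and nu_pos: "a \<in> R \<Longrightarrow> a \<noteq> 0 \<Longrightarrow> \<nu> a > 0"
    and nu_add: "a \<in> R \<Longrightarrow> b \<in> R \<Longrightarrow> \<nu> (a + b) \<le> \<nu> a + \<nu> b"
    and nu_mult: "a \<in> R \<Longrightarrow> b \<in> R \<Longrightarrow> \<nu> (a * b) \<le> \<nu> a * \<nu> b"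
    and nu_uminus: "a \<in> R \<Longrightarrow> \<nu> (- a) \<le> \<nu> a"
begin

lemma nu_diff: "a \<in> R \<Longrightarrow> b \<in> R \<Longrightarrow> \<nu> (a - b) \<le> \<nu> a + \<nu> b"
  using nu_add[of a "- b"] nu_uminus[of b] uminus_mem[of b] by simp

lemma nu_sum: "(\<And>x. x \<in> A \<Longrightarrow> f x \<in> R) \<Longrightarrow> \<nu> (sum f A) \<le> (\<Sum>x\<in>A. \<nu> (f x))"
proof (induction A rule: infinite_finite_induct)
  case (insert x A)
  have "\<nu> (f x + sum f A) \<le> \<nu> (f x) + \<nu> (sum f A)"
    using insert by (intro nu_add sum_mem) auto
  then show ?case using insert by fastforce
qed (auto simp: nu_0)

lemma nu_power: "a \<in> R \<Longrightarrow> \<nu> (a ^ Suc n) \<le> \<nu> a ^ Suc n"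
proof (induction n)
  case (Suc n)
  have "\<nu> (a * a ^ Suc n) \<le> \<nu> a * \<nu> (a ^ Suc n)"
    using Suc by (intro nu_mult power_mem) auto
  also have "\<dots> \<le> \<nu> a * \<nu> a ^ Suc n"
    using Suc by (intro mult_left_mono) auto
  finally show ?case by simp
qed simp

text \<open>Every step multiplies by the leading coefficient of \<open>A\<close>, even if the
  coefficient to be removed is already 0, so the power is exactly \<open>m\<close>. A step forms the
  difference of two products of sizes 2^S and 2^T, whence S + 1 per step in the exponent.\<close>

lemma pseudo_division:
  assumes A: "A \<in> coeffs_in R" "degree A = n"
    and A_le: "\<And>i. \<nu> (coeff A i) \<le> 2 ^ S"
  shows "G \<in> coeffs_in R \<Longrightarrow> (\<forall>i\<ge>n + m. coeff G i = 0) \<Longrightarrow> (\<forall>i. \<nu> (coeff G i) \<le> 2 ^ T) \<Longrightarrow>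
    \<exists>Q\<in>coeffs_in R. \<exists>B\<in>coeffs_in R. smult (lead_coeff A ^ m) G = Q * A + B \<and>
      (\<forall>i\<ge>n. coeff B i = 0) \<and> (\<forall>i\<ge>m. coeff Q i = 0) \<and> (\<forall>i. \<nu> (coeff B i) \<le> 2 ^ (T + m * (S + 1)))"
proof (induction m arbitrary: G T)
  case 0
  then show ?case by (intro bexI[of _ 0] bexI[of _ G]) (auto intro: polys_zero_mem)
next
  case (Suc m)
  define a where "a = lead_coeff A"
  have a: "a \<in> R" "coeff A n = a" "\<nu> a \<le> 2 ^ S"
    using A A_le by (auto simp: a_def coeff_in)
  define G1 where "G1 = smult a G - monom (coeff G (n + m)) m * A"
  have G1: "G1 \<in> coeffs_in R"
    unfolding G1_def using A a Suc.prems by (intro polys_ring_mems smult_in monom_in coeff_in)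
  have G1_coeff: "coeff G1 i = a * coeff G i - (if i < m then 0 else coeff G (n + m) * coeff A (i - m))" for i
    by (simp add: G1_def coeff_monom_mult)
  have "coeff G1 i = 0" if "i \<ge> n + m" for i
  proof (cases "i = n + m")
    case True
    then show ?thesis by (simp add: G1_coeff a)
  next
    case False
    then have "coeff A (i - m) = 0" "coeff G i = 0"
      using that A Suc.prems by (auto intro: coeff_eq_0)
    then show ?thesis by (simp add: G1_coeff)
  qed
  moreover have "\<nu> (coeff G1 i) \<le> 2 ^ (T + S + 1)" for i
  proof -
    have "\<nu> (a * coeff G i) \<le> 2 ^ S * 2 ^ T"
      using nu_mult[of a "coeff G i"] a Suc.prems
      by (meson coeff_in le_trans mult_le_mono)
    moreover have "\<nu> (coeff G (n + m) * coeff A (i - m)) \<le> 2 ^ T * 2 ^ S"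
      using nu_mult[of "coeff G (n + m)" "coeff A (i - m)"] A A_le Suc.prems
      by (meson coeff_in le_trans mult_le_mono)
    ultimately have *: "\<nu> (a * coeff G i) + \<nu> (coeff G (n + m) * coeff A (i - m)) \<le> 2 ^ (T + S + 1)"
      by (simp add: power_add mult.commute)
    show ?thesis
    proof (cases "i < m")
      case True
      then show ?thesis using * by (simp add: G1_coeff)
    next
      case False
      have "\<nu> (a * coeff G i - coeff G (n + m) * coeff A (i - m)) \<le>
          \<nu> (a * coeff G i) + \<nu> (coeff G (n + m) * coeff A (i - m))"
        using A a Suc.prems by (intro nu_diff mult_mem coeff_in)
      then show ?thesis using * False by (simp add: G1_coeff)
    qed
  qed
  ultimately obtain Q B where QB: "Q \<in> coeffs_in R" "B \<in> coeffs_in R"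
    "smult (a ^ m) G1 = Q * A + B" "\<forall>i\<ge>n. coeff B i = 0" "\<forall>i\<ge>m. coeff Q i = 0"
    "\<forall>i. \<nu> (coeff B i) \<le> 2 ^ (T + S + 1 + m * (S + 1))"
    using Suc.IH[OF G1, of "T + S + 1"] unfolding a_def by blast
  show ?case
  proof (intro bexI conjI)
    show "smult (lead_coeff A ^ Suc m) G = (Q + monom (a ^ m * coeff G (n + m)) m) * A + B"
    proof -
      have "smult (lead_coeff A ^ Suc m) G = smult (a ^ m) G1 + smult (a ^ m) (monom (coeff G (n + m)) m * A)"
        unfolding G1_def a_def by (simp add: smult_diff_right mult.commute)
      moreover have "smult (a ^ m) (monom (coeff G (n + m)) m * A) = monom (a ^ m * coeff G (n + m)) m * A"
        by (simp add: smult_monom flip: mult_smult_left)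
      ultimately show ?thesis unfolding QB(3) by (simp add: algebra_simps)
    qed
    show "Q + monom (a ^ m * coeff G (n + m)) m \<in> coeffs_in R"
      using QB a Suc.prems by (intro polys_ring_mems monom_in ring_mems coeff_in)
  qed (use QB in \<open>auto simp: algebra_simps\<close>)
qed

text \<open>
  Euclid's algorithm, with pseudo-division, applied to \<open>f\<close> and \<open>A\<close> produces a multiple of \<open>A(x)\<close>
  in \<open>R\<close> of controlled size; it takes the place of a norm.
\<close>

lemma elimination:
  assumes f: "f \<in> coeffs_in R" "f \<noteq> 0" "poly f x = 0"
    and min: "\<And>A. A \<in> coeffs_in R \<Longrightarrow> degree A < degree f \<Longrightarrow> poly A x = 0 \<Longrightarrow> A = 0"
  shows "n \<le> degree f \<Longrightarrow> \<exists>C. \<forall>S. \<forall>A\<in>coeffs_in R. A \<noteq> 0 \<and> degree A < n \<and> (\<forall>i. \<nu> (coeff A i) \<le> 2 ^ S) \<longrightarrow>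
    (\<exists>B\<in>coeffs_in R. \<exists>c\<in>R. c \<noteq> 0 \<and> poly B x * poly A x = c \<and> \<nu> c \<le> 2 ^ (C * (S + 1)))"
proof (induction n)
  case 0
  then show ?case by auto
next
  case (Suc n)
  define D where "D = degree f"
  obtain C where C: "\<And>S A. A \<in> coeffs_in R \<Longrightarrow> A \<noteq> 0 \<Longrightarrow> degree A < n \<Longrightarrow> (\<forall>i. \<nu> (coeff A i) \<le> 2 ^ S) \<Longrightarrow>
     (\<exists>B\<in>coeffs_in R. \<exists>c\<in>R. c \<noteq> 0 \<and> poly B x * poly A x = c \<and> \<nu> c \<le> 2 ^ (C * (S + 1)))"
    using Suc by (meson Suc_leD)
  define T where "T = (\<Sum>i\<le>D. \<nu> (coeff f i))"
  have T: "\<nu> (coeff f i) \<le> 2 ^ T" for i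
  proof (cases "i \<le> D")
    case True
    then have "\<nu> (coeff f i) \<le> T" unfolding T_def by (intro member_le_sum) auto
    also have "T \<le> 2 ^ T" by (rule less_imp_le) (rule less_exp)
    finally show ?thesis .
  qed (simp add: D_def coeff_eq_0 nu_0)
  \<comment> \<open>The remainder formed below has exponent T + m (S + 1) with m \<le> D. With the 1
    required by the induction hypothesis this is at most (T + D + 2) (S + 1).\<close>
  define C' where "C' = Suc C * (T + D + 2)"
  show ?case
  proof (intro exI[of _ C'] allI ballI impI)
    fix S A
    assume A: "A \<in> coeffs_in R" and asm: "A \<noteq> 0 \<and> degree A < Suc n \<and> (\<forall>i. \<nu> (coeff A i) \<le> 2 ^ S)"
    have A_le: "\<And>i. \<nu> (coeff A i) \<le> 2 ^ S" using asm by blast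
    consider "degree A < n" | "degree A = n" "n = 0" | "degree A = n" "n > 0" using asm by linarith
    then show "\<exists>B\<in>coeffs_in R. \<exists>c\<in>R. c \<noteq> 0 \<and> poly B x * poly A x = c \<and> \<nu> c \<le> 2 ^ (C' * (S + 1))"
    proof cases
      case 1
      obtain B c where Bc: "B \<in> coeffs_in R" "c \<in> R" "c \<noteq> 0" "poly B x * poly A x = c" "\<nu> c \<le> 2 ^ (C * (S + 1))"
        using C[of A S] A asm 1 by blast
      have "C * (S + 1) \<le> C' * (S + 1)"
        unfolding C'_def by (intro mult_le_mono) auto
      then have "(2::nat) ^ (C * (S + 1)) \<le> 2 ^ (C' * (S + 1))" by (intro power_increasing) auto
      then show ?thesis using Bc by (meson le_trans)
    next
      case 2
      then obtain c where c: "A = [:c:]" by (metis degree_eq_zeroE)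
      have "S \<le> C' * (S + 1)" unfolding C'_def by (simp add: algebra_simps)
      then have "(2::nat) ^ S \<le> 2 ^ (C' * (S + 1))" by (intro power_increasing) auto
      moreover have "\<nu> c \<le> 2 ^ S" using A_le[of 0] by (simp add: c)
      ultimately have "\<nu> c \<le> 2 ^ (C' * (S + 1))" by (rule le_trans[rotated])
      moreover have "poly 1 x * poly A x = c" "c \<in> R" "c \<noteq> 0"
        using A asm by (auto simp: c pCons_in_iff)
      ultimately show ?thesis using polys_one_mem by blast
    next
      case 3
      define m where "m = D - n + 1"
      have m: "n + m = D + 1" "m \<le> D" using Suc.prems 3 unfolding m_def D_def by auto
      obtain Q B where QB: "Q \<in> coeffs_in R" "B \<in> coeffs_in R"
        "smult (lead_coeff A ^ m) f = Q * A + B" "\<forall>i\<ge>n. coeff B i = 0" "\<forall>i\<ge>m. coeff Q i = 0"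
        "\<forall>i. \<nu> (coeff B i) \<le> 2 ^ (T + m * (S + 1))"
        using pseudo_division[OF A 3(1) A_le f(1), of m T] m T by (auto simp: D_def coeff_eq_0)
      have "Q \<noteq> 0"
      proof
        assume "Q = 0"
        then have "lead_coeff A ^ m * coeff f D = coeff B D"
          using QB(3) by (metis add_0 coeff_smult mult_zero_left)
        then show False using QB(4) Suc.prems f asm by (auto simp: D_def)
      qed
      moreover have "degree Q < degree f"
        using QB(5) m 3 \<open>Q \<noteq> 0\<close> by (intro degree_lessI) (auto simp: D_def)
      \<comment> \<open>Here n > 0 matters: it makes the degree of \<open>Q\<close> smaller than
        that of \<open>f\<close>, so minimality of \<open>f\<close> excludes Q(x) = 0.\<close>
      ultimately have "poly Q x \<noteq> 0" using min[OF QB(1)] by blast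
      moreover have "poly A x \<noteq> 0" using min[OF A] asm Suc.prems by auto
      \<comment> \<open>As f(x) = 0, division turns into Q(x) A(x) = - B(x): every multiple of B(x)
        is one of A(x), and \<open>B\<close> has smaller degree.\<close>
      moreover have rel: "poly Q x * poly A x + poly B x = 0"
        using arg_cong[OF QB(3), of "\<lambda>q. poly q x"] f(3) by simp
      ultimately have "poly B x \<noteq> 0" by auto
      then have "B \<noteq> 0" by auto
      moreover have "degree B < n" using QB(4) 3 by (intro degree_lessI) auto
      ultimately obtain B1 c where Bc: "B1 \<in> coeffs_in R" "c \<in> R" "c \<noteq> 0" "poly B1 x * poly B x = c"
          "\<nu> c \<le> 2 ^ (C * (T + m * (S + 1) + 1))"
        using C[OF QB(2) _ _ QB(6)] by blast
      have "T + m * (S + 1) + 1 \<le> (T + D + 2) * (S + 1)"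
        using mult_le_mono1[OF m(2), of "S + 1"] by (simp add: algebra_simps)
      then have "C * (T + m * (S + 1) + 1) \<le> Suc C * ((T + D + 2) * (S + 1))"
        by (intro mult_le_mono) auto
      then have "C * (T + m * (S + 1) + 1) \<le> C' * (S + 1)"
        by (simp only: C'_def mult.assoc)
      then have "(2::nat) ^ (C * (T + m * (S + 1) + 1)) \<le> 2 ^ (C' * (S + 1))"
        by (intro power_increasing) auto
      moreover have "poly (- (B1 * Q)) x * poly A x = c"
      proof -
        have "poly B x = - (poly Q x * poly A x)" using rel by (simp add: eq_neg_iff_add_eq_0 add.commute)
        then show ?thesis using Bc(4) by (simp add: algebra_simps)
      qed
      ultimately show ?thesis using Bc QB(1) polys_ring_mems by (meson le_trans)
    qed
  qed
qed

end

section \<open>Extensions of arithmetic frames\<close>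

text \<open>
  The last axiom is a Liouville inequality: an element of size at most \<open>2 ^ S\<close> is not divisible by
  a power of \<open>I 1\<close> whose exponent is large compared to \<open>S\<close>, not even after multiplication by
  something that is not nilpotent modulo \<open>I 1\<close>.
\<close>

locale arith_frame = padic_ring R I p + normed_subring R \<nu>
  for R :: "'a::field_char_0 set" and I p \<nu> +
  assumes one_notin: "1 \<notin> I 1"
    and liouville: "\<exists>C. \<forall>S. \<forall>b\<in>R. \<forall>\<sigma>\<in>R.
      b \<noteq> 0 \<and> \<nu> b \<le> 2 ^ S \<and> \<sigma> * b \<in> I (C * (S + 1)) \<longrightarrow> (\<exists>M. \<sigma> ^ M \<in> I 1)"

text \<open>
  The frame is extended to \<open>R[x]\<close>, where \<open>x\<close> gets weight \<open>w\<close> in the filtration and size \<open>K\<close>: the weight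
  is \<open>1\<close> for transcendental \<open>x\<close>, and \<open>0\<close> if \<open>x\<close> is integral or the inverse of a unit modulo \<open>I 1\<close>.
\<close>

locale frame_extension = arith_frame R I p \<nu>
  for R :: "'a::field_char_0 set" and I p \<nu> +
  fixes x :: 'a and K w :: nat
  assumes K_ge_2: "K \<ge> 2"
begin

lemma K_pos [simp]: "K > 0"
  using K_ge_2 by simp

text \<open>The filtration in which \<open>x\<close> has order \<open>w\<close>. The truncated
  difference is intended: once w i \<ge> c, the coefficient of index i is free in
  \<open>I 0\<close>.\<close>

definition ext_I :: "nat \<Rightarrow> 'a set"
  where "ext_I c = (\<lambda>A. poly A x) ` {A. \<forall>i. coeff A i \<in> I (c - w * i)}"

definition pnorm :: "'a poly \<Rightarrow> nat"
  where "pnorm A = poly (map_poly \<nu> A) K"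

text \<open>The quotient norm of \<open>pnorm\<close> under evaluation at \<open>x\<close>; an
  element of R[x] can have many representations when \<open>x\<close> is algebraic.\<close>

definition ext_nu :: "'a \<Rightarrow> nat"
  where "ext_nu b = (LEAST n. \<exists>A\<in>coeffs_in R. poly A x = b \<and> pnorm A = n)"

lemma pnorm_0: "pnorm 0 = 0"
  by (simp add: pnorm_def)

lemma pnorm_pCons: "pnorm (pCons a A) = \<nu> a + K * pnorm A"
  by (simp add: pnorm_def map_poly_pCons nu_0)

lemma pnorm_monom: "pnorm (monom a n) = \<nu> a * K ^ n"
  by (induction n) (auto simp: monom_0 monom_Suc pnorm_pCons pnorm_0 nu_0)

lemma coeff_le_pnorm: "\<nu> (coeff A i) * K ^ i \<le> pnorm A"
proof (induction A arbitrary: i)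
  case (pCons a A)
  show ?case
  proof (cases i)
    case (Suc j)
    have "\<nu> (coeff A j) * K ^ Suc j = K * (\<nu> (coeff A j) * K ^ j)" by simp
    also have "\<dots> \<le> K * pnorm A" by (rule mult_le_mono2[OF pCons(2)])
    finally show ?thesis unfolding Suc by (simp only: pnorm_pCons coeff_pCons_Suc)
  qed (simp add: pnorm_pCons)
qed (simp add: nu_0)

lemma nu_coeff_le: "\<nu> (coeff A i) \<le> pnorm A"
proof -
  have "\<nu> (coeff A i) * 1 \<le> \<nu> (coeff A i) * K ^ i"
    using K_ge_2 by (intro mult_le_mono2) auto
  then show ?thesis using coeff_le_pnorm[of A i] by linarith
qed

text \<open>Size controls degree: since K \<ge> 2, a nonzero coefficient of index i contributes at
  least 2^i.\<close>

lemma index_le: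
  assumes "A \<in> coeffs_in R" "coeff A i \<noteq> 0" "pnorm A \<le> 2 ^ S"
  shows "i \<le> S"
proof -
  have "(2::nat) ^ i \<le> K ^ i" using K_ge_2 by (intro power_mono) auto
  also have "\<dots> \<le> \<nu> (coeff A i) * K ^ i"
    using nu_pos[of "coeff A i"] assms coeff_in[of A i] by simp
  also have "\<dots> \<le> 2 ^ S" using coeff_le_pnorm[of A i] assms by linarith
  finally show ?thesis by simp
qed

lemma pnorm_add: "A \<in> coeffs_in R \<Longrightarrow> B \<in> coeffs_in R \<Longrightarrow> pnorm (A + B) \<le> pnorm A + pnorm B"
proof (induction A B rule: poly_induct2)
  case (pCons a A b B)
  have "\<nu> (a + b) \<le> \<nu> a + \<nu> b" using pCons.prems by (intro nu_add) (auto simp: pCons_in_iff)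
  moreover have "K * pnorm (A + B) \<le> K * (pnorm A + pnorm B)"
    using pCons by (intro mult_le_mono2) (auto simp: pCons_in_iff)
  ultimately show ?case by (simp add: pnorm_pCons algebra_simps)
qed (simp add: pnorm_0)

lemma pnorm_uminus: "A \<in> coeffs_in R \<Longrightarrow> pnorm (- A) \<le> pnorm A"
proof (induction A)
  case (pCons a A)
  have "\<nu> (- a) \<le> \<nu> a" using pCons.prems by (intro nu_uminus) (auto simp: pCons_in_iff)
  moreover have "K * pnorm (- A) \<le> K * pnorm A"
    using pCons by (intro mult_le_mono2) (auto simp: pCons_in_iff)
  ultimately have "\<nu> (- a) + K * pnorm (- A) \<le> \<nu> a + K * pnorm A" by (rule add_mono)
  then show ?case by (simp add: pnorm_pCons)
qed (simp add: pnorm_0)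

lemma pnorm_diff: "A \<in> coeffs_in R \<Longrightarrow> B \<in> coeffs_in R \<Longrightarrow> pnorm (A - B) \<le> pnorm A + pnorm B"
  using pnorm_add[of A "- B"] pnorm_uminus[of B] polys_ring_mems(5)[of B] by simp

lemma pnorm_smult: "a \<in> R \<Longrightarrow> A \<in> coeffs_in R \<Longrightarrow> pnorm (smult a A) \<le> \<nu> a * pnorm A"
proof (induction A)
  case (pCons b A)
  have "\<nu> (a * b) \<le> \<nu> a * \<nu> b" using pCons.prems by (intro nu_mult) (auto simp: pCons_in_iff)
  moreover have "K * pnorm (smult a A) \<le> K * (\<nu> a * pnorm A)"
    using pCons by (intro mult_le_mono2) (auto simp: pCons_in_iff)
  ultimately have "\<nu> (a * b) + K * pnorm (smult a A) \<le> \<nu> a * \<nu> b + K * (\<nu> a * pnorm A)"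
    by (rule add_mono)
  then show ?case by (simp add: pnorm_pCons algebra_simps)
qed (simp add: pnorm_0)

lemma pnorm_mult: "A \<in> coeffs_in R \<Longrightarrow> B \<in> coeffs_in R \<Longrightarrow> pnorm (A * B) \<le> pnorm A * pnorm B"
proof (induction A)
  case (pCons a A)
  have *: "a \<in> R" "A \<in> coeffs_in R" using pCons.prems by (auto simp: pCons_in_iff)
  have "pnorm (pCons a A * B) \<le> pnorm (smult a B) + pnorm (pCons 0 (A * B))"
    using * pCons.prems
    by (simp only: mult_pCons_left, intro pnorm_add)
      (auto simp: pCons_in_iff zero_mem intro!: smult_in polys_mult_mem)
  also have "\<dots> \<le> \<nu> a * pnorm B + K * pnorm (A * B)"
    using pnorm_smult[of a B] * pCons.prems by (simp add: pnorm_pCons nu_0)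
  also have "K * pnorm (A * B) \<le> K * (pnorm A * pnorm B)"
    using pCons * by (intro mult_le_mono2) auto
  finally show ?case by (simp add: pnorm_pCons algebra_simps)
qed (simp add: pnorm_0)

lemma ext_nu_le: "A \<in> coeffs_in R \<Longrightarrow> ext_nu (poly A x) \<le> pnorm A"
  unfolding ext_nu_def by (rule Least_le) blast

lemma ext_nu_attained:
  assumes "b \<in> adjoin R x"
  obtains A where "A \<in> coeffs_in R" "poly A x = b" "pnorm A = ext_nu b"
proof -
  have "\<exists>A\<in>coeffs_in R. poly A x = b \<and> pnorm A = ext_nu b"
    unfolding ext_nu_def
    by (rule LeastI_ex) (use assms in \<open>auto simp: adjoin_def\<close>)
  then show ?thesis using that by blast
qed

lemma ext_normed: "normed_subring (adjoin R x) ext_nu"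
proof -
  interpret S: subring_of "adjoin R x" by (rule adjoin_subring)
  show ?thesis
  proof
    show "ext_nu 0 = 0"
      using ext_nu_le[of 0] polys_zero_mem by (simp add: pnorm_0)
    show "ext_nu a > 0" if a: "a \<in> adjoin R x" "a \<noteq> 0" for a
    proof (rule ccontr)
      assume "\<not> ext_nu a > 0"
      then obtain A where A: "A \<in> coeffs_in R" "poly A x = a" "pnorm A = 0"
        using ext_nu_attained[OF a(1)] by auto
      then have "\<nu> (coeff A i) = 0" for i using nu_coeff_le[of A i] by simp
      then have "coeff A i = 0" for i using nu_pos[of "coeff A i"] A(1) coeff_in by fastforce
      then have "A = 0" by (simp add: poly_eq_iff)
      then show False using A a by simp
    qed
    fix a b assume a: "a \<in> adjoin R x" and b: "b \<in> adjoin R x"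
    obtain A where A: "A \<in> coeffs_in R" "poly A x = a" "pnorm A = ext_nu a"
      using ext_nu_attained[OF a] .
    obtain B where B: "B \<in> coeffs_in R" "poly B x = b" "pnorm B = ext_nu b"
      using ext_nu_attained[OF b] .
    show "ext_nu (a + b) \<le> ext_nu a + ext_nu b"
      using ext_nu_le[of "A + B"] pnorm_add[of A B] polys_ring_mems(4)[of A B] A B by simp
    show "ext_nu (a * b) \<le> ext_nu a * ext_nu b"
      using ext_nu_le[of "A * B"] pnorm_mult[of A B] polys_ring_mems(6)[of A B] A B by simp
    show "ext_nu (- a) \<le> ext_nu a"
      using ext_nu_le[of "- A"] pnorm_uminus[of A] polys_ring_mems(5)[of A] A by simp
  qed
qed

lemma ext_I_in: "A \<in> coeffs_in R \<Longrightarrow> (\<And>i. coeff A i \<in> I (c - w * i)) \<Longrightarrow> poly A x \<in> ext_I c"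
  by (auto simp: ext_I_def)

lemma ext_I_elim:
  assumes "b \<in> ext_I c"
  obtains A where "A \<in> coeffs_in R" "poly A x = b" "\<And>i. coeff A i \<in> I (c - w * i)"
  using assms fil_mem unfolding ext_I_def coeffs_in_def by blast

lemma ext_I_const: "a \<in> I c \<Longrightarrow> a \<in> ext_I c"
  using ext_I_in[of "[:a:]" c] fil_zero fil_mem[of a c]
  by (auto simp: const_in coeff_pCons split: nat.splits)

lemma ext_filtered: "filtered_ring (adjoin R x) ext_I"
proof -
  interpret S: subring_of "adjoin R x" by (rule adjoin_subring)
  show ?thesis
  proof
    show "ext_I 0 = adjoin R x"
      by (simp add: ext_I_def adjoin_def coeffs_in_def fil_0)
    show "ext_I (Suc c) \<subseteq> ext_I c" for c
    proof
      fix b assume "b \<in> ext_I (Suc c)"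
      then obtain A where A: "A \<in> coeffs_in R" "poly A x = b" "\<And>i. coeff A i \<in> I (Suc c - w * i)"
        by (rule ext_I_elim) blast
      have "coeff A i \<in> I (c - w * i)" for i by (rule fil_antimono[OF A(3)[of i]]) simp
      then show "b \<in> ext_I c" using ext_I_in[OF A(1)] A(2) by blast
    qed
    show "0 \<in> ext_I c" for c by (rule ext_I_const[OF fil_zero])
    show "a - b \<in> ext_I c" if ab: "a \<in> ext_I c" "b \<in> ext_I c" for a b c
    proof -
      obtain A where A: "A \<in> coeffs_in R" "poly A x = a" "\<And>i. coeff A i \<in> I (c - w * i)"
        using ext_I_elim[OF ab(1)] by blast
      obtain B where B: "B \<in> coeffs_in R" "poly B x = b" "\<And>i. coeff B i \<in> I (c - w * i)"
        using ext_I_elim[OF ab(2)] by blast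
      show ?thesis using ext_I_in[OF polys_diff_mem[OF A(1) B(1)], of c] A B by (simp add: fil_diff)
    qed
    show "a * b \<in> ext_I (i + j)" if ab: "a \<in> ext_I i" "b \<in> ext_I j" for a b i j
    proof -
      obtain A where A: "A \<in> coeffs_in R" "poly A x = a" "\<And>l. coeff A l \<in> I (i - w * l)"
        using ext_I_elim[OF ab(1)] by blast
      obtain B where B: "B \<in> coeffs_in R" "poly B x = b" "\<And>l. coeff B l \<in> I (j - w * l)"
        using ext_I_elim[OF ab(2)] by blast
      have "coeff (A * B) n \<in> I (i + j - w * n)" for n
        unfolding coeff_mult
      proof (rule fil_sum)
        fix l assume l: "l \<in> {..n}"
        then have "w * n = w * l + w * (n - l)" by (simp flip: distrib_left)
        then have "i + j - w * n \<le> (i - w * l) + (j - w * (n - l))" by linarith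
        then show "coeff A l * coeff B (n - l) \<in> I (i + j - w * n)"
          by (rule fil_antimono[OF fil_mult[OF A(3) B(3)]])
      qed
      then show ?thesis using ext_I_in[OF polys_mult_mem[OF A(1) B(1)], of "i + j"] A B by simp
    qed
  qed
qed

text \<open>The hypotheses collect what depends on \<open>x\<close>. In \<open>quot\<close>,
  coefficients from index n on already have the required order, so only n coefficients remain to be
  approximated by elements of a finite set.\<close>

lemma ext_frame:
  assumes cancel: "\<And>A i. A \<in> coeffs_in R \<Longrightarrow> of_nat p * poly A x \<in> ext_I (Suc i) \<Longrightarrow> poly A x \<in> ext_I i"
    and quot: "\<And>c. \<exists>n. \<forall>A\<in>coeffs_in R. \<exists>B\<in>coeffs_in R. poly B x = poly A x \<and>
       (\<forall>i\<ge>n. coeff B i \<in> I (c - w * i))"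
    and one: "1 \<notin> ext_I 1"
    and liou: "\<exists>C. \<forall>S. \<forall>b\<in>adjoin R x. \<forall>\<sigma>\<in>adjoin R x.
      b \<noteq> 0 \<and> ext_nu b \<le> 2 ^ S \<and> \<sigma> * b \<in> ext_I (C * (S + 1)) \<longrightarrow> (\<exists>M. \<sigma> ^ M \<in> ext_I 1)"
  shows "arith_frame (adjoin R x) ext_I p ext_nu"
proof -
  interpret S: filtered_ring "adjoin R x" ext_I by (rule ext_filtered)
  interpret T: normed_subring "adjoin R x" ext_nu by (rule ext_normed)
  show ?thesis
  proof unfold_locales
    show "prime p" "p > 2" by (rule prime_p p_gt_2)+
    show "of_nat p \<in> ext_I 1" by (rule ext_I_const[OF p_mem])
    show "a \<in> ext_I i" if a: "a \<in> adjoin R x" "of_nat p * a \<in> ext_I (Suc i)" for a i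
    proof -
      obtain A where A: "A \<in> coeffs_in R" "poly A x = a" using a(1) unfolding adjoin_def by blast
      show ?thesis by (rule cancel[OF A(1), of i, unfolded A(2), OF a(2)])
    qed
    show "\<exists>F. finite F \<and> (\<forall>a\<in>adjoin R x. \<exists>b\<in>F. a - b \<in> ext_I c)" for c
    proof -
      from quot[of c] obtain n where n: "\<forall>A\<in>coeffs_in R. \<exists>B\<in>coeffs_in R. poly B x = poly A x \<and>
         (\<forall>i\<ge>n. coeff B i \<in> I (c - w * i))" ..
      obtain F where F: "finite F" "\<And>a. a \<in> R \<Longrightarrow> \<exists>b\<in>F. a - b \<in> I c"
        using finite_quot[of c] by blast
      define G where "G = (\<lambda>l. poly (Poly l) x) ` {l. set l \<subseteq> F \<and> length l = n}"
      have "finite G" unfolding G_def using F by (intro finite_imageI finite_lists_length_eq)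
      moreover have "\<exists>b\<in>G. a - b \<in> ext_I c" if a: "a \<in> adjoin R x" for a
      proof -
        obtain B where B: "B \<in> coeffs_in R" "poly B x = a" "\<And>i. i \<ge> n \<Longrightarrow> coeff B i \<in> I (c - w * i)"
          using a n unfolding adjoin_def by (elim imageE) (metis (no_types, lifting))
        obtain r where r: "\<And>a. a \<in> R \<Longrightarrow> r a \<in> F \<and> a - r a \<in> I c"
          using F(2) by metis
        define l where "l = map (\<lambda>i. r (coeff B i)) [0..<n]"
        have "poly (Poly l) x \<in> G"
        proof -
          have "r (coeff B i) \<in> F" for i using r[OF coeff_in[OF B(1)]] by blast
          then have "set l \<subseteq> F \<and> length l = n" by (auto simp: l_def)
          then show ?thesis unfolding G_def by (intro imageI CollectI)
        qed
        moreover have *: "coeff (B - Poly l) i \<in> I (c - w * i)" for i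
        proof (cases "i < n")
          case True
          have "coeff B i - r (coeff B i) \<in> I (c - w * i)"
            by (rule fil_antimono[OF conjunct2[OF r[OF coeff_in[OF B(1)]]]]) simp
          then show ?thesis using True by (simp add: l_def nth_default_def)
        next
          case False
          then show ?thesis using B(3)[of i] by (simp add: l_def nth_default_def)
        qed
        moreover have "B - Poly l \<in> coeffs_in R" using fil_mem[OF *] by (auto simp: coeffs_in_def)
        ultimately have "a - poly (Poly l) x \<in> ext_I c"
          using ext_I_in[of "B - Poly l" c] B(2) by simp
        then show ?thesis using \<open>poly (Poly l) x \<in> G\<close> by blast
      qed
      ultimately show ?thesis by blast
    qed
    show "1 \<notin> ext_I 1" by (rule one)
    show "\<exists>C. \<forall>S. \<forall>b\<in>adjoin R x. \<forall>\<sigma>\<in>adjoin R x.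
      b \<noteq> 0 \<and> ext_nu b \<le> 2 ^ S \<and> \<sigma> * b \<in> ext_I (C * (S + 1)) \<longrightarrow> (\<exists>M. \<sigma> ^ M \<in> ext_I 1)"
      by (rule liou)
  qed
qed

end

section \<open>Units and nilpotents modulo the filtration\<close>

context filtered_ring
begin

text \<open>Successive approximation: adding h (1 - g k) to \<open>k\<close> multiplies the error 1
  - g k by 1 - g h, which has order 1.\<close>

lemma unit_inverse:
  assumes "g \<in> R" "h \<in> R" "1 - g * h \<in> I 1"
  shows "\<exists>k\<in>R. 1 - g * k \<in> I c"
proof (induction c)
  case 0
  then show ?case using assms by (auto simp: fil_0 intro!: bexI[of _ h] ring_mems)
next
  case (Suc c)
  then obtain k where k: "k \<in> R" "1 - g * k \<in> I c" by blast
  have "1 - g * (k + h * (1 - g * k)) = (1 - g * h) * (1 - g * k)"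
    by (simp add: algebra_simps)
  then have "1 - g * (k + h * (1 - g * k)) \<in> I (Suc c)"
    using fil_mult[OF assms(3) k(2)] by simp
  then show ?case using k assms by (blast intro: ring_mems)
qed

lemma unit_cancel:
  assumes "g \<in> R" "h \<in> R" "1 - g * h \<in> I 1" "a \<in> R" "g * a \<in> I c"
  shows "a \<in> I c"
proof -
  obtain k where k: "k \<in> R" "1 - g * k \<in> I c" using unit_inverse[OF assms(1-3)] by blast
  have "a = a * (1 - g * k) + k * (g * a)" by (simp add: algebra_simps)
  also have "\<dots> \<in> I c"
    by (rule fil_add[OF fil_mult_left[OF assms(4) k(2)] fil_mult_left[OF k(1) assms(5)]])
  finally show ?thesis .
qed

lemma nil_add:
  assumes "a \<in> R" "b \<in> R" "a ^ m \<in> I 1" "b ^ n \<in> I 1"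
  shows "(a + b) ^ (m + n) \<in> I 1"
  unfolding binomial_ring
proof (rule fil_sum)
  fix k assume "k \<in> {..m + n}"
  then consider "m \<le> k" | "n \<le> m + n - k" "k \<le> m + n" by fastforce
  then have "a ^ k * b ^ (m + n - k) \<in> I 1"
  proof cases
    case 1
    then have "a ^ k = a ^ (k - m) * a ^ m" by (simp flip: power_add)
    then have "a ^ k * b ^ (m + n - k) = (a ^ (k - m) * b ^ (m + n - k)) * a ^ m"
      by (simp add: mult_ac)
    then show ?thesis using assms by (auto intro!: fil_mult_left ring_mems)
  next
    case 2
    then have "b ^ (m + n - k) = b ^ (m - k) * b ^ n" by (simp flip: power_add)
    then have "a ^ k * b ^ (m + n - k) = (a ^ k * b ^ (m - k)) * b ^ n"
      by (simp add: mult_ac)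
    then show ?thesis using assms by (auto intro!: fil_mult_left ring_mems)
  qed
  then show "of_nat (m + n choose k) * a ^ k * b ^ (m + n - k) \<in> I 1"
    using fil_mult_left[OF of_nat_mem[of "m + n choose k"]] by (simp add: mult.assoc)
qed

lemma nil_sum:
  "finite A \<Longrightarrow> (\<And>i. i \<in> A \<Longrightarrow> f i \<in> R \<and> (\<exists>M. f i ^ M \<in> I 1)) \<Longrightarrow> \<exists>M. sum f A ^ M \<in> I 1"
proof (induction A rule: finite_induct)
  case empty
  then show ?case by (intro exI[of _ 1]) (simp add: fil_zero)
next
  case (insert x A)
  then obtain m n where "f x ^ m \<in> I 1" "sum f A ^ n \<in> I 1" by blast
  then have "(f x + sum f A) ^ (m + n) \<in> I 1"
    using insert by (intro nil_add sum_mem) auto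
  then show ?case using insert by auto
qed

end

section \<open>Adjoining a transcendental element or the inverse of a unit\<close>

context frame_extension
begin

text \<open>Representations by polynomials over \<open>R\<close> are unique here, so orders in R[x]
  are read off coefficient by coefficient.\<close>

lemma frame_transcendental:
  assumes w: "w = 1" and trans: "\<And>A. A \<in> coeffs_in R \<Longrightarrow> poly A x = 0 \<Longrightarrow> A = 0"
  shows "arith_frame (adjoin R x) ext_I p ext_nu"
proof (rule ext_frame)
  have unique: "A = B" if "A \<in> coeffs_in R" "B \<in> coeffs_in R" "poly A x = poly B x" for A B
    using trans[of "A - B"] polys_diff_mem[of A B] that by simp
  have coeff_I: "coeff A i \<in> I (c - i)" if A: "A \<in> coeffs_in R" "poly A x \<in> ext_I c" for A c i
  proof -
    obtain B where B: "B \<in> coeffs_in R" "poly B x = poly A x" "\<And>i. coeff B i \<in> I (c - w * i)"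
      using ext_I_elim[OF A(2)] by blast
    then show ?thesis using unique[OF A(1) B(1)] w by simp
  qed
  show "poly A x \<in> ext_I i" if A: "A \<in> coeffs_in R" "of_nat p * poly A x \<in> ext_I (Suc i)" for A i
  proof (rule ext_I_in[OF A(1)])
    fix j
    have "poly (smult (of_nat p) A) x \<in> ext_I (Suc i)" using A(2) by simp
    then have *: "of_nat p * coeff A j \<in> I (Suc i - j)"
      using coeff_I[of "smult (of_nat p) A" "Suc i" j] A(1) by (simp add: smult_in of_nat_mem)
    have "coeff A j \<in> I (i - j)"
    proof (cases "j \<le> i")
      case True
      then show ?thesis using * p_cancel[OF coeff_in[OF A(1)]] by (simp add: Suc_diff_le)
    next
      case False
      then show ?thesis by (simp add: fil_0 coeff_in[OF A(1)])
    qed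
    then show "coeff A j \<in> I (i - w * j)" by (simp add: w)
  qed
  show "\<exists>n. \<forall>A\<in>coeffs_in R. \<exists>B\<in>coeffs_in R. poly B x = poly A x \<and>
       (\<forall>i\<ge>n. coeff B i \<in> I (c - w * i))" for c
    by (rule exI[of _ c]) (auto simp: w fil_0 intro!: coeff_in)
  show "1 \<notin> ext_I 1"
  proof
    assume "1 \<in> ext_I 1"
    then have "coeff 1 0 \<in> I (1 - 0)" by (intro coeff_I polys_one_mem) simp
    then show False using one_notin by simp
  qed
  obtain C where C: "\<And>S b \<sigma>. b \<in> R \<Longrightarrow> \<sigma> \<in> R \<Longrightarrow> b \<noteq> 0 \<Longrightarrow> \<nu> b \<le> 2 ^ S \<Longrightarrow>
      \<sigma> * b \<in> I (C * (S + 1)) \<Longrightarrow> \<exists>M. \<sigma> ^ M \<in> I 1"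
    using liouville by blast
  show "\<exists>C. \<forall>S. \<forall>b\<in>adjoin R x. \<forall>\<sigma>\<in>adjoin R x.
      b \<noteq> 0 \<and> ext_nu b \<le> 2 ^ S \<and> \<sigma> * b \<in> ext_I (C * (S + 1)) \<longrightarrow> (\<exists>M. \<sigma> ^ M \<in> ext_I 1)"
  \<comment> \<open>In the product, the lowest nonzero coefficient of \<open>b\<close> meets only
    the constant coefficient of \<sigma>. Its index j \<le> S lowers the order, which the extra 1 in
    C + 1 pays for. Since \<open>x\<close> has order 1, \<sigma> agrees modulo
    \<open>ext_I 1\<close> with its constant coefficient.\<close>
  proof (rule exI[of _ "C + 1"], intro allI ballI impI, elim conjE)
    fix S b \<sigma>
    assume b: "b \<in> adjoin R x" "b \<noteq> 0" "ext_nu b \<le> 2 ^ S"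
      and s: "\<sigma> \<in> adjoin R x" "\<sigma> * b \<in> ext_I ((C + 1) * (S + 1))"
    obtain A where A: "A \<in> coeffs_in R" "poly A x = b" "pnorm A = ext_nu b"
      using ext_nu_attained[OF b(1)] .
    obtain B where B: "B \<in> coeffs_in R" "poly B x = \<sigma>" using s(1) by (auto simp: adjoin_def)
    have "A \<noteq> 0" using A b by auto
    define j where "j = (LEAST j. coeff A j \<noteq> 0)"
    have "\<exists>j. coeff A j \<noteq> 0" using \<open>A \<noteq> 0\<close> by (auto simp: poly_eq_iff)
    then have j: "coeff A j \<noteq> 0" "\<And>i. i < j \<Longrightarrow> coeff A i = 0"
      unfolding j_def by (rule LeastI_ex) (drule not_less_Least, simp)
    have jS: "j \<le> S" using index_le[OF A(1) j(1)] A b by simp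
    have "coeff (B * A) j = (\<Sum>i\<le>j. coeff B i * coeff A (j - i))" by (rule coeff_mult)
    also have "\<dots> = (\<Sum>i\<in>{0}. coeff B i * coeff A (j - i))"
      by (intro sum.mono_neutral_right) (auto intro!: j)
    finally have *: "coeff (B * A) j = coeff B 0 * coeff A j" by simp
    have "poly (B * A) x \<in> ext_I ((C + 1) * (S + 1))" using s A B by simp
    then have "coeff B 0 * coeff A j \<in> I ((C + 1) * (S + 1) - j)"
      using coeff_I[OF polys_mult_mem[OF B(1) A(1)]] * by metis
    then have "coeff B 0 * coeff A j \<in> I (C * (S + 1))"
      by (rule fil_antimono) (use jS in simp)
    moreover have "\<nu> (coeff A j) \<le> 2 ^ S" using nu_coeff_le[of A j] A b by simp
    ultimately obtain M where M: "coeff B 0 ^ M \<in> I 1"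
      using C[of "coeff A j" "coeff B 0" S] j(1) coeff_in[OF A(1)] coeff_in[OF B(1)] by blast
    have "poly (B ^ M) x \<in> ext_I 1"
    proof (rule ext_I_in)
      show BM: "B ^ M \<in> coeffs_in R" using B(1) by (rule polys_ring_mems)
      show "coeff (B ^ M) i \<in> I (1 - w * i)" for i
        using M coeff_in[OF BM] by (cases i) (auto simp: w fil_0 coeff_0_power)
    qed
    then show "\<exists>M. \<sigma> ^ M \<in> ext_I 1" using B by auto
  qed
qed

text \<open>As \<open>g\<close> is a unit modulo every \<open>I c\<close>, inverting it neither
  changes the order of an element of \<open>R\<close> (\<open>descend\<close>,
  \<open>ascend\<close>) nor creates new residue classes.\<close>

lemma frame_localization:
  assumes w: "w = 0" and g: "g \<in> R" "g \<noteq> 0" and x: "x = 1 / g"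
    and h: "h \<in> R" "1 - g * h \<in> I 1"
  shows "arith_frame (adjoin R x) ext_I p ext_nu"
proof (rule ext_frame)
  have gx: "g * x = 1" using g x by simp
  \<comment> \<open>This is g^J A(1/g), the element of \<open>R\<close> left after clearing
    denominators.\<close>
  define clear where "clear J A = (\<Sum>i\<le>J. coeff A i * g ^ (J - i))" for J and A :: "'a poly"
  have clear: "poly A x = clear J A * x ^ J" if "degree A \<le> J" for A J
  proof -
    have "poly A x = (\<Sum>i\<le>J. coeff A i * x ^ i)"
      unfolding poly_altdef using that by (intro sum.mono_neutral_left) (auto simp: coeff_eq_0)
    also have "\<dots> = (\<Sum>i\<le>J. coeff A i * g ^ (J - i) * x ^ J)"
    proof (intro sum.cong refl)
      fix i assume "i \<in> {..J}"
      then have "x ^ J = x ^ i * x ^ (J - i)" by (simp flip: power_add)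
      then have "g ^ (J - i) * x ^ J = (g * x) ^ (J - i) * x ^ i"
        by (simp add: power_mult_distrib)
      then show "coeff A i * x ^ i = coeff A i * g ^ (J - i) * x ^ J"
        by (simp add: gx mult.assoc)
    qed
    finally show ?thesis by (simp add: clear_def sum_distrib_right)
  qed
  have clear_R: "clear J A \<in> R" if "A \<in> coeffs_in R" for A J
    unfolding clear_def using that g by (intro ring_mems coeff_in)
  have cancel_pow: "a \<in> I c" if "a \<in> R" "g ^ n * a \<in> I c" for a n c
    using that
  proof (induction n arbitrary: a)
    case (Suc n)
    have "g ^ n * (g * a) \<in> I c" using Suc.prems by (simp add: mult_ac)
    then have "g * a \<in> I c" using Suc.IH[of "g * a"] Suc.prems g mult_mem by blast
    then show ?case using unit_cancel[OF g(1) h] Suc.prems by blast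
  qed simp
  have descend: "a \<in> I c" if a: "a \<in> R" "a * x ^ n \<in> ext_I c" for a n c
  proof -
    obtain A where A: "A \<in> coeffs_in R" "poly A x = a * x ^ n" "\<And>i. coeff A i \<in> I (c - w * i)"
      using ext_I_elim[OF a(2)] by blast
    define J where "J = degree A"
    have eq: "clear J A * x ^ J = a * x ^ n" using clear[of A J] A(2) by (simp add: J_def)
    have "g ^ J * a = g ^ J * a * (g * x) ^ n" by (simp add: gx)
    also have "\<dots> = g ^ n * g ^ J * (a * x ^ n)" by (simp add: power_mult_distrib)
    also have "\<dots> = g ^ n * clear J A * (g * x) ^ J" unfolding eq[symmetric] by (simp add: power_mult_distrib)
    also have "\<dots> = g ^ n * clear J A" by (simp add: gx)
    also have "\<dots> \<in> I c"
      unfolding clear_def using A(3) g by (intro fil_mult_left fil_sum fil_mult_right ring_mems) (auto simp: w)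
    finally show ?thesis by (rule cancel_pow[OF a(1)])
  qed
  have ascend: "a * x ^ n \<in> ext_I c" if a: "a \<in> I c" for a n c
    using ext_I_in[of "monom a n" c] a fil_mem[OF a] fil_zero
    by (auto simp: monom_in poly_monom w)
  have rep: "\<exists>a\<in>R. \<exists>n. b = a * x ^ n" if b: "b \<in> adjoin R x" for b
  proof -
    obtain A where "A \<in> coeffs_in R" "b = poly A x" using b by (auto simp: adjoin_def)
    then show ?thesis using clear[of A "degree A"] clear_R by auto
  qed
  have rep': "\<exists>a\<in>R. \<exists>n. poly A x = a * x ^ n" if "A \<in> coeffs_in R" for A
    using rep[of "poly A x"] that by (auto simp: adjoin_def)
  show "poly A x \<in> ext_I i" if A: "A \<in> coeffs_in R" "of_nat p * poly A x \<in> ext_I (Suc i)" for A i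
  proof -
    obtain a n where a: "a \<in> R" "poly A x = a * x ^ n" using rep'[OF A(1)] by blast
    then have "of_nat p * a * x ^ n \<in> ext_I (Suc i)" using A(2) by (simp add: mult.assoc)
    then have "of_nat p * a \<in> I (Suc i)" using a(1) by (intro descend ring_mems) 
    then show ?thesis using a p_cancel ascend by metis
  qed
  show "\<exists>n. \<forall>A\<in>coeffs_in R. \<exists>B\<in>coeffs_in R. poly B x = poly A x \<and>
       (\<forall>i\<ge>n. coeff B i \<in> I (c - w * i))" for c
  proof (intro exI[of _ 1] ballI)
    fix A assume "A \<in> coeffs_in R"
    then obtain a n where a: "a \<in> R" "poly A x = a * x ^ n" using rep' by blast
    obtain k where k: "k \<in> R" "1 - g * k \<in> I c" using unit_inverse[OF g(1) h] by blast
    \<comment> \<open>Modulo \<open>ext_I c\<close> powers of 1/g may be replaced by powers of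
      \<open>k\<close>. The error \<open>e\<close> lies in \<open>I c\<close>, so only the constant
      coefficient of the representation matters.\<close>
    define e where "e = a * (1 - (g * k) ^ n)"
    have e: "e \<in> I c"
      using fil_power_diff[of 1 "g * k" c n] k a(1) g(1)
      unfolding e_def by (auto intro!: fil_mult_left ring_mems)
    have "a * x ^ n = a * k ^ n * (g * x) ^ n + e * x ^ n"
      by (simp add: e_def algebra_simps power_mult_distrib)
    then have "poly ([:a * k ^ n:] + monom e n) x = poly A x"
      by (simp add: a(2) poly_monom gx)
    moreover have "[:a * k ^ n:] + monom e n \<in> coeffs_in R"
      using a k fil_mem[OF e] by (intro polys_ring_mems const_in monom_in ring_mems)
    moreover have "\<forall>i\<ge>1. coeff ([:a * k ^ n:] + monom e n) i \<in> I (c - w * i)"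
      using e fil_zero by (auto simp: w coeff_pCons split: nat.splits)
    ultimately show "\<exists>B\<in>coeffs_in R. poly B x = poly A x \<and> (\<forall>i\<ge>1. coeff B i \<in> I (c - w * i))"
      by blast
  qed
  show "1 \<notin> ext_I 1"
    using descend[of 1 0 1] one_mem one_notin by auto
  obtain C where C: "\<And>S b \<sigma>. b \<in> R \<Longrightarrow> \<sigma> \<in> R \<Longrightarrow> b \<noteq> 0 \<Longrightarrow> \<nu> b \<le> 2 ^ S \<Longrightarrow>
      \<sigma> * b \<in> I (C * (S + 1)) \<Longrightarrow> \<exists>M. \<sigma> ^ M \<in> I 1"
    using liouville by blast
  define G where "G = \<nu> 1 + \<nu> g"
  have nu_g: "\<nu> (g ^ n) \<le> 2 ^ (G * (n + 1))" for n
  proof (cases n)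
    case 0
    have "\<nu> 1 \<le> G" by (simp add: G_def)
    also have "G \<le> 2 ^ G" by (rule less_imp_le) (rule less_exp)
    finally show ?thesis by (simp add: 0)
  next
    case (Suc m)
    have "\<nu> (g ^ n) \<le> \<nu> g ^ n" unfolding Suc by (rule nu_power[OF g(1)])
    also have "\<dots> \<le> (2 ^ G) ^ n"
    proof (rule power_mono)
      have "\<nu> g \<le> G" by (simp add: G_def)
      also have "G \<le> 2 ^ G" by (rule less_imp_le) (rule less_exp)
      finally show "\<nu> g \<le> 2 ^ G" .
    qed simp
    also have "\<dots> = 2 ^ (G * n)" by (simp add: power_mult)
    also have "\<dots> \<le> 2 ^ (G * (n + 1))" by (intro power_increasing) auto
    finally show ?thesis .
  qed
  show "\<exists>C. \<forall>S. \<forall>b\<in>adjoin R x. \<forall>\<sigma>\<in>adjoin R x.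
      b \<noteq> 0 \<and> ext_nu b \<le> 2 ^ S \<and> \<sigma> * b \<in> ext_I (C * (S + 1)) \<longrightarrow> (\<exists>M. \<sigma> ^ M \<in> ext_I 1)"
  \<comment> \<open>Clearing denominators raises the size from 2^S to 2^S' with S' = (G + 2) (S +
    1), and S' + 1 \<le> (G + 3) (S + 1).\<close>
  proof (rule exI[of _ "C * (G + 3)"], intro allI ballI impI, elim conjE)
    fix S b \<sigma>
    assume b: "b \<in> adjoin R x" "b \<noteq> 0" "ext_nu b \<le> 2 ^ S"
      and s: "\<sigma> \<in> adjoin R x" "\<sigma> * b \<in> ext_I (C * (G + 3) * (S + 1))"
    obtain A where A: "A \<in> coeffs_in R" "poly A x = b" "pnorm A = ext_nu b"
      using ext_nu_attained[OF b(1)] .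
    obtain t n where t: "t \<in> R" "\<sigma> = t * x ^ n" using rep[OF s(1)] by blast
    have "A \<noteq> 0" using A b by auto
    then have "degree A \<le> S" using index_le[OF A(1), of "degree A"] A b by simp
    then have b_eq: "b = clear S A * x ^ S" using clear[of A S] A by simp
    define S' where "S' = (G + 2) * (S + 1)"
    have "\<nu> (clear S A) \<le> (\<Sum>i\<le>S. \<nu> (coeff A i * g ^ (S - i)))"
      unfolding clear_def using A g by (intro nu_sum ring_mems coeff_in)
    also have "\<dots> \<le> (\<Sum>i\<le>S. 2 ^ S * 2 ^ (G * (S + 1)))"
    proof (rule sum_mono)
      fix i
      have "\<nu> (coeff A i * g ^ (S - i)) \<le> \<nu> (coeff A i) * \<nu> (g ^ (S - i))"
        using A g by (intro nu_mult coeff_in power_mem)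
      also have "\<dots> \<le> 2 ^ S * 2 ^ (G * (S + 1))"
      proof (rule mult_le_mono)
        show "\<nu> (coeff A i) \<le> 2 ^ S" using nu_coeff_le[of A i] A b by simp
        have "(2::nat) ^ (G * (S - i + 1)) \<le> 2 ^ (G * (S + 1))"
          by (intro power_increasing mult_le_mono2) auto
        then show "\<nu> (g ^ (S - i)) \<le> 2 ^ (G * (S + 1))" using nu_g[of "S - i"] by linarith
      qed
      finally show "\<nu> (coeff A i * g ^ (S - i)) \<le> 2 ^ S * 2 ^ (G * (S + 1))" .
    qed
    also have "\<dots> = (S + 1) * (2 ^ S * 2 ^ (G * (S + 1)))" by simp
    also have "\<dots> \<le> 2 ^ (S + 1) * (2 ^ S * 2 ^ (G * (S + 1)))"
      using less_exp[of "S + 1"] by (intro mult_le_mono1) simp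
    also have "\<dots> = 2 ^ (S + 1 + (S + G * (S + 1)))" by (simp only: power_add)
    also have "\<dots> \<le> 2 ^ S'" unfolding S'_def by (intro power_increasing) (auto simp: algebra_simps)
    finally have nu_le: "\<nu> (clear S A) \<le> 2 ^ S'" .
    have "t * clear S A * x ^ (n + S) \<in> ext_I (C * (G + 3) * (S + 1))"
      using s(2) unfolding b_eq t(2) by (simp add: power_add mult_ac)
    then have "t * clear S A \<in> I (C * (G + 3) * (S + 1))"
      using t clear_R[OF A(1)] by (intro descend mult_mem)
    then have "t * clear S A \<in> I (C * (S' + 1))"
      by (rule fil_antimono) (auto simp: S'_def algebra_simps)
    moreover have "clear S A \<noteq> 0" using b b_eq by auto
    ultimately obtain M where "t ^ M \<in> I 1"
      using C[OF clear_R[OF A(1)] t(1) _ nu_le] by blast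
    then have "\<sigma> ^ M \<in> ext_I 1"
      using ascend[of "t ^ M" 1 "n * M"] by (simp add: t(2) power_mult_distrib power_mult)
    then show "\<exists>M. \<sigma> ^ M \<in> ext_I 1" by blast
  qed
qed

end

section \<open>Adjoining an integral element\<close>

context frame_extension
begin

lemma pnorm_split: "pnorm A = pnorm (A - monom (coeff A n) n) + \<nu> (coeff A n) * K ^ n"
proof (induction A arbitrary: n)
  case (pCons a A)
  show ?case
  proof (cases n)
    case 0
    then show ?thesis by (simp add: monom_0 pnorm_pCons nu_0)
  next
    case (Suc j)
    show ?thesis unfolding Suc
      by (subst pnorm_pCons, subst pCons(2)[of j]) (simp add: monom_Suc pnorm_pCons algebra_simps)
  qed
qed (simp add: pnorm_0 nu_0)

lemma pnorm_altdef: "(\<forall>i\<ge>n. coeff A i = 0) \<Longrightarrow> pnorm A = (\<Sum>i<n. \<nu> (coeff A i) * K ^ i)"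
proof (induction A arbitrary: n)
  case 0
  then show ?case by (simp add: pnorm_0 nu_0)
next
  case (pCons a A)
  show ?case
  proof (cases n)
    case 0
    then have "pCons a A = 0" using pCons.prems by (auto simp: poly_eq_iff)
    then show ?thesis using pCons(1) by simp
  next
    case (Suc m)
    have "coeff A i = 0" if "i \<ge> m" for i
      using pCons.prems that spec[of _ "Suc i"] by (fastforce simp: Suc)
    then have "pnorm A = (\<Sum>i<m. \<nu> (coeff A i) * K ^ i)" by (intro pCons.IH) simp
    then show ?thesis unfolding Suc
      by (simp add: pnorm_pCons sum.lessThan_Suc_shift sum_distrib_left mult_ac del: sum.lessThan_Suc)
  qed
qed

context
  fixes f :: "'a poly"
  assumes w: "w = 0"
    and f: "f \<in> coeffs_in R" "lead_coeff f = 1" "degree f > 0" "poly f x = 0"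
    and min: "\<And>A. A \<in> coeffs_in R \<Longrightarrow> degree A < degree f \<Longrightarrow> poly A x = 0 \<Longrightarrow> A = 0"
    and K: "(\<Sum>i<degree f. \<nu> (coeff f i)) \<le> K"
begin

text \<open>This is what \<open>K\<close> is chosen for: replacing X^D, with D the degree of
  \<open>f\<close>, by the lower terms of \<open>f\<close> does not increase \<open>pnorm\<close>,
  so reduction modulo \<open>f\<close> costs nothing.\<close>

lemma pnorm_tail: "pnorm (f - monom 1 (degree f)) \<le> K ^ degree f"
proof -
  obtain d where d: "degree f = Suc d" using f(3) gr0_implies_Suc by blast
  have "pnorm (f - monom 1 (degree f)) =
      (\<Sum>i<degree f. \<nu> (coeff (f - monom 1 (degree f)) i) * K ^ i)"
  proof (rule pnorm_altdef, intro allI impI)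
    fix i assume "i \<ge> degree f"
    then show "coeff (f - monom 1 (degree f)) i = 0"
      using f(2) by (cases "i = degree f") (auto simp: coeff_eq_0)
  qed
  also have "\<dots> \<le> (\<Sum>i<degree f. \<nu> (coeff f i) * K ^ d)"
  proof (rule sum_mono)
    fix i assume "i \<in> {..<degree f}"
    then have i: "i \<le> d" "i \<noteq> degree f" using d by auto
    have "K ^ i \<le> K ^ d" using i K_ge_2 by (intro power_increasing) auto
    then show "\<nu> (coeff (f - monom 1 (degree f)) i) * K ^ i \<le> \<nu> (coeff f i) * K ^ d"
      using i by simp
  qed
  also have "\<dots> \<le> K * K ^ d"
    unfolding sum_distrib_right[symmetric] using K by (rule mult_le_mono1)
  finally show ?thesis by (simp add: d)
qed

text \<open>\<open>f\<close> is monic, so the division has no denominators and all coefficients stay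
  in whichever \<open>I c\<close> they came from.\<close>

lemma integral_reduce:
  assumes "A \<in> coeffs_in R"
  shows "\<exists>B\<in>coeffs_in R. poly B x = poly A x \<and> (\<forall>i\<ge>degree f. coeff B i = 0) \<and> pnorm B \<le> pnorm A \<and>
    (\<forall>c. (\<forall>i. coeff A i \<in> I c) \<longrightarrow> (\<forall>i. coeff B i \<in> I c))"
proof -
  define D where "D = degree f"
  have main: "A \<in> coeffs_in R \<Longrightarrow> (\<forall>i\<ge>D + m. coeff A i = 0) \<Longrightarrow>
    \<exists>B\<in>coeffs_in R. poly B x = poly A x \<and> (\<forall>i\<ge>D. coeff B i = 0) \<and> pnorm B \<le> pnorm A \<and>
    (\<forall>c. (\<forall>i. coeff A i \<in> I c) \<longrightarrow> (\<forall>i. coeff B i \<in> I c))" for m A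
  proof (induction m arbitrary: A)
    case 0
    then show ?case by auto
  next
    case (Suc m)
    define a where "a = coeff A (D + m)"
    define A1 where "A1 = A - monom a m * f"
    have a: "a \<in> R" unfolding a_def by (rule coeff_in[OF Suc.prems(1)])
    have A1: "A1 \<in> coeffs_in R"
      unfolding A1_def by (intro polys_diff_mem polys_mult_mem monom_in a f Suc.prems)
    have A1_coeff: "coeff A1 i = coeff A i - (if i < m then 0 else a * coeff f (i - m))" for i
      by (simp add: A1_def coeff_monom_mult)
    have "coeff A1 i = 0" if "i \<ge> D + m" for i
    proof (cases "i = D + m")
      case True
      then show ?thesis using f(2) by (simp add: A1_coeff a_def D_def)
    next
      case False
      then show ?thesis using that Suc.prems by (simp add: A1_coeff D_def coeff_eq_0)
    qed
    then obtain B where B: "B \<in> coeffs_in R" "poly B x = poly A1 x" "\<forall>i\<ge>D. coeff B i = 0"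
       "pnorm B \<le> pnorm A1" "\<forall>c. (\<forall>i. coeff A1 i \<in> I c) \<longrightarrow> (\<forall>i. coeff B i \<in> I c)"
      using Suc.IH[OF A1] by blast
    have "poly A1 x = poly A x" by (simp add: A1_def f(4))
    moreover have "pnorm A1 \<le> pnorm A"
    proof -
      let ?A0 = "A - monom a (D + m)" and ?r = "f - monom 1 D"
      have "A1 = ?A0 - monom a m * ?r"
        by (simp add: A1_def algebra_simps mult_monom)
      also have "pnorm \<dots> \<le> pnorm ?A0 + pnorm (monom a m * ?r)"
        by (intro pnorm_diff polys_diff_mem polys_mult_mem monom_in a f Suc.prems one_mem)
      also have "pnorm (monom a m * ?r) \<le> pnorm (monom a m) * pnorm ?r"
        by (intro pnorm_mult polys_diff_mem monom_in a f one_mem)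
      also have "\<dots> \<le> \<nu> a * K ^ m * K ^ D"
        unfolding pnorm_monom using pnorm_tail by (intro mult_le_mono2) (simp add: D_def)
      also have "pnorm ?A0 + \<nu> a * K ^ m * K ^ D = pnorm A"
        using pnorm_split[of A "D + m"] by (simp add: a_def power_add mult_ac)
      finally show ?thesis by simp
    qed
    moreover have "coeff A1 i \<in> I c" if c: "\<forall>i. coeff A i \<in> I c" for c i
      using c fil_mult_right[OF coeff_in[OF f(1)], of a c "i - m"] by (auto simp: A1_coeff a_def intro: fil_diff)
    ultimately show ?case using B by (intro bexI[of _ B]) auto
  qed
  have "\<forall>i\<ge>D + (degree A + 1). coeff A i = 0" by (simp add: coeff_eq_0)
  from main[OF assms this] show ?thesis by (simp only: D_def)
qed

lemma integral_unique:
  assumes "A \<in> coeffs_in R" "B \<in> coeffs_in R" "\<forall>i\<ge>degree f. coeff A i = 0" "\<forall>i\<ge>degree f. coeff B i = 0"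
    and "poly A x = poly B x"
  shows "A = B"
proof -
  have "degree (A - B) < degree f" using assms f(3) by (intro degree_lessI) auto
  then have "A - B = 0" using assms by (intro min polys_diff_mem) auto
  then show ?thesis by simp
qed

lemma integral_coeff_I:
  assumes "A \<in> coeffs_in R" "\<forall>i\<ge>degree f. coeff A i = 0" "poly A x \<in> ext_I c"
  shows "coeff A i \<in> I c"
proof -
  obtain A' where A': "A' \<in> coeffs_in R" "poly A' x = poly A x" "\<And>i. coeff A' i \<in> I (c - w * i)"
    using ext_I_elim[OF assms(3)] by blast
  obtain B where B: "B \<in> coeffs_in R" "poly B x = poly A' x" "\<forall>i\<ge>degree f. coeff B i = 0"
    "\<forall>i. coeff B i \<in> I c"
    using integral_reduce[OF A'(1)] A'(3) by (auto simp: w)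
  have "A = B" by (rule integral_unique) (use assms A' B in auto)
  then show ?thesis using B by blast
qed

lemma frame_integral: "arith_frame (adjoin R x) ext_I p ext_nu"
proof (rule ext_frame)
  have f0: "f \<noteq> 0" using f by auto
  interpret S: filtered_ring "adjoin R x" ext_I by (rule ext_filtered)
  have rep: "\<exists>A\<in>coeffs_in R. poly A x = b \<and> (\<forall>i\<ge>degree f. coeff A i = 0) \<and> pnorm A = ext_nu b"
    if b: "b \<in> adjoin R x" for b
  proof -
    obtain A where A: "A \<in> coeffs_in R" "poly A x = b" "pnorm A = ext_nu b"
      using ext_nu_attained[OF b] .
    obtain B where B: "B \<in> coeffs_in R" "poly B x = poly A x" "\<forall>i\<ge>degree f. coeff B i = 0"
      "pnorm B \<le> pnorm A"
      using integral_reduce[OF A(1)] by blast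
    then show ?thesis using A ext_nu_le[OF B(1)] by (intro bexI[of _ B]) auto
  qed
  show "poly A x \<in> ext_I i" if A: "A \<in> coeffs_in R" "of_nat p * poly A x \<in> ext_I (Suc i)" for A i
  proof -
    obtain B where B: "B \<in> coeffs_in R" "poly B x = poly A x" "\<forall>i\<ge>degree f. coeff B i = 0"
      using integral_reduce[OF A(1)] by blast
    have "coeff (smult (of_nat p) B) j \<in> I (Suc i)" for j
      by (rule integral_coeff_I) (use A B in \<open>auto intro: smult_in of_nat_mem\<close>)
    then have "coeff B j \<in> I i" for j
      using p_cancel[OF coeff_in[OF B(1)]] by simp
    then show ?thesis using ext_I_in[OF B(1), of i] B(2) by (simp add: w)
  qed
  show "\<exists>n. \<forall>A\<in>coeffs_in R. \<exists>B\<in>coeffs_in R. poly B x = poly A x \<and>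
       (\<forall>i\<ge>n. coeff B i \<in> I (c - w * i))" for c
  proof (rule exI[of _ "degree f"], intro ballI)
    fix A assume "A \<in> coeffs_in R"
    then obtain B where "B \<in> coeffs_in R" "poly B x = poly A x" "\<forall>i\<ge>degree f. coeff B i = 0"
      using integral_reduce by blast
    then show "\<exists>B\<in>coeffs_in R. poly B x = poly A x \<and> (\<forall>i\<ge>degree f. coeff B i \<in> I (c - w * i))"
      using fil_zero by (intro bexI[of _ B]) auto
  qed
  show "1 \<notin> ext_I 1"
  proof
    assume "1 \<in> ext_I 1"
    then have "coeff 1 0 \<in> I 1"
      by (intro integral_coeff_I) (use f(3) polys_one_mem in auto)
    then show False using one_notin by simp
  qed
  obtain C where C: "\<And>S b \<sigma>. b \<in> R \<Longrightarrow> \<sigma> \<in> R \<Longrightarrow> b \<noteq> 0 \<Longrightarrow> \<nu> b \<le> 2 ^ S \<Longrightarrow>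
      \<sigma> * b \<in> I (C * (S + 1)) \<Longrightarrow> \<exists>M. \<sigma> ^ M \<in> I 1"
    using liouville by blast
  from elimination[OF f(1) f0 f(4) min order.refl]
  obtain E where E: "\<forall>S. \<forall>A\<in>coeffs_in R. A \<noteq> 0 \<and> degree A < degree f \<and> (\<forall>i. \<nu> (coeff A i) \<le> 2 ^ S) \<longrightarrow>
      (\<exists>B\<in>coeffs_in R. \<exists>c\<in>R. c \<noteq> 0 \<and> poly B x * poly A x = c \<and> \<nu> c \<le> 2 ^ (E * (S + 1)))" ..
  show "\<exists>C. \<forall>S. \<forall>b\<in>adjoin R x. \<forall>\<sigma>\<in>adjoin R x.
      b \<noteq> 0 \<and> ext_nu b \<le> 2 ^ S \<and> \<sigma> * b \<in> ext_I (C * (S + 1)) \<longrightarrow> (\<exists>M. \<sigma> ^ M \<in> ext_I 1)"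
  proof (rule exI[of _ "C * (E + 1)"], intro allI ballI impI, elim conjE)
    fix S b \<sigma>
    assume b: "b \<in> adjoin R x" "b \<noteq> 0" "ext_nu b \<le> 2 ^ S"
      and s: "\<sigma> \<in> adjoin R x" "\<sigma> * b \<in> ext_I (C * (E + 1) * (S + 1))"
    obtain A where A: "A \<in> coeffs_in R" "poly A x = b" "\<forall>i\<ge>degree f. coeff A i = 0" "pnorm A = ext_nu b"
      using rep[OF b(1)] by blast
    obtain T where T: "T \<in> coeffs_in R" "poly T x = \<sigma>" "\<forall>i\<ge>degree f. coeff T i = 0"
      using rep[OF s(1)] by blast
    have "A \<noteq> 0" using A b by auto
    moreover have "degree A < degree f" using A(3) f(3) by (intro degree_lessI) auto
    moreover have "\<forall>i. \<nu> (coeff A i) \<le> 2 ^ S"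
      by (rule allI, rule le_trans[OF nu_coeff_le]) (simp add: A(4) b(3))
    ultimately have "\<exists>B\<in>coeffs_in R. \<exists>c\<in>R. c \<noteq> 0 \<and> poly B x * poly A x = c \<and> \<nu> c \<le> 2 ^ (E * (S + 1))"
      by (intro mp[OF bspec[OF spec[OF E] A(1)]] conjI)
    \<comment> \<open>Multiplication by B(x) replaces \<open>b\<close> by an element
      \<open>c\<close> of \<open>R\<close>. Now the inequality in \<open>R\<close> applies with each
      coefficient of \<sigma> as multiplier, and a sum of elements nilpotent modulo
      \<open>ext_I 1\<close> is again nilpotent.\<close>
    then obtain B c where Bc: "B \<in> coeffs_in R" "c \<in> R" "c \<noteq> 0" "poly B x * b = c" "\<nu> c \<le> 2 ^ (E * (S + 1))"
      unfolding A(2) by blast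
    have "poly B x * (\<sigma> * b) \<in> ext_I (C * (E + 1) * (S + 1))"
      by (rule S.fil_mult_left[OF _ s(2)]) (use Bc(1) in \<open>auto simp: adjoin_def\<close>)
    moreover have "poly B x * (\<sigma> * b) = poly (smult c T) x"
      unfolding Bc(4)[symmetric] by (simp add: T(2) mult_ac)
    ultimately have *: "poly (smult c T) x \<in> ext_I (C * (E + 1) * (S + 1))" by simp
    have "coeff (smult c T) i \<in> I (C * (E + 1) * (S + 1))" for i
      by (rule integral_coeff_I[OF _ _ *]) (use T Bc smult_in in auto)
    then have **: "coeff T i * c \<in> I (C * (E + 1) * (S + 1))" for i by (simp add: mult.commute)
    have "coeff T i * c \<in> I (C * (E * (S + 1) + 1))" for i
      by (rule fil_antimono[OF **]) (simp add: algebra_simps)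
    then have nil: "\<exists>M. coeff T i ^ M \<in> I 1" for i
      using C[OF Bc(2) coeff_in[OF T(1)] Bc(3) Bc(5)] by blast
    have "\<exists>M. (\<Sum>i\<le>degree T. coeff T i * x ^ i) ^ M \<in> ext_I 1"
    proof (rule S.nil_sum)
      fix i
      have c: "coeff T i \<in> adjoin R x" using subset_adjoin coeff_in[OF T(1)] by blast
      obtain M where M: "coeff T i ^ M \<in> I 1" using nil by blast
      have "(coeff T i * x ^ i) ^ M = coeff T i ^ M * (x ^ i) ^ M" by (rule power_mult_distrib)
      also have "\<dots> \<in> ext_I 1"
        by (intro S.fil_mult_right[OF _ ext_I_const[OF M]] S.power_mem generator_in_adjoin)
      finally have "(coeff T i * x ^ i) ^ M \<in> ext_I 1" .
      then show "coeff T i * x ^ i \<in> adjoin R x \<and> (\<exists>M. (coeff T i * x ^ i) ^ M \<in> ext_I 1)"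
        using c by (blast intro: S.mult_mem S.power_mem generator_in_adjoin)
    qed simp
    then show "\<exists>M. \<sigma> ^ M \<in> ext_I 1" using T(2) by (simp add: poly_altdef)
  qed
qed

end

end

section \<open>Frames containing a given finite set\<close>

text \<open>Rings between \<open>R\<close> and its fractions are harmless enlargements: an element
  keeps its minimal degree over them, and a transcendental one stays transcendental, because
  denominators can be cleared.\<close>

definition fractions :: "'a::field set \<Rightarrow> 'a set"
  where "fractions R = {a / b | a b. a \<in> R \<and> b \<in> R \<and> b \<noteq> 0}"

lemma (in subring_of) adjoin_mono: "subring_of R' \<Longrightarrow> R \<subseteq> R' \<Longrightarrow> adjoin R x \<subseteq> adjoin R' x"
  by (auto simp: adjoin_def coeffs_in_def)

lemma fractions_subring:
  fixes R :: "'a::field set"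
  assumes "subring_of R"
  shows "subring_of (fractions R)"
proof -
  interpret subring_of R by fact
  show ?thesis
  proof
    show "1 \<in> fractions R"
      unfolding fractions_def using one_mem by (auto intro!: exI[of _ 1])
    fix x y assume "x \<in> fractions R" "y \<in> fractions R"
    then obtain a b c d where "x = a / b" "y = c / d" and R: "a \<in> R" "b \<in> R" "b \<noteq> 0" "c \<in> R" "d \<in> R" "d \<noteq> 0"
      unfolding fractions_def by blast
    then have "x - y = (a * d - c * b) / (b * d)" "x * y = (a * c) / (b * d)"
      by (simp_all add: field_simps)
    moreover have "a * d - c * b \<in> R" "a * c \<in> R" "b * d \<in> R" "b * d \<noteq> 0"
      using R by (auto intro: ring_mems)
    ultimately show "x - y \<in> fractions R" "x * y \<in> fractions R"
      unfolding fractions_def by blast+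
  qed
qed

lemma subset_fractions: "subring_of R \<Longrightarrow> R \<subseteq> fractions R"
  unfolding fractions_def using subring_of.one_mem by force

lemma inverse_in_fractions: "a \<in> R \<Longrightarrow> b \<in> R \<Longrightarrow> a \<noteq> 0 \<Longrightarrow> b / a \<in> fractions R"
  unfolding fractions_def by blast

lemma fractions_mono: "R \<subseteq> R' \<Longrightarrow> fractions R \<subseteq> fractions R'"
  unfolding fractions_def by blast

lemma clear_denominators:
  fixes R :: "'a::field set"
  assumes "subring_of R" "A \<in> coeffs_in (fractions R)"
  shows "\<exists>d\<in>R. d \<noteq> 0 \<and> smult d A \<in> coeffs_in R"
proof -
  interpret subring_of R by fact
  interpret F: subring_of "fractions R" by (rule fractions_subring) fact
  show ?thesis using assms(2)
  proof (induction A)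
    case 0
    then show ?case using one_mem polys_zero_mem by (intro bexI[of _ 1]) auto
  next
    case (pCons a A)
    then obtain d where d: "d \<in> R" "d \<noteq> 0" "smult d A \<in> coeffs_in R" by (auto simp: F.pCons_in_iff)
    obtain b c where bc: "a = b / c" "b \<in> R" "c \<in> R" "c \<noteq> 0"
      using pCons.prems unfolding F.pCons_in_iff unfolding fractions_def by blast
    have "smult (d * c) (pCons a A) = pCons (d * b) (smult c (smult d A))"
      using bc by (simp add: mult.commute)
    moreover have "pCons (d * b) (smult c (smult d A)) \<in> coeffs_in R"
      unfolding pCons_in_iff using bc d by (auto intro: mult_mem smult_in simp del: smult_smult)
    ultimately show ?case using bc d by (intro bexI[of _ "d * c"]) (auto intro: mult_mem)
  qed
qed

definition int_ideal :: "nat \<Rightarrow> nat \<Rightarrow> 'a::ring_1 set"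
  where "int_ideal p c = {of_int n | n. int p ^ c dvd n}"

text \<open>A nonzero integer divisible by p^(S+1) exceeds 2^S in absolute value, and a multiplier
  prime to \<open>p\<close> does not help with divisibility; hence the constant 1 in the Liouville
  inequality.\<close>

lemma int_frame:
  assumes p: "prime p" "p > 2"
  shows "arith_frame (range of_int :: 'a::field_char_0 set) (int_ideal p) p (\<lambda>a. nat \<bar>inv of_int a\<bar>)"
proof -
  have inv: "inv of_int (of_int n :: 'a) = n" for n by (rule inv_f_f) (simp add: inj_def)
  have mem: "(of_int n :: 'a) \<in> int_ideal p c \<longleftrightarrow> int p ^ c dvd n" for n c
    by (auto simp: int_ideal_def)
  have elim: "\<exists>n. a = of_int n \<and> int p ^ c dvd n" if "a \<in> int_ideal p c" for a :: 'a and c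
    using that by (auto simp: int_ideal_def)
  have pi: "prime (int p)" using p by simp
  then have p1: "\<not> int p dvd 1" using not_prime_unit by blast
  show ?thesis
  proof
    show "1 \<in> (range of_int :: 'a set)" by (rule image_eqI[of _ _ 1]) auto
    show "(0 :: 'a) \<in> int_ideal p c" for c using mem[of 0 c] by simp
    show "(of_nat p :: 'a) \<in> int_ideal p 1" using mem[of "int p" 1] by simp
    show "(1 :: 'a) \<notin> int_ideal p 1" using mem[of 1 1] p1 by simp
    show "nat \<bar>inv of_int (0 :: 'a)\<bar> = 0" using inv[of 0] by simp
    show "int_ideal p 0 = (range of_int :: 'a set)" by (auto simp: int_ideal_def)
    show "int_ideal p (Suc c) \<subseteq> (int_ideal p c :: 'a set)" for c
      by (auto simp: int_ideal_def intro: dvd_mult_right)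
    show "prime p" "p > 2" by fact+
  next
    fix a b :: 'a assume "a \<in> range of_int" "b \<in> range of_int"
    then obtain m n where mn: "a = of_int m" "b = of_int n" by auto
    show "a - b \<in> range of_int" "a * b \<in> range of_int"
      unfolding mn by (metis of_int_diff rangeI) (metis of_int_mult rangeI)
    have "nat \<bar>m + n\<bar> \<le> nat \<bar>m\<bar> + nat \<bar>n\<bar>" by simp
    then show "nat \<bar>inv of_int (a + b)\<bar> \<le> nat \<bar>inv of_int a\<bar> + nat \<bar>inv of_int b\<bar>"
      unfolding mn by (simp only: inv flip: of_int_add)
    have "nat \<bar>m * n\<bar> \<le> nat \<bar>m\<bar> * nat \<bar>n\<bar>" by (simp add: abs_mult nat_mult_distrib)
    then show "nat \<bar>inv of_int (a * b)\<bar> \<le> nat \<bar>inv of_int a\<bar> * nat \<bar>inv of_int b\<bar>"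
      unfolding mn by (simp only: inv flip: of_int_mult)
  next
    fix a :: 'a assume "a \<in> range of_int"
    then obtain m where m: "a = of_int m" by auto
    show "nat \<bar>inv of_int (- a)\<bar> \<le> nat \<bar>inv of_int a\<bar>"
      unfolding m by (simp add: inv flip: of_int_minus)
    show "0 < nat \<bar>inv of_int a\<bar>" if "a \<noteq> 0"
      using that unfolding m by (simp add: inv)
    show "a \<in> int_ideal p i" if "of_nat p * a \<in> int_ideal p (Suc i)" for i
    proof -
      have "int p ^ Suc i dvd int p * m" using that mem[of "int p * m" "Suc i"] by (simp add: m)
      then show ?thesis using p by (simp add: m mem)
    qed
  next
    fix a b :: 'a and i assume "a \<in> int_ideal p i" "b \<in> int_ideal p i"
    then obtain m n where mn: "a = of_int m" "b = of_int n" "int p ^ i dvd m" "int p ^ i dvd n"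
      using elim by blast
    then have "(of_int (m - n) :: 'a) \<in> int_ideal p i" unfolding mem by (intro dvd_diff)
    then show "a - b \<in> int_ideal p i" by (simp add: mn)
  next
    fix a b :: 'a and i j assume "a \<in> int_ideal p i" "b \<in> int_ideal p j"
    then obtain m n where mn: "a = of_int m" "b = of_int n" "int p ^ i dvd m" "int p ^ j dvd n"
      using elim by meson
    then have "(of_int (m * n) :: 'a) \<in> int_ideal p (i + j)"
      unfolding mem power_add by (intro mult_dvd_mono)
    then show "a * b \<in> int_ideal p (i + j)" by (simp add: mn)
  next
    fix c
    show "\<exists>F. finite F \<and> (\<forall>a\<in>range of_int. \<exists>b\<in>F. a - b \<in> (int_ideal p c :: 'a set))"
    proof (intro exI[of _ "of_int ` {0..<int p ^ c}"] conjI ballI)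
      fix a :: 'a assume "a \<in> range of_int"
      then obtain n where n: "a = of_int n" by auto
      have "(of_int (n - n mod int p ^ c) :: 'a) \<in> int_ideal p c"
        unfolding mem by (simp add: minus_mod_eq_mult_div)
      moreover have "n mod int p ^ c \<in> {0..<int p ^ c}" using p by simp
      ultimately show "\<exists>b\<in>of_int ` {0..<int p ^ c}. a - b \<in> int_ideal p c"
        by (intro bexI[of _ "of_int (n mod int p ^ c)"]) (auto simp: n)
    qed simp
  next
    show "\<exists>C. \<forall>S. \<forall>b\<in>range of_int. \<forall>\<sigma>\<in>range of_int.
       b \<noteq> (0::'a) \<and> nat \<bar>inv of_int b\<bar> \<le> 2 ^ S \<and> \<sigma> * b \<in> int_ideal p (C * (S + 1)) \<longrightarrow>
       (\<exists>M. \<sigma> ^ M \<in> int_ideal p 1)"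
    proof (rule exI[of _ 1], intro allI ballI impI, elim conjE)
      fix S and b \<sigma> :: 'a
      assume "b \<in> range of_int" "\<sigma> \<in> range of_int"
      then obtain n s where ns: "b = of_int n" "\<sigma> = of_int s" by auto
      assume b: "b \<noteq> 0" "nat \<bar>inv of_int b\<bar> \<le> 2 ^ S" and sb: "\<sigma> * b \<in> int_ideal p (1 * (S + 1))"
      have dvd: "int p ^ (S + 1) dvd s * n"
        using sb mem[of "s * n" "S + 1"] by (simp add: ns)
      have "int p dvd s"
      proof (rule ccontr)
        assume "\<not> int p dvd s"
        then have "coprime (int p ^ (S + 1)) s" using prime_imp_coprime[OF pi] by simp
        then have "int p ^ (S + 1) dvd n" using dvd by (simp add: coprime_dvd_mult_right_iff)
        moreover have "n \<noteq> 0" using b ns by auto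
        ultimately have "\<bar>int p ^ (S + 1)\<bar> \<le> \<bar>n\<bar>" by (intro dvd_imp_le_int)
        moreover have "\<bar>n\<bar> \<le> 2 ^ S" using b(2) by (simp add: ns inv nat_le_iff)
        moreover have "(2::int) ^ S < 2 ^ (S + 1)" by simp
        moreover have "(2::int) ^ (S + 1) \<le> int p ^ (S + 1)" using p by (intro power_mono) auto
        ultimately show False using abs_ge_self[of "int p ^ (S + 1)"] by linarith
      qed
      then have "\<sigma> ^ 1 \<in> int_ideal p 1" using mem[of s 1] by (simp add: ns)
      then show "\<exists>M. \<sigma> ^ M \<in> int_ideal p 1" by blast
    qed
  qed
qed

text \<open>
  Inverting a prescribed \<open>g\<close> is what makes adjoining elements possible: \<open>g\<close> is used to turn leading
  coefficients and special values of polynomials into units before the filtration is chosen.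
\<close>

definition admissible :: "'a::field_char_0 set \<Rightarrow> bool"
  where "admissible R \<longleftrightarrow> subring_of R \<and> (\<forall>g\<in>R. g \<noteq> 0 \<longrightarrow>
    (\<exists>R' I p \<nu>. arith_frame R' I p \<nu> \<and> R \<subseteq> R' \<and> R' \<subseteq> fractions R \<and> 1 / g \<in> R'))"

lemma admissible_int: "admissible (range of_int :: 'a::field_char_0 set)"
proof -
  have sub: "subring_of (range of_int :: 'a set)"
    using int_frame[of 3, where 'a = 'a] unfolding arith_frame_def padic_ring_def filtered_ring_def by simp
  interpret Z: subring_of "range of_int :: 'a set" by (rule sub)
  show ?thesis unfolding admissible_def
  proof (intro conjI sub ballI impI)
    fix g :: 'a assume g: "g \<in> range of_int" "g \<noteq> 0"
    then obtain n where n: "g = of_int n" "n \<noteq> 0" by auto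
    \<comment> \<open>A prime above |n| makes \<open>g\<close> a unit modulo
      \<open>p\<close>.\<close>
    obtain p where p: "prime p" "max 2 (nat \<bar>n\<bar>) < p" using bigger_prime by blast
    then have p2: "p > 2" by simp
    interpret F: arith_frame "range of_int :: 'a set" "int_ideal p" p "\<lambda>a. nat \<bar>inv of_int a\<bar>"
      by (rule int_frame[OF p(1) p2])
    interpret E: frame_extension "range of_int :: 'a set" "int_ideal p" p "\<lambda>a. nat \<bar>inv of_int a\<bar>" "1 / g" 2 0
      by unfold_locales simp
    have "\<not> int p dvd n"
    proof
      assume "int p dvd n"
      with n(2) have "\<bar>int p\<bar> \<le> \<bar>n\<bar>" by (rule dvd_imp_le_int)
      then show False using p(2) by linarith
    qed
    then have "coprime (int p) n" using p(1) by (intro prime_imp_coprime) auto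
    then obtain s t where "s * int p + t * n = 1"
      using bezout_int[of "int p" n] by auto
    then have "1 - n * t = int p ^ 1 * s" by (simp add: algebra_simps)
    then have "1 - g * of_int t = of_int (int p ^ 1 * s)"
      unfolding n by (metis of_int_1 of_int_diff of_int_mult)
    then have "1 - g * of_int t \<in> int_ideal p 1" unfolding int_ideal_def by (metis (mono_tags, lifting) CollectI dvd_triv_left)
    then have "arith_frame (adjoin (range of_int) (1 / g)) E.ext_I p E.ext_nu"
      by (intro E.frame_localization[OF refl g refl, of "of_int t"]) auto
    moreover have "adjoin (range of_int) (1 / g) \<subseteq> fractions (range of_int :: 'a set)"
      by (intro Z.adjoin_least fractions_subring sub subset_fractions inverse_in_fractions g Z.one_mem)
    ultimately show "\<exists>R' I p \<nu>. arith_frame R' I p \<nu> \<and> range of_int \<subseteq> R' \<and>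
        R' \<subseteq> fractions (range of_int) \<and> 1 / g \<in> R'"
      using Z.subset_adjoin Z.generator_in_adjoin by blast
  qed
qed

lemma (in subring_of) pcompose_in:
  assumes "A \<in> coeffs_in R" "B \<in> coeffs_in R"
  shows "pcompose A B \<in> coeffs_in R"
  using assms(1)
proof (induction A)
  case (pCons a A)
  then show ?case using assms(2)
    by (auto simp: pcompose_pCons pCons_in_iff intro!: polys_ring_mems const_in)
qed (simp add: polys_zero_mem)

lemma admissible_adjoin_algebraic:
  fixes R :: "'a::field_char_0 set"
  assumes adm: "admissible R"
    and alg: "A0 \<in> coeffs_in R" "A0 \<noteq> 0" "poly A0 x = 0"
  shows "admissible (adjoin R x)"
proof -
  interpret subring_of R using adm unfolding admissible_def by blast
  have sub: "subring_of (adjoin R x)" by (rule adjoin_subring)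
  define Q where "Q n \<longleftrightarrow> (\<exists>A\<in>coeffs_in R. A \<noteq> 0 \<and> poly A x = 0 \<and> degree A = n)" for n
  have "Q (degree A0)" using alg by (auto simp: Q_def)
  then have "Q (LEAST n. Q n)" by (rule LeastI)
  then obtain f where f: "f \<in> coeffs_in R" "f \<noteq> 0" "poly f x = 0" "degree f = (LEAST n. Q n)"
    unfolding Q_def by blast
  have min: "A = 0" if A: "A \<in> coeffs_in R" "degree A < degree f" "poly A x = 0" for A
  proof (rule ccontr)
    assume "A \<noteq> 0"
    then have "Q (degree A)" using A by (auto simp: Q_def)
    then show False using not_less_Least[of "degree A" Q] A(2) f(4) by simp
  qed
  have deg_f: "degree f > 0"
  proof (rule ccontr)
    assume "\<not> degree f > 0"
    then obtain c where "f = [:c:]" by (metis degree_eq_zeroE neq0_conv)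
    then show False using f by simp
  qed
  define a where "a = lead_coeff f"
  have a: "a \<in> R" "a \<noteq> 0" using f(1,2) by (auto simp: a_def coeff_in)
  \<comment> \<open>Elimination serves here only to find a nonzero multiple of g in
    \<open>R\<close>, whose size is irrelevant; a trivial size function makes it available.\<close>
  define \<nu>0 :: "'a \<Rightarrow> nat" where "\<nu>0 b = (if b = 0 then 0 else 1)" for b
  interpret N: normed_subring R \<nu>0
    by unfold_locales (auto simp: \<nu>0_def)
  have \<nu>0_le: "\<nu>0 b \<le> 2 ^ S" for b S by (simp add: \<nu>0_def)
  show ?thesis unfolding admissible_def
  proof (intro conjI sub ballI impI)
    fix g assume g: "g \<in> adjoin R x" "g \<noteq> 0"
    then obtain G where G: "G \<in> coeffs_in R" "g = poly G x" by (auto simp: adjoin_def)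
    define m where "m = degree G + 1"
    have "\<exists>Q\<in>coeffs_in R. \<exists>B\<in>coeffs_in R. smult (lead_coeff f ^ m) G = Q * f + B \<and>
      (\<forall>i\<ge>degree f. coeff B i = 0) \<and> (\<forall>i\<ge>m. coeff Q i = 0) \<and> (\<forall>i. \<nu>0 (coeff B i) \<le> 2 ^ (0 + m * (0 + 1)))"
      by (rule N.pseudo_division[OF f(1) refl \<nu>0_le G(1)]) (auto simp: m_def coeff_eq_0 \<nu>0_def)
    then obtain Q B where B: "B \<in> coeffs_in R" "smult (a ^ m) G = Q * f + B" "\<forall>i\<ge>degree f. coeff B i = 0"
      unfolding a_def by blast
    have Bx: "poly B x = a ^ m * g"
      using arg_cong[OF B(2), of "\<lambda>q. poly q x"] f(3) G(2) by simp
    then have "B \<noteq> 0" using a g by auto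
    moreover have "degree B < degree f" using B(3) deg_f by (intro degree_lessI) auto
    moreover from N.elimination[OF f(1-3) min order.refl]
    obtain C where C: "\<forall>S. \<forall>A\<in>coeffs_in R. A \<noteq> 0 \<and> degree A < degree f \<and> (\<forall>i. \<nu>0 (coeff A i) \<le> 2 ^ S) \<longrightarrow>
      (\<exists>B\<in>coeffs_in R. \<exists>c\<in>R. c \<noteq> 0 \<and> poly B x * poly A x = c \<and> \<nu>0 c \<le> 2 ^ (C * (S + 1)))" ..
    ultimately have "\<exists>B'\<in>coeffs_in R. \<exists>c\<in>R. c \<noteq> 0 \<and> poly B' x * poly B x = c \<and> \<nu>0 c \<le> 2 ^ (C * (0 + 1))"
      by (intro mp[OF bspec[OF spec[OF C] B(1)]] conjI allI \<nu>0_le)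
    then obtain B' c where B': "B' \<in> coeffs_in R" "c \<in> R" "c \<noteq> 0" "poly B' x * poly B x = c"
      by blast
    \<comment> \<open>An inverse of \<open>a\<close> will make \<open>f\<close> monic, and an
      inverse of \<open>c\<close> will make \<open>g\<close> invertible after adjoining
      \<open>x\<close>.\<close>
    have "a * c \<in> R" "a * c \<noteq> 0" using a B' by (auto intro: mult_mem)
    then obtain R1 I p \<nu> where R1: "arith_frame R1 I p \<nu>" "R \<subseteq> R1" "R1 \<subseteq> fractions R" "1 / (a * c) \<in> R1"
      using adm unfolding admissible_def by blast
    interpret F: arith_frame R1 I p \<nu> by (rule R1(1))
    have "1 / a = c * (1 / (a * c))" "1 / c = a * (1 / (a * c))" using a B' by auto
    then have inv: "1 / a \<in> R1" "1 / c \<in> R1"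
      using a(1) B'(2) R1 by (metis F.mult_mem subsetD)+
    define f1 where "f1 = smult (1 / a) f"
    have f_R1: "f \<in> coeffs_in R1" using f(1) R1(2) by (auto simp: coeffs_in_def)
    have f1: "f1 \<in> coeffs_in R1" "lead_coeff f1 = 1" "degree f1 = degree f" "poly f1 x = 0"
      unfolding f1_def using inv f_R1 a f(3) by (auto intro: F.smult_in simp: a_def)
    have min1: "A = 0" if A: "A \<in> coeffs_in R1" "degree A < degree f1" "poly A x = 0" for A
    proof -
      have "A \<in> coeffs_in (fractions R)" using A(1) R1(3) by (auto simp: coeffs_in_def)
      then obtain d where d: "d \<in> R" "d \<noteq> 0" "smult d A \<in> coeffs_in R"
        using clear_denominators[of R A] subring_of_axioms by blast
      then have "smult d A = 0" using A f1(3) by (intro min) auto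
      then show "A = 0" using d by simp
    qed
    define K where "K = 2 + (\<Sum>i<degree f1. \<nu> (coeff f1 i))"
    interpret E: frame_extension R1 I p \<nu> x K 0 by unfold_locales (simp add: K_def)
    have "arith_frame (adjoin R1 x) E.ext_I p E.ext_nu"
      by (rule E.frame_integral[OF refl f1(1,2) _ f1(4) min1]) (auto simp: f1(3) deg_f K_def)
    moreover have "adjoin R x \<subseteq> adjoin R1 x"
      by (intro adjoin_mono F.subring_of_axioms R1(2))
    moreover have "adjoin R1 x \<subseteq> fractions (adjoin R x)"
    proof (rule F.adjoin_least)
      show "R1 \<subseteq> fractions (adjoin R x)"
        using R1(3) fractions_mono[OF subset_adjoin] by blast
      show "x \<in> fractions (adjoin R x)"
        using generator_in_adjoin subset_fractions[OF sub] by blast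
    qed (rule fractions_subring[OF sub])
    moreover have "1 / g \<in> adjoin R1 x"
    proof -
      have "c = poly B' x * a ^ m * g" using B'(4) Bx by (simp add: mult.assoc)
      then have "1 / g = poly B' x * a ^ m * (1 / c)" using g(2) B'(3) by (simp add: field_simps)
      moreover interpret S: subring_of "adjoin R1 x" by (rule F.adjoin_subring)
      have "poly B' x \<in> adjoin R1 x" using B'(1) R1(2) by (auto simp: adjoin_def coeffs_in_def)
      then have "poly B' x * a ^ m * (1 / c) \<in> adjoin R1 x"
        using inv(2) a(1) R1(2) F.subset_adjoin by (intro S.mult_mem S.power_mem) auto
      ultimately show ?thesis by simp
    qed
    ultimately show "\<exists>R' I p \<nu>. arith_frame R' I p \<nu> \<and> adjoin R x \<subseteq> R' \<and>
        R' \<subseteq> fractions (adjoin R x) \<and> 1 / g \<in> R'" by blast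
  qed
qed

lemma admissible_adjoin_transcendental:
  fixes R :: "'a::field_char_0 set"
  assumes adm: "admissible R"
    and trans: "\<And>A. A \<in> coeffs_in R \<Longrightarrow> poly A x = 0 \<Longrightarrow> A = 0"
  shows "admissible (adjoin R x)"
proof -
  interpret subring_of R using adm unfolding admissible_def by blast
  have sub: "subring_of (adjoin R x)" by (rule adjoin_subring)
  interpret RX: subring_of "adjoin R x" by (rule sub)
  show ?thesis unfolding admissible_def
  proof (intro conjI sub ballI impI)
    fix g assume g: "g \<in> adjoin R x" "g \<noteq> 0"
    then obtain G where G: "G \<in> coeffs_in R" "g = poly G x" by (auto simp: adjoin_def)
    then have "G \<noteq> 0" using g by auto
    then have "finite {y. poly G y = 0}" by (rule poly_roots_finite)
    then have "\<not> range (of_nat :: nat \<Rightarrow> 'a) \<subseteq> {y. poly G y = 0}"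
      using infinite_UNIV_char_0 finite_subset by (metis finite_imageD inj_of_nat)
    \<comment> \<open>Recentring at a natural number where \<open>G\<close> does not vanish: y = x -
      a gets order 1, so g is congruent to G(a), which is inverted before \<open>y\<close> is
      adjoined. Then g is a unit modulo the new filtration and can be inverted as well.\<close>
    then obtain a where a: "poly G (of_nat a) \<noteq> 0" by auto
    have "poly G (of_nat a) \<in> R" using G(1) by (intro poly_mem of_nat_mem)
    then obtain R1 I p \<nu> where R1: "arith_frame R1 I p \<nu>" "R \<subseteq> R1" "R1 \<subseteq> fractions R" "1 / poly G (of_nat a) \<in> R1"
      using adm a unfolding admissible_def by blast
    interpret F: arith_frame R1 I p \<nu> by (rule R1(1))
    define y where "y = x - of_nat a"
    interpret E: frame_extension R1 I p \<nu> y 2 1 by unfold_locales simp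
    have trans1: "A = 0" if A: "A \<in> coeffs_in R1" "poly A y = 0" for A
    proof -
      have "A \<in> coeffs_in (fractions R)" using A(1) R1(3) by (auto simp: coeffs_in_def)
      then obtain d where d: "d \<in> R" "d \<noteq> 0" "smult d A \<in> coeffs_in R"
        using clear_denominators[of R A] subring_of_axioms by blast
      have "pcompose (smult d A) [:- of_nat a, 1:] = 0"
      proof (rule trans)
        show "pcompose (smult d A) [:- of_nat a, 1:] \<in> coeffs_in R"
          using d(3) by (intro pcompose_in) (auto simp: pCons_in_iff polys_zero_mem intro!: ring_mems)
        show "poly (pcompose (smult d A) [:- of_nat a, 1:]) x = 0"
          using A(2) by (simp add: poly_pcompose y_def)
      qed
      then have "smult d A = 0" by (rule pcompose_eq_0) simp
      then show "A = 0" using d by simp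
    qed
    have fr: "arith_frame (adjoin R1 y) E.ext_I p E.ext_nu"
      by (rule E.frame_transcendental[OF refl trans1])
    interpret F1: arith_frame "adjoin R1 y" E.ext_I p E.ext_nu by (rule fr)
    interpret E1: frame_extension "adjoin R1 y" E.ext_I p E.ext_nu "1 / g" 2 0 by unfold_locales simp
    define H where "H = pcompose G [:of_nat a, 1:]"
    have H: "H \<in> coeffs_in R1"
      unfolding H_def
    proof (rule F.pcompose_in)
      show "G \<in> coeffs_in R1" using G(1) R1(2) by (auto simp: coeffs_in_def)
      show "[:of_nat a, 1:] \<in> coeffs_in R1"
        by (simp add: F.pCons_in_iff F.polys_zero_mem F.one_mem F.of_nat_mem)
    qed
    have gH: "g = poly H y" by (simp add: H_def poly_pcompose y_def G(2))
    define h where "h = 1 / poly G (of_nat a)"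
    have hR1: "h \<in> R1" using R1(4) by (simp add: h_def)
    have "1 - g * h = poly (1 - smult h H) y" by (simp add: gH)
    moreover have "poly (1 - smult h H) y \<in> E.ext_I 1"
    proof (rule E.ext_I_in)
      show mem: "1 - smult h H \<in> coeffs_in R1"
        using hR1 H by (intro F.polys_diff_mem F.polys_one_mem F.smult_in)
      have "coeff H 0 = poly G (of_nat a)" by (simp add: H_def poly_pcompose flip: poly_0_coeff_0)
      then have "coeff (1 - smult h H) 0 = 0" using a by (simp add: h_def)
      then show "coeff (1 - smult h H) i \<in> I (1 - 1 * i)" for i
        using F.coeff_in[OF mem, of i] by (cases i) (auto simp: F.fil_0 F.fil_zero)
    qed
    ultimately have "1 - g * h \<in> E.ext_I 1" by (simp only:)
    moreover have "g \<in> adjoin R1 y" using H by (auto simp: adjoin_def gH)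
    moreover have "h \<in> adjoin R1 y" using hR1 F.subset_adjoin by blast
    ultimately have "arith_frame (adjoin (adjoin R1 y) (1 / g)) E1.ext_I p E1.ext_nu"
      using g(2) by (intro E1.frame_localization[OF refl _ _ refl, of h])
    moreover have "adjoin R x \<subseteq> adjoin (adjoin R1 y) (1 / g)"
    proof (rule adjoin_least)
      show s: "subring_of (adjoin (adjoin R1 y) (1 / g))" by (rule F1.adjoin_subring)
      show "R \<subseteq> adjoin (adjoin R1 y) (1 / g)"
        using R1(2) F.subset_adjoin F1.subset_adjoin by blast
      have "y \<in> adjoin (adjoin R1 y) (1 / g)"
        using F.generator_in_adjoin F1.subset_adjoin by blast
      then have "y + of_nat a \<in> adjoin (adjoin R1 y) (1 / g)"
        by (intro subring_of.add_mem[OF s] subring_of.of_nat_mem[OF s])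
      then show "x \<in> adjoin (adjoin R1 y) (1 / g)" by (simp add: y_def)
    qed
    moreover have "adjoin (adjoin R1 y) (1 / g) \<subseteq> fractions (adjoin R x)"
    proof (intro F1.adjoin_least F.adjoin_least)
      show "R1 \<subseteq> fractions (adjoin R x)"
        using R1(3) fractions_mono[OF subset_adjoin] by blast
      have "y \<in> adjoin R x"
        unfolding y_def by (intro RX.diff_mem RX.of_nat_mem generator_in_adjoin)
      then show "y \<in> fractions (adjoin R x)"
        using subset_fractions[OF sub] by blast
      show "1 / g \<in> fractions (adjoin R x)"
        using g RX.one_mem by (intro inverse_in_fractions)
    qed (rule fractions_subring[OF sub])+
    ultimately show "\<exists>R' I p \<nu>. arith_frame R' I p \<nu> \<and> adjoin R x \<subseteq> R' \<and>
        R' \<subseteq> fractions (adjoin R x) \<and> 1 / g \<in> R'"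
      using F1.generator_in_adjoin by blast
  qed
qed

lemma arith_frame_exists:
  fixes E :: "'a::field_char_0 set"
  assumes "finite E"
  shows "\<exists>R I p \<nu>. arith_frame R I p \<nu> \<and> E \<subseteq> R"
proof -
  have "\<exists>R. admissible R \<and> E \<subseteq> R"
    using assms
  proof (induction E rule: finite_induct)
    case empty
    then show ?case using admissible_int by blast
  next
    case (insert x E)
    then obtain R where R: "admissible R" "E \<subseteq> R" by blast
    have "admissible (adjoin R x)"
      using admissible_adjoin_algebraic[OF R(1)] admissible_adjoin_transcendental[OF R(1)] by blast
    moreover have "insert x E \<subseteq> adjoin R x"
    proof -
      interpret subring_of R using R(1) by (simp add: admissible_def)
      show ?thesis using R(2) subset_adjoin[of x] generator_in_adjoin[of x] by auto
    qed
    ultimately show ?case by blast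
  qed
  then obtain R where R: "admissible R" "E \<subseteq> R" by blast
  then have "1 \<in> R" by (auto simp: admissible_def subring_of.one_mem)
  moreover have "(1::'a) \<noteq> 0" by simp
  ultimately obtain R' I p \<nu> where "arith_frame R' I p \<nu>" "R \<subseteq> R'"
    using R(1) unfolding admissible_def by blast
  then show ?thesis using R(2) by blast
qed

text \<open>
  Such frames arise from \<open>arith_frame\<close> by localizing the filtration at a maximal ideal \<open>P \<supseteq> I 1\<close>, which
  removes the nilpotent multipliers from the Liouville inequality.
\<close>

locale prime_frame = padic_ring R J p + normed_subring R \<nu>
  for R :: "'a::field_char_0 set" and J p \<nu> +
  fixes P :: "'a set"
  assumes P_subset: "P \<subseteq> R"
    and P_diff: "a \<in> P \<Longrightarrow> b \<in> P \<Longrightarrow> a - b \<in> P"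
    and P_mult: "r \<in> R \<Longrightarrow> a \<in> P \<Longrightarrow> r * a \<in> P"
    and P_one: "1 \<notin> P"
    and P_prime: "a \<in> R \<Longrightarrow> b \<in> R \<Longrightarrow> a * b \<in> P \<Longrightarrow> a \<in> P \<or> b \<in> P"
    and P_nil: "a \<in> P \<Longrightarrow> \<exists>M. a ^ M \<in> J 1"
    and P_cancel: "s \<in> R \<Longrightarrow> s \<notin> P \<Longrightarrow> a \<in> R \<Longrightarrow> s * a \<in> J c \<Longrightarrow> a \<in> J c"
    and P_liouville: "\<exists>C. \<forall>S. \<forall>b\<in>R. \<nu> b \<le> 2 ^ S \<and> b \<in> J (C * (S + 1)) \<longrightarrow> b = 0"

section \<open>Localization at a maximal ideal\<close>

lemma (in arith_frame) maximal_ideal_exists: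
  obtains P where "P \<subseteq> R" "I 1 \<subseteq> P" "\<And>a b. a \<in> P \<Longrightarrow> b \<in> P \<Longrightarrow> a - b \<in> P"
    "\<And>r a. r \<in> R \<Longrightarrow> a \<in> P \<Longrightarrow> r * a \<in> P" "1 \<notin> P"
    "\<And>a b. a \<in> R \<Longrightarrow> b \<in> R \<Longrightarrow> a * b \<in> P \<Longrightarrow> a \<in> P \<or> b \<in> P"
proof -
  obtain F where F: "finite F" "\<And>a. a \<in> R \<Longrightarrow> \<exists>b\<in>F. a - b \<in> I 1" using finite_quot[of 1] by blast
  define ideal where "ideal P \<longleftrightarrow> P \<subseteq> R \<and> I 1 \<subseteq> P \<and> (\<forall>a\<in>P. \<forall>b\<in>P. a - b \<in> P) \<and>
    (\<forall>r\<in>R. \<forall>a\<in>P. r * a \<in> P)" for P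
  define Q where "Q P \<longleftrightarrow> ideal P \<and> 1 \<notin> P" for P
  \<comment> \<open>An ideal containing \<open>I 1\<close> is determined by the representatives in
    the finite set \<open>F\<close> that are congruent to one of its elements, so a maximal ideal
    can be found by counting them.\<close>
  define tr where "tr P = {b \<in> F. \<exists>a\<in>P. a - b \<in> I 1}" for P
  have "Q (I 1)"
    unfolding Q_def ideal_def using one_notin fil_mem by (auto intro: fil_diff fil_mult_left)
  moreover have "\<forall>P. Q P \<longrightarrow> card (tr P) \<le> card F"
    using F(1) by (auto simp: tr_def intro!: card_mono)
  ultimately have "\<exists>P. Q P \<and> (\<forall>P'. Q P' \<longrightarrow> card (tr P') \<le> card (tr P))"
    using ex_has_greatest_nat[of Q "I 1" "\<lambda>P. card (tr P)" "Suc (card F)"] by (simp add: less_Suc_eq_le)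
  then obtain P where P: "Q P" "\<And>P'. Q P' \<Longrightarrow> card (tr P') \<le> card (tr P)"
    by (elim exE conjE) simp
  then have iP: "ideal P" "1 \<notin> P" by (auto simp: Q_def)
  then have P0: "0 \<in> P" using fil_zero by (auto simp: ideal_def)
  have Padd: "a + b \<in> P" if "a \<in> P" "b \<in> P" for a b
  proof -
    have "0 - b \<in> P" using iP P0 that(2) by (auto simp: ideal_def)
    then have "a - (0 - b) \<in> P" using iP that(1) unfolding ideal_def by blast
    then show ?thesis by simp
  qed
  have max: "P' \<subseteq> P" if P': "Q P'" "P \<subseteq> P'" for P'
  proof
    fix q assume q: "q \<in> P'"
    have fin: "finite (tr P')" using F(1) by (simp add: tr_def)
    have "tr P \<subseteq> tr P'" using P'(2) by (auto simp: tr_def)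
    then have eq: "tr P = tr P'" using P(2)[OF P'(1)] fin by (intro card_seteq) auto
    have "q \<in> R" using q P'(1) by (auto simp: Q_def ideal_def)
    then obtain b where b: "b \<in> F" "q - b \<in> I 1" using F(2) by blast
    then have "b \<in> tr P" using q unfolding eq by (auto simp: tr_def)
    then obtain a where a: "a \<in> P" "a - b \<in> I 1" by (auto simp: tr_def)
    have "(q - b) - (a - b) \<in> I 1" by (rule fil_diff[OF b(2) a(2)])
    then have "q - a \<in> P" using iP by (auto simp: ideal_def)
    then have "q - a + a \<in> P" using a(1) by (rule Padd)
    then show "q \<in> P" by simp
  qed
  show ?thesis
  proof
    show "a \<in> P \<or> b \<in> P" if ab: "a \<in> R" "b \<in> R" "a * b \<in> P" for a b
    proof (rule ccontr)
      assume na: "\<not> (a \<in> P \<or> b \<in> P)"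
      define P' where "P' = {x + a * r | x r. x \<in> P \<and> r \<in> R}"
      have sub: "P \<subseteq> P'" unfolding P'_def using zero_mem by force
      have "a \<in> P'" unfolding P'_def using P0 one_mem by force
      then have "\<not> Q P'" using max[OF _ sub] na by blast
      moreover have "ideal P'" unfolding ideal_def
      proof (intro conjI ballI)
        show "P' \<subseteq> R" using iP(1) ab(1) by (auto simp: P'_def ideal_def intro!: add_mem mult_mem)
        show "I 1 \<subseteq> P'" using iP(1) sub by (auto simp: ideal_def)
        fix u assume "u \<in> P'"
        then obtain x r where u: "u = x + a * r" "x \<in> P" "r \<in> R" by (auto simp: P'_def)
        show "u - v \<in> P'" if vP: "v \<in> P'" for v
        proof -
          obtain y s where v: "v = y + a * s" "y \<in> P" "s \<in> R" using vP by (auto simp: P'_def)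
          have "u - v = (x - y) + a * (r - s)" by (simp add: u v algebra_simps)
          moreover have "x - y \<in> P" "r - s \<in> R" using u v iP(1) by (auto simp: ideal_def intro: diff_mem)
          ultimately show ?thesis unfolding P'_def by blast
        qed
        show "s * u \<in> P'" if "s \<in> R" for s
        proof -
          have "s * u = s * x + a * (s * r)" by (simp add: u algebra_simps)
          moreover have "s * x \<in> P" "s * r \<in> R" using u that iP(1) by (auto simp: ideal_def intro: mult_mem)
          ultimately show ?thesis unfolding P'_def by blast
        qed
      qed
      ultimately have "1 \<in> P'" by (simp add: Q_def)
      then obtain x r where x: "1 = x + a * r" "x \<in> P" "r \<in> R" by (auto simp: P'_def)
      have "b = b * (x + a * r)" unfolding x(1)[symmetric] by simp
      also have "\<dots> = b * x + r * (a * b)" by (simp add: algebra_simps)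
      also have "\<dots> \<in> P" using x ab iP(1) by (intro Padd) (auto simp: ideal_def)
      finally show False using na by blast
    qed
  qed (use iP in \<open>auto simp: ideal_def\<close>)
qed

lemma (in arith_frame) prime_frame_exists: "\<exists>J P. prime_frame R J p \<nu> P"
proof -
  obtain P where P: "P \<subseteq> R" "I 1 \<subseteq> P" "\<And>a b. a \<in> P \<Longrightarrow> b \<in> P \<Longrightarrow> a - b \<in> P"
    "\<And>r a. r \<in> R \<Longrightarrow> a \<in> P \<Longrightarrow> r * a \<in> P" "1 \<notin> P"
    "\<And>a b. a \<in> R \<Longrightarrow> b \<in> R \<Longrightarrow> a * b \<in> P \<Longrightarrow> a \<in> P \<or> b \<in> P"
    by (rule maximal_ideal_exists) blast
  \<comment> \<open>The saturation of \<open>I c\<close> by the complement of \<open>P\<close>: it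
    makes elements outside \<open>P\<close> cancellable although they need not be inverted in
    \<open>R\<close>.\<close>
  define J where "J c = {b \<in> R. \<exists>s\<in>R - P. s * b \<in> I c}" for c
  have JI: "b \<in> J c" if "b \<in> R" "s \<in> R" "s \<notin> P" "s * b \<in> I c" for b s c
    using that by (auto simp: J_def)
  have IJ: "b \<in> J c" if "b \<in> I c" for b c
    using JI[of b 1 c] that P(5) fil_mem one_mem by auto
  have JE: "\<exists>s. b \<in> R \<and> s \<in> R \<and> s \<notin> P \<and> s * b \<in> I c" if "b \<in> J c" for b c
    using that by (auto simp: J_def)
  have Pm: "s * t \<in> R \<and> s * t \<notin> P" if "s \<in> R" "s \<notin> P" "t \<in> R" "t \<notin> P" for s t
    using that P(6) mult_mem by blast
  have "prime_frame R J p \<nu> P"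
  proof
    show "J 0 = R" using one_mem P(5) by (force simp: J_def fil_0 intro: mult_mem)
    show "J (Suc c) \<subseteq> J c" for c using fil_Suc[of c] by (auto simp: J_def)
    show "0 \<in> J c" for c by (rule IJ[OF fil_zero])
    show "prime p" "p > 2" by (rule prime_p p_gt_2)+
    show "of_nat p \<in> J 1" by (rule IJ[OF p_mem])
    show "a - b \<in> J c" if ab: "a \<in> J c" "b \<in> J c" for a b c
    proof -
      obtain s t where st: "a \<in> R" "s \<in> R" "s \<notin> P" "s * a \<in> I c" "b \<in> R" "t \<in> R" "t \<notin> P" "t * b \<in> I c"
        using JE[OF ab(1)] JE[OF ab(2)] by blast
      have "s * t * (a - b) = t * (s * a) - s * (t * b)" by (simp add: algebra_simps)
      also have "\<dots> \<in> I c"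
        by (rule fil_diff[OF fil_mult_left[OF st(6,4)] fil_mult_left[OF st(2,8)]])
      finally show ?thesis using JI[of "a - b" "s * t" c] Pm[OF st(2,3,6,7)] diff_mem[OF st(1,5)] by blast
    qed
    show "a * b \<in> J (i + j)" if ab: "a \<in> J i" "b \<in> J j" for a b i j
    proof -
      obtain s t where st: "a \<in> R" "s \<in> R" "s \<notin> P" "s * a \<in> I i" "b \<in> R" "t \<in> R" "t \<notin> P" "t * b \<in> I j"
        using JE[OF ab(1)] JE[OF ab(2)] by blast
      have "s * t * (a * b) = (s * a) * (t * b)" by (simp add: algebra_simps)
      also have "\<dots> \<in> I (i + j)" by (rule fil_mult[OF st(4,8)])
      finally show ?thesis using JI[of "a * b" "s * t" "i + j"] Pm[OF st(2,3,6,7)] mult_mem[OF st(1,5)] by blast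
    qed
    show "a \<in> J i" if a: "a \<in> R" "of_nat p * a \<in> J (Suc i)" for a i
    proof -
      obtain s where s: "s \<in> R" "s \<notin> P" "s * (of_nat p * a) \<in> I (Suc i)" using JE[OF a(2)] by blast
      then have "of_nat p * (s * a) \<in> I (Suc i)" by (simp add: mult_ac)
      then have "s * a \<in> I i" using p_cancel[OF mult_mem[OF s(1) a(1)]] by simp
      then show ?thesis using JI a s by blast
    qed
    show "\<exists>F. finite F \<and> (\<forall>a\<in>R. \<exists>b\<in>F. a - b \<in> J c)" for c
    proof -
      obtain F where "finite F" "\<forall>a\<in>R. \<exists>b\<in>F. a - b \<in> I c" using finite_quot[of c] by blast
      then show ?thesis using IJ by (intro exI[of _ F]) blast
    qed
    show "P \<subseteq> R" "1 \<notin> P" by (fact P)+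
    show "a - b \<in> P" if "a \<in> P" "b \<in> P" for a b using that by (rule P)
    show "r * a \<in> P" if "r \<in> R" "a \<in> P" for r a using that by (rule P)
    show "a \<in> P \<or> b \<in> P" if "a \<in> R" "b \<in> R" "a * b \<in> P" for a b using that by (rule P)
    show "a \<in> J c" if sa: "s \<in> R" "s \<notin> P" "a \<in> R" "s * a \<in> J c" for s a c
    proof -
      obtain t where t: "t \<in> R" "t \<notin> P" "t * (s * a) \<in> I c" using JE[OF sa(4)] by blast
      then have "t * s * a \<in> I c" by (simp add: mult.assoc)
      then show ?thesis using JI[of a "t * s" c] Pm[OF t(1,2) sa(1,2)] sa(3) by blast
    qed
    show "\<exists>M. a ^ M \<in> J 1" if a: "a \<in> P" for a
    proof -
      have aR: "a \<in> R" using a P(1) by blast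
      \<comment> \<open>Powers of \<open>a\<close> repeat modulo \<open>I 1\<close>, so
        \<open>I 1\<close> contains some a^i (1 - a^(k+1)). The second factor is outside
        \<open>P\<close>, hence a^i lies in \<open>J 1\<close>.\<close>
      obtain F where F: "finite F" "\<forall>a\<in>R. \<exists>b\<in>F. a - b \<in> I 1" using finite_quot[of 1] by blast
      have "\<exists>b\<in>F. a ^ n - b \<in> I 1" for n using F(2) power_mem[OF aR] by blast
      then obtain r where r: "\<And>n. r n \<in> F" "\<And>n. a ^ n - r n \<in> I 1" by metis
      have "\<not> inj r"
      proof
        assume "inj r"
        then have "infinite (range r)" by (rule range_inj_infinite)
        moreover have "range r \<subseteq> F" using r(1) by blast
        ultimately show False using F(1) finite_subset by blast
      qed
      then obtain m n where "m \<noteq> n" "r m = r n" by (auto simp: inj_def)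
      then obtain i k where ik: "r i = r (i + Suc k)"
        by (metis linorder_neqE_nat less_iff_Suc_add add_Suc_right)
      have "(a ^ i - r i) - (a ^ (i + Suc k) - r i) \<in> I 1"
        using r(2)[of i] r(2)[of "i + Suc k"] unfolding ik[symmetric] by (rule fil_diff)
      then have *: "(1 - a ^ Suc k) * a ^ i \<in> I 1" by (simp add: algebra_simps power_add)
      have "a ^ k * a \<in> P" by (rule P(4)[OF power_mem[OF aR] a])
      then have "1 - a ^ Suc k \<notin> P" using P(3)[of "1 - a ^ Suc k" "- (a ^ Suc k)"] P(5)
          P(4)[of "-1" "a ^ Suc k"] uminus_mem[OF one_mem] by (auto simp: mult.commute)
      then have "a ^ i \<in> J 1" using * aR by (intro JI[of _ "1 - a ^ Suc k"]) (auto intro!: diff_mem one_mem mult_mem power_mem)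
      then show ?thesis by blast
    qed
    obtain C where C: "\<And>S b \<sigma>. b \<in> R \<Longrightarrow> \<sigma> \<in> R \<Longrightarrow> b \<noteq> 0 \<Longrightarrow> \<nu> b \<le> 2 ^ S \<Longrightarrow>
        \<sigma> * b \<in> I (C * (S + 1)) \<Longrightarrow> \<exists>M. \<sigma> ^ M \<in> I 1"
      using liouville by blast
    show "\<exists>C. \<forall>S. \<forall>b\<in>R. \<nu> b \<le> 2 ^ S \<and> b \<in> J (C * (S + 1)) \<longrightarrow> b = 0"
    proof (rule exI[of _ C], intro allI ballI impI, elim conjE, rule ccontr)
      fix S b assume b: "b \<in> R" "\<nu> b \<le> 2 ^ S" "b \<in> J (C * (S + 1))" "b \<noteq> 0"
      \<comment> \<open>The denominator \<open>s\<close> is the multiplier in the Liouville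
        inequality of the frame: it would be nilpotent modulo \<open>I 1\<close> and therefore lie
        in \<open>P\<close>.\<close>
      obtain s where s: "s \<in> R" "s \<notin> P" "s * b \<in> I (C * (S + 1))" using JE[OF b(3)] by blast
      obtain M where "s ^ M \<in> I 1" using C[OF b(1) s(1) b(4) b(2) s(3)] by blast
      then have "s ^ M \<in> P" using P(2) by blast
      then have "s \<in> P"
      proof (induction M)
        case (Suc M)
        then show ?case using P(6)[OF s(1) power_mem[OF s(1)], of M] by auto
      qed (use P(5) in simp)
      then show False using s(2) by blast
    qed
  qed
  then show ?thesis by blast
qed

theorem prime_frame_containing:
  fixes E :: "'a::field_char_0 set"
  assumes "finite E"
  obtains R J p \<nu> P where "prime_frame R J p \<nu> P" "E \<subseteq> R"
  using arith_frame_exists[OF assms] arith_frame.prime_frame_exists by blast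

section \<open>Multivariate polynomials\<close>

lemma poly_mapping_sum_singles:
  "p = (\<Sum>e\<in>Poly_Mapping.keys p. Poly_Mapping.single e (Poly_Mapping.lookup p e))"
proof (rule poly_mapping_eqI)
  fix k
  show "Poly_Mapping.lookup p k =
      Poly_Mapping.lookup (\<Sum>e\<in>Poly_Mapping.keys p. Poly_Mapping.single e (Poly_Mapping.lookup p e)) k"
    by (simp add: lookup_sum lookup_single when_def in_keys_iff)
qed

definition mcoeffs_in :: "'k::zero set \<Rightarrow> ('v, 'k) mpoly \<Rightarrow> bool"
  where "mcoeffs_in R p \<longleftrightarrow> (\<forall>e. Poly_Mapping.lookup p e \<in> R)"

lemma mcoeffs_inD: "mcoeffs_in R p \<Longrightarrow> Poly_Mapping.lookup p e \<in> R"
  by (simp add: mcoeffs_in_def)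

lemma mpoly_induct_single:
  fixes p :: "('v, 'k::comm_monoid_add) mpoly"
  assumes "mcoeffs_in R p" "0 \<in> R"
    and single: "\<And>e c. c \<in> R \<Longrightarrow> P (Poly_Mapping.single e c)"
    and add: "\<And>p q. P p \<Longrightarrow> P q \<Longrightarrow> P (p + q)"
  shows "P p"
proof -
  have "P (\<Sum>e\<in>A. Poly_Mapping.single e (Poly_Mapping.lookup p e))" if "finite A" for A
    using that
  proof (induction A rule: finite_induct)
    case empty
    then show ?case using single[of 0 0] assms(2) by simp
  next
    case (insert x A)
    then show ?case using add single mcoeffs_inD[OF assms(1)] by simp
  qed
  from this[OF finite_keys, of p] show ?thesis using poly_mapping_sum_singles[of p] by simp
qed

lemma mpoly_single_add: "P 0 \<Longrightarrow> (\<And>e c. P (Poly_Mapping.single e c)) \<Longrightarrow> (\<And>p q. P p \<Longrightarrow> P q \<Longrightarrow> P (p + q)) \<Longrightarrow> P p"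
  for p :: "('v, 'k::comm_monoid_add) mpoly"
  by (rule mpoly_induct_single[of UNIV]) (auto simp: mcoeffs_in_def)

lemma mpoly_induct_in [consumes 2, case_names const var add mult]:
  fixes p :: "('v::finite, 'k::comm_semiring_1) mpoly"
  assumes "mcoeffs_in R p" "0 \<in> R"
    and const: "\<And>c. c \<in> R \<Longrightarrow> P (mconst c)"
    and var: "\<And>v. P (mvar v)"
    and add: "\<And>p q. P p \<Longrightarrow> P q \<Longrightarrow> P (p + q)"
    and mult: "\<And>p q. P p \<Longrightarrow> P q \<Longrightarrow> P (p * q)"
  shows "P p"
  using assms(1,2)
proof (rule mpoly_induct_single)
  show "P (p + q)" if "P p" "P q" for p q using that by (rule add)
  fix e :: "'v \<Rightarrow>\<^sub>0 nat" and c assume c: "c \<in> R"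
  show "P (Poly_Mapping.single e c)"
  proof (induction "\<Sum>v\<in>UNIV. Poly_Mapping.lookup e v" arbitrary: e)
    case 0
    then have "e = 0" by (intro poly_mapping_eqI) simp
    then show ?case using const[OF c] by (simp add: mconst_def)
  next
    case (Suc n)
    then obtain v where v: "Poly_Mapping.lookup e v \<noteq> 0"
      by (metis nat.distinct(1) sum.neutral)
    define e' where "e' = e - Poly_Mapping.single v 1"
    have e: "e = e' + Poly_Mapping.single v 1"
      by (rule poly_mapping_eqI) (use v in \<open>auto simp: e'_def lookup_add lookup_minus lookup_single when_def\<close>)
    have "(\<Sum>v\<in>UNIV. Poly_Mapping.lookup e v) = (\<Sum>v\<in>UNIV. Poly_Mapping.lookup e' v) + 1"
      by (subst e) (simp add: lookup_add sum.distrib lookup_single when_def)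
    then have "P (Poly_Mapping.single e' c)" using Suc by simp
    then have "P (Poly_Mapping.single e' c * mvar v)" using mult var by blast
    then show ?case by (subst e) (simp add: mvar_def mult_single)
  qed
qed

lemmas mpoly_induct [case_names const var add mult] =
  mpoly_induct_in[of UNIV, unfolded mcoeffs_in_def, simplified]

context
  fixes h :: "'k::comm_semiring_1 \<Rightarrow> 'a::comm_semiring_1" and s :: "'v::finite \<Rightarrow> 'a"
  assumes h0: "h 0 = 0" and h_add: "\<And>a b. h (a + b) = h a + h b"
begin

lemma minsert_superset:
  assumes "finite S" "Poly_Mapping.keys p \<subseteq> S"
  shows "minsert h s p = (\<Sum>e\<in>S. h (Poly_Mapping.lookup p e) * (\<Prod>v\<in>UNIV. s v ^ Poly_Mapping.lookup e v))"
proof -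
  have "(\<Prod>v\<in>Poly_Mapping.keys e. s v ^ Poly_Mapping.lookup e v) = (\<Prod>v\<in>UNIV. s v ^ Poly_Mapping.lookup e v)" for e
    by (rule prod.mono_neutral_left) (auto simp: in_keys_iff)
  then have "minsert h s p = (\<Sum>e\<in>Poly_Mapping.keys p. h (Poly_Mapping.lookup p e) * (\<Prod>v\<in>UNIV. s v ^ Poly_Mapping.lookup e v))"
    by (simp add: minsert_def)
  also have "\<dots> = (\<Sum>e\<in>S. h (Poly_Mapping.lookup p e) * (\<Prod>v\<in>UNIV. s v ^ Poly_Mapping.lookup e v))"
    by (rule sum.mono_neutral_left) (use assms h0 in \<open>auto simp: in_keys_iff\<close>)
  finally show ?thesis .
qed

lemma minsert_zero: "minsert h s 0 = 0"
  by (simp add: minsert_def)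

lemma minsert_add: "minsert h s (p + q) = minsert h s p + minsert h s q"
proof -
  let ?S = "Poly_Mapping.keys p \<union> Poly_Mapping.keys q"
  have fin: "finite ?S" by simp
  show ?thesis
    by (subst (1 2 3) minsert_superset[OF fin])
      (auto simp: lookup_add h_add sum.distrib algebra_simps dest: subsetD[OF keys_add])
qed

lemma minsert_single: "minsert h s (Poly_Mapping.single e c) = h c * (\<Prod>v\<in>UNIV. s v ^ Poly_Mapping.lookup e v)"
  by (subst minsert_superset[of "{e}"]) auto

lemma minsert_mult:
  assumes h_mult: "\<And>a b. h (a * b) = h a * h b"
  shows "minsert h s (p * q) = minsert h s p * minsert h s q"
proof (induction p rule: mpoly_single_add)
  case 1
  show ?case by (simp add: minsert_zero)
next
  case (2 e c)
  show ?case
  proof (induction q rule: mpoly_single_add)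
    case 1
    show ?case by (simp add: minsert_zero)
  next
    case (2 e' c')
    show ?case
      by (simp add: mult_single minsert_single h_mult lookup_add power_add prod.distrib mult_ac)
  next
    case (3 p q)
    then show ?case by (simp add: distrib_left minsert_add)
  qed
next
  case (3 p q)
  then show ?case by (simp add: distrib_right minsert_add)
qed

lemma minsert_const: "minsert h s (mconst c) = h c"
  by (simp add: mconst_def minsert_single)

lemma minsert_var: "h 1 = 1 \<Longrightarrow> minsert h s (mvar v) = s v"
  by (simp add: mvar_def minsert_single lookup_single when_def if_distrib[of "power _"] prod.delta cong: if_cong)

end

lemma mconst_0: "mconst 0 = 0" by (simp add: mconst_def)
lemma mconst_1: "mconst 1 = 1" by (simp add: mconst_def)
lemma mconst_add: "mconst (a + b) = mconst a + mconst b" by (simp add: mconst_def single_add)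
lemma mconst_mult: "mconst (a * b) = mconst a * mconst b" for a :: "'k::semiring_0"
  by (simp add: mconst_def mult_single)

context
  fixes x :: "'k::comm_semiring_1 ^ 'v::finite"
begin

lemma meval_0 [simp]: "meval x 0 = 0"
  and meval_add [simp]: "meval x (p + q) = meval x p + meval x q"
  and meval_mult [simp]: "meval x (p * q) = meval x p * meval x q"
  and meval_const [simp]: "meval x (mconst c) = c"
  and meval_var [simp]: "meval x (mvar v) = x $ v"
  and meval_single: "meval x (Poly_Mapping.single e c) = c * (\<Prod>v\<in>UNIV. x $ v ^ Poly_Mapping.lookup e v)"
  by (simp_all add: meval_def minsert_zero minsert_add minsert_mult minsert_const minsert_var minsert_single)

lemma meval_1 [simp]: "meval x 1 = 1"
  using meval_const[of 1] by (simp only: mconst_1)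

lemma meval_sum [simp]: "meval x (sum f A) = (\<Sum>a\<in>A. meval x (f a))"
  by (induction A rule: infinite_finite_induct) auto

lemma meval_prod [simp]: "meval x (prod f A) = (\<Prod>a\<in>A. meval x (f a))"
  by (induction A rule: infinite_finite_induct) auto

end

lemma meval_uminus [simp]: "meval x (- p) = - meval x p" for x :: "'k::comm_ring_1 ^ 'v::finite"
proof -
  have "meval x (- p) + meval x p = meval x (- p + p)" by (simp only: meval_add)
  then show ?thesis by (simp add: eq_neg_iff_add_eq_0)
qed

lemma meval_diff [simp]: "meval x (p - q) = meval x p - meval x q" for x :: "'k::comm_ring_1 ^ 'v::finite"
  using meval_add[of x p "- q"] by simp

lemma meval_of_nat [simp]: "meval x (of_nat n) = of_nat n"
  by (induction n) auto

lemma meval_of_int [simp]: "meval x (of_int n) = of_int n" for x :: "'k::comm_ring_1 ^ 'v::finite"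
  by (cases n) (auto simp del: of_nat_Suc)

lemma meval_det: "meval x (det A) = det (map_matrix (meval x) A)"
  for x :: "'k::comm_ring_1 ^ 'v::finite"
  by (simp add: det_def map_matrix_def)

lemma msubst_add [simp]: "msubst s (p + q) = msubst s p + msubst s q"
  and msubst_mult [simp]: "msubst s (p * q) = msubst s p * msubst s q"
  and msubst_const [simp]: "msubst s (mconst c) = mconst c"
  and msubst_var [simp]: "msubst s (mvar v) = s v"
  for s :: "'v::finite \<Rightarrow> ('w, 'k::comm_semiring_1) mpoly"
  by (simp_all add: msubst_def minsert_add minsert_mult minsert_const minsert_var
      mconst_0 mconst_1 mconst_add mconst_mult)

lemma meval_msubst: "meval x (msubst s p) = meval (\<chi> v. meval x (s v)) p"
  for s :: "'v::finite \<Rightarrow> ('w::finite, 'k::comm_semiring_1) mpoly"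
  by (induction p rule: mpoly_induct) auto

lemma pmap_eval_nth [simp]: "pmap_eval f x $ i = meval x (f $ i)"
  by (simp add: pmap_eval_def)

lemma pmap_eval_iterate: "pmap_eval (pmap_iterate n f) x = (pmap_eval f ^^ n) x"
proof (induction n)
  case 0
  then show ?case by (simp add: pmap_iterate_def pmap_id_def vec_eq_iff)
next
  case (Suc n)
  have "pmap_eval (pmap_iterate (Suc n) f) x = pmap_eval f (pmap_eval (pmap_iterate n f) x)"
    by (simp add: pmap_iterate_def pmap_compose_def vec_eq_iff meval_msubst pmap_eval_def)
  then show ?case using Suc by simp
qed

lemma mpderiv_superset:
  assumes "finite S" "Poly_Mapping.keys p \<subseteq> S"
  shows "mpderiv v p = (\<Sum>e\<in>S. Poly_Mapping.single (e - Poly_Mapping.single v 1)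
         (of_nat (Poly_Mapping.lookup e v) * Poly_Mapping.lookup p e))"
  unfolding mpderiv_def by (rule sum.mono_neutral_left) (use assms in \<open>auto simp: in_keys_iff\<close>)

lemma mpderiv_0 [simp]: "mpderiv v 0 = 0"
  by (simp add: mpderiv_def)

lemma mpderiv_add [simp]: "mpderiv v (p + q) = mpderiv v p + mpderiv v q"
proof -
  let ?S = "Poly_Mapping.keys p \<union> Poly_Mapping.keys q"
  have fin: "finite ?S" by simp
  show ?thesis
    by (subst (1 2 3) mpderiv_superset[OF fin])
      (auto simp: lookup_add distrib_left single_add sum.distrib dest: subsetD[OF keys_add])
qed

lemma mpderiv_sum [simp]: "mpderiv v (sum f A) = (\<Sum>a\<in>A. mpderiv v (f a))"
  by (induction A rule: infinite_finite_induct) auto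

lemma mpderiv_single: "mpderiv v (Poly_Mapping.single e c) =
    Poly_Mapping.single (e - Poly_Mapping.single v 1) (of_nat (Poly_Mapping.lookup e v) * c)"
  by (subst mpderiv_superset[of "{e}"]) auto

lemma mpderiv_const [simp]: "mpderiv v (mconst c) = 0"
  by (simp add: mconst_def mpderiv_single)

lemma mpderiv_var [simp]: "mpderiv v (mvar w) = (if v = w then 1 else 0)"
  by (simp add: mvar_def mpderiv_single lookup_single)

lemma mpderiv_mult [simp]: "mpderiv v (p * q) = mpderiv v p * q + p * mpderiv v q"
  for p q :: "('v, 'k::comm_semiring_1) mpoly"
proof (induction p rule: mpoly_single_add)
  case (2 e c)
  show ?case
  proof (induction q rule: mpoly_single_add)
    case (2 e' c')
    let ?v = "Poly_Mapping.single v 1"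
    have *: "Poly_Mapping.single (e + e' - ?v) (of_nat (Poly_Mapping.lookup e v) * a) =
        Poly_Mapping.single (e - ?v + e') (of_nat (Poly_Mapping.lookup e v) * a)" for e e' and a :: 'k
    proof (cases "Poly_Mapping.lookup e v = 0")
      case False
      then have "e + e' - ?v = e - ?v + e'"
        by (intro poly_mapping_eqI) (auto simp: lookup_add lookup_minus lookup_single when_def)
      then show ?thesis by simp
    qed simp
    show ?case
      using *[of e e' "c * c'"] *[of e' e "c * c'"]
      by (simp add: mult_single mpderiv_single lookup_add distrib_right distrib_left single_add add.commute mult_ac)
  qed (simp_all add: distrib_left algebra_simps)
qed (simp_all add: distrib_right algebra_simps)

lemma (in subring_of) mcoeffs_in_single: "c \<in> R \<Longrightarrow> mcoeffs_in R (Poly_Mapping.single e c)"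
  by (auto simp: mcoeffs_in_def lookup_single when_def zero_mem)

lemma (in subring_of) mcoeffs_in_add: "mcoeffs_in R p \<Longrightarrow> mcoeffs_in R q \<Longrightarrow> mcoeffs_in R (p + q)"
  by (auto simp: mcoeffs_in_def lookup_add add_mem)

lemma (in subring_of) mcoeffs_in_mult:
  assumes "mcoeffs_in R p" "mcoeffs_in R q"
  shows "mcoeffs_in R (p * q)"
  using assms(1) zero_mem
proof (rule mpoly_induct_single)
  fix e c assume c: "c \<in> R"
  show "mcoeffs_in R (Poly_Mapping.single e c * q)"
    using assms(2) zero_mem
  proof (rule mpoly_induct_single)
    show "mcoeffs_in R (Poly_Mapping.single e c * Poly_Mapping.single e' c')" if "c' \<in> R" for e' c'
      unfolding mult_single using c that by (intro mcoeffs_in_single mult_mem)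
  qed (simp add: distrib_left mcoeffs_in_add)
qed (simp add: distrib_right mcoeffs_in_add)

lemma (in subring_of) mcoeffs_in_0: "mcoeffs_in R 0"
  by (simp add: mcoeffs_in_def zero_mem)

lemma (in subring_of) mcoeffs_in_sum: "(\<And>a. a \<in> A \<Longrightarrow> mcoeffs_in R (f a)) \<Longrightarrow> mcoeffs_in R (sum f A)"
  by (induction A rule: infinite_finite_induct) (auto intro: mcoeffs_in_add mcoeffs_in_0)

lemma (in subring_of) mcoeffs_in_mpderiv: "mcoeffs_in R p \<Longrightarrow> mcoeffs_in R (mpderiv v p)"
  unfolding mpderiv_def
  by (intro mcoeffs_in_sum mcoeffs_in_single mult_mem of_nat_mem mcoeffs_inD)

lemma (in subring_of) meval_mem:
  assumes "mcoeffs_in R p" "\<And>i. x $ i \<in> R"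
  shows "meval x p \<in> R"
  using assms(1) zero_mem by (rule mpoly_induct_in) (auto intro: ring_mems assms(2))

lemma monom_degree_UNIV: "monom_degree e = (\<Sum>v\<in>UNIV. Poly_Mapping.lookup e v)"
  for e :: "'v::finite \<Rightarrow>\<^sub>0 nat"
  unfolding monom_degree_def by (rule sum.mono_neutral_left) (auto simp: in_keys_iff)

lemma monom_degree_le_total_degree: "e \<in> Poly_Mapping.keys p \<Longrightarrow> monom_degree e \<le> total_degree p"
  unfolding total_degree_def by (rule Max_ge) auto

lemma (in normed_subring) meval_size:
  fixes p :: "('v::finite, 'a) mpoly"
  assumes p: "mcoeffs_in R p"
  obtains C where "\<And>x X. (\<And>i. x $ i \<in> R) \<Longrightarrow> (\<And>i. \<nu> (x $ i) \<le> X) \<Longrightarrow> X \<ge> 1 \<Longrightarrow>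
    \<nu> (meval x p) \<le> C * X ^ total_degree p"
proof
  \<comment> \<open>Since \<open>\<nu> 1\<close> may exceed 1, a trivial power of a coordinate still
    costs a factor \<open>\<kappa>\<close>. One factor per variable and one for the empty product
    give \<open>c\<close>.\<close>
  define \<kappa> where "\<kappa> = max 1 (\<nu> 1)"
  define c where "c = \<kappa> ^ Suc CARD('v)"
  define C where "C = (\<Sum>e\<in>Poly_Mapping.keys p. \<nu> (Poly_Mapping.lookup p e) * c)"
  fix x :: "'a ^ 'v" and X
  assume x: "\<And>i. x $ i \<in> R" and X: "\<And>i. \<nu> (x $ i) \<le> X" "X \<ge> 1"
  have pow: "\<nu> (x $ v ^ n) \<le> \<kappa> * X ^ n" for v n
  proof (cases n)
    case (Suc m)
    have "\<nu> (x $ v ^ n) \<le> \<nu> (x $ v) ^ n" unfolding Suc by (rule nu_power[OF x])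
    also have "\<dots> \<le> 1 * X ^ n" using X(1) by (simp add: power_mono)
    also have "\<dots> \<le> \<kappa> * X ^ n" by (intro mult_le_mono1) (simp add: \<kappa>_def)
    finally show ?thesis .
  qed (simp add: \<kappa>_def)
  have prod: "\<nu> (\<Prod>v\<in>A. x $ v ^ f v) \<le> \<kappa> ^ Suc (card A) * X ^ (\<Sum>v\<in>A. f v)" if "finite A" for A and f :: "'v \<Rightarrow> nat"
    using that
  proof (induction A rule: finite_induct)
    case (insert v A)
    have "\<nu> (\<Prod>v\<in>insert v A. x $ v ^ f v) \<le> \<nu> (x $ v ^ f v) * \<nu> (\<Prod>v\<in>A. x $ v ^ f v)"
      using insert.hyps by (simp add: nu_mult prod_mem power_mem x)
    also have "\<dots> \<le> (\<kappa> * X ^ f v) * (\<kappa> ^ Suc (card A) * X ^ (\<Sum>v\<in>A. f v))"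
      by (intro mult_le_mono pow insert.IH)
    finally show ?case using insert.hyps by (simp add: power_add mult_ac)
  qed (simp add: \<kappa>_def)
  have "meval x p = (\<Sum>e\<in>Poly_Mapping.keys p. Poly_Mapping.lookup p e * (\<Prod>v\<in>UNIV. x $ v ^ Poly_Mapping.lookup e v))"
    unfolding meval_def by (rule minsert_superset) auto
  also have "\<nu> \<dots> \<le> (\<Sum>e\<in>Poly_Mapping.keys p. \<nu> (Poly_Mapping.lookup p e * (\<Prod>v\<in>UNIV. x $ v ^ Poly_Mapping.lookup e v)))"
    by (intro nu_sum mult_mem prod_mem power_mem x mcoeffs_inD[OF p])
  also have "\<dots> \<le> (\<Sum>e\<in>Poly_Mapping.keys p. \<nu> (Poly_Mapping.lookup p e) * c * X ^ total_degree p)"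
  proof (rule sum_mono)
    fix e assume e: "e \<in> Poly_Mapping.keys p"
    have "\<nu> (Poly_Mapping.lookup p e * (\<Prod>v\<in>UNIV. x $ v ^ Poly_Mapping.lookup e v)) \<le>
        \<nu> (Poly_Mapping.lookup p e) * \<nu> (\<Prod>v\<in>UNIV. x $ v ^ Poly_Mapping.lookup e v)"
      by (intro nu_mult prod_mem power_mem x mcoeffs_inD[OF p])
    also have "\<dots> \<le> \<nu> (Poly_Mapping.lookup p e) * (c * X ^ monom_degree e)"
      unfolding c_def monom_degree_UNIV by (intro mult_le_mono2 prod) simp
    also have "\<dots> \<le> \<nu> (Poly_Mapping.lookup p e) * (c * X ^ total_degree p)"
      using monom_degree_le_total_degree[OF e] X(2) by (intro mult_le_mono2 power_increasing)
    finally show "\<nu> (Poly_Mapping.lookup p e * (\<Prod>v\<in>UNIV. x $ v ^ Poly_Mapping.lookup e v)) \<le>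
        \<nu> (Poly_Mapping.lookup p e) * c * X ^ total_degree p" by (simp only: mult.assoc)
  qed
  finally show "\<nu> (meval x p) \<le> C * X ^ total_degree p" by (simp add: C_def sum_distrib_right)
qed

section \<open>Base coordinates of the total space\<close>

definition base :: "'k ^ ('m::finite + 'r::finite) \<Rightarrow> 'k ^ 'm"
  where "base x = (\<chi> i. x $ Inl i)"

lemma base_nth [simp]: "base x $ i = x $ Inl i"
  by (simp add: base_def)

lemma meval_pull_base [simp]: "meval x (pull_base p) = meval (base x) p"
  for p :: "('m::finite, 'k::comm_semiring_1) mpoly" and x :: "'k ^ ('m + 'r::finite)"
  by (simp add: pull_base_def meval_msubst base_def)

lemma pull_base_simps [simp]:
  "pull_base (p + q) = pull_base p + pull_base q"
  "pull_base (p * q) = pull_base p * pull_base q"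
  "pull_base (mconst c :: ('m, 'k) mpoly) = mconst c"
  "pull_base (mvar v) = mvar (Inl v)"
  for p q :: "('m::finite, 'k::comm_semiring_1) mpoly" and v :: 'm
  by (simp_all add: pull_base_def)

lemma mpderiv_pull_base_fiber [simp]: "mpderiv (Inr j) (pull_base p) = 0"
  for p :: "('m::finite, 'k::comm_semiring_1) mpoly"
  by (induction p rule: mpoly_induct) auto

lemma mpderiv_pull_base_base [simp]: "mpderiv (Inl i) (pull_base p) = pull_base (mpderiv i p)"
  for p :: "('m::finite, 'k::comm_semiring_1) mpoly"
  by (induction p rule: mpoly_induct) (auto simp flip: mconst_1 mconst_0)

lemma (in subring_of) mcoeffs_in_pull_base:
  fixes p :: "('m::finite, 'a) mpoly"
  assumes "mcoeffs_in R p"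
  shows "mcoeffs_in R (pull_base p :: ('m + 'r, 'a) mpoly)"
  using assms zero_mem
proof (rule mpoly_induct_in)
  show "mcoeffs_in R (pull_base (mvar v :: ('m, 'a) mpoly) :: ('m + 'r, 'a) mpoly)" for v
    unfolding pull_base_simps unfolding mvar_def by (rule mcoeffs_in_single[OF one_mem])
  show "mcoeffs_in R (pull_base (mconst c :: ('m, 'a) mpoly) :: ('m + 'r, 'a) mpoly)" if "c \<in> R" for c
    unfolding pull_base_simps unfolding mconst_def by (rule mcoeffs_in_single[OF that])
qed (auto intro: mcoeffs_in_add mcoeffs_in_mult)

section \<open>Hilbert's basis theorem\<close>

inductive_set ideal_gen :: "'a::comm_ring_1 set \<Rightarrow> 'a set \<Rightarrow> 'a set"
  for R B where
  zero: "0 \<in> ideal_gen R B"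
| add: "a \<in> ideal_gen R B \<Longrightarrow> r \<in> R \<Longrightarrow> b \<in> B \<Longrightarrow> a + r * b \<in> ideal_gen R B"

definition ideal_in :: "'a::comm_ring_1 set \<Rightarrow> 'a set \<Rightarrow> bool"
  where "ideal_in R I \<longleftrightarrow> I \<subseteq> R \<and> 0 \<in> I \<and> (\<forall>a\<in>I. \<forall>b\<in>I. a + b \<in> I) \<and> (\<forall>r\<in>R. \<forall>a\<in>I. r * a \<in> I)"

definition noetherian :: "'a::comm_ring_1 set \<Rightarrow> bool"
  where "noetherian R \<longleftrightarrow> (\<forall>I. ideal_in R I \<longrightarrow> (\<exists>B. finite B \<and> B \<subseteq> I \<and> I \<subseteq> ideal_gen R B))"

lemma ideal_gen_add:
  assumes "a \<in> ideal_gen R B" "b \<in> ideal_gen R B"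
  shows "a + b \<in> ideal_gen R B"
  using assms(2,1)
proof (induction b rule: ideal_gen.induct)
  case (add b r c)
  then show ?case using ideal_gen.add[of "a + b" R B r c] by (simp add: add.assoc)
qed simp

lemma ideal_gen_mono: "B \<subseteq> B' \<Longrightarrow> ideal_gen R B \<subseteq> ideal_gen R B'"
proof
  fix a assume "B \<subseteq> B'" "a \<in> ideal_gen R B"
  from this(2,1) show "a \<in> ideal_gen R B'"
    by (induction rule: ideal_gen.induct) (auto intro: ideal_gen.intros)
qed

lemma ideal_gen_least: "ideal_in R I \<Longrightarrow> B \<subseteq> I \<Longrightarrow> ideal_gen R B \<subseteq> I"
proof
  fix a assume "ideal_in R I" "B \<subseteq> I" "a \<in> ideal_gen R B"
  from this(3,1,2) show "a \<in> I"
    by (induction rule: ideal_gen.induct) (auto simp: ideal_in_def)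
qed

context subring_of
begin

lemma ideal_gen_mult:
  assumes "r \<in> R" "a \<in> ideal_gen R B"
  shows "r * a \<in> ideal_gen R B"
  using assms(2,1)
proof (induction a rule: ideal_gen.induct)
  case (add a s b)
  then show ?case using ideal_gen.add[of "r * a" R B "r * s" b] mult_mem by (simp add: algebra_simps)
qed (simp add: ideal_gen.zero)

lemma ideal_gen_base: "b \<in> B \<Longrightarrow> b \<in> ideal_gen R B"
  using ideal_gen.add[OF ideal_gen.zero one_mem, of b B] by simp

lemma ideal_gen_subset: "B \<subseteq> R \<Longrightarrow> ideal_gen R B \<subseteq> R"
proof
  fix a assume "B \<subseteq> R" "a \<in> ideal_gen R B"
  from this(2,1) show "a \<in> R"
    by (induction rule: ideal_gen.induct) (auto intro: ring_mems)
qed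

text \<open>The ascending chain condition for sequences: the union of the ideals generated by
  initial segments is finitely generated, so some finite stage contains all of it.\<close>

lemma noetherian_sequence:
  assumes "noetherian R" and f: "\<And>n::nat. f n \<in> R"
  shows "\<exists>n. f n \<in> ideal_gen R (f ` {..<n})"
proof -
  define G where "G n = ideal_gen R (f ` {..<n})" for n
  have mono: "G m \<subseteq> G n" if "m \<le> n" for m n
    unfolding G_def using that by (intro ideal_gen_mono) auto
  have "ideal_in R (\<Union>n. G n)"
    unfolding ideal_in_def
  proof (intro conjI ballI)
    show "(\<Union>n. G n) \<subseteq> R" unfolding G_def using f by (intro UN_least ideal_gen_subset) auto
    show "0 \<in> (\<Union>n. G n)" by (auto simp: G_def intro: ideal_gen.zero)
    show "r * a \<in> (\<Union>n. G n)" if "r \<in> R" "a \<in> (\<Union>n. G n)" for r a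
      using that by (auto simp: G_def intro: ideal_gen_mult)
    fix a b assume "a \<in> (\<Union>n. G n)" "b \<in> (\<Union>n. G n)"
    then obtain m n where "a \<in> G m" "b \<in> G n" by auto
    then have "a \<in> G (max m n)" "b \<in> G (max m n)"
      using mono[of m "max m n"] mono[of n "max m n"] by auto
    then have "a + b \<in> G (max m n)" unfolding G_def by (rule ideal_gen_add)
    then show "a + b \<in> (\<Union>n. G n)" by blast
  qed
  then obtain B where B: "finite B" "B \<subseteq> (\<Union>n. G n)" "(\<Union>n. G n) \<subseteq> ideal_gen R B"
    using assms(1) unfolding noetherian_def by blast
  have "\<exists>n. B \<subseteq> G n" using B(1,2)
  proof (induction B rule: finite_induct)
    case (insert b B)
    then obtain m n where "b \<in> G m" "B \<subseteq> G n" by auto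
    then have "insert b B \<subseteq> G (max m n)"
      using mono[of m "max m n"] mono[of n "max m n"] by auto
    then show ?case by blast
  qed simp
  then obtain n where n: "B \<subseteq> G n" by blast
  have "ideal_in R (G n)" unfolding ideal_in_def
  proof (intro conjI ballI)
    show "G n \<subseteq> R" unfolding G_def using f by (intro ideal_gen_subset) auto
    show "0 \<in> G n" by (simp add: G_def ideal_gen.zero)
  qed (auto simp: G_def intro: ideal_gen_mult ideal_gen_add)
  then have "ideal_gen R B \<subseteq> G n" using n by (rule ideal_gen_least)
  moreover have "f n \<in> G (Suc n)" unfolding G_def by (intro ideal_gen_base) auto
  ultimately have "f n \<in> G n" using B(3) by blast
  then show ?thesis unfolding G_def by blast
qed

text \<open>
  Pick elements of minimal degree outside the ideal generated by the previous ones; a relation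
  between the leading coefficients lowers a degree.
\<close>

lemma noetherian_polys:
  assumes noeth: "noetherian R"
  shows "noetherian (coeffs_in R)"
  unfolding noetherian_def
proof (intro allI impI, rule ccontr)
  fix I assume I: "ideal_in (coeffs_in R) I"
    and nex: "\<nexists>B. finite B \<and> B \<subseteq> I \<and> I \<subseteq> ideal_gen (coeffs_in R) B"
  define \<Phi> where "\<Phi> B = (SOME g. g \<in> I \<and> g \<notin> ideal_gen (coeffs_in R) B \<and>
     (\<forall>g'. g' \<in> I \<and> g' \<notin> ideal_gen (coeffs_in R) B \<longrightarrow> degree g \<le> degree g'))" for B
  have \<Phi>: "\<Phi> B \<in> I \<and> \<Phi> B \<notin> ideal_gen (coeffs_in R) B \<and>
     (\<forall>g'. g' \<in> I \<and> g' \<notin> ideal_gen (coeffs_in R) B \<longrightarrow> degree (\<Phi> B) \<le> degree g')"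
    if fin: "finite B" "B \<subseteq> I" for B
  proof -
    obtain g where g: "g \<in> I \<and> g \<notin> ideal_gen (coeffs_in R) B" using nex fin by blast
    have "\<exists>g. (g \<in> I \<and> g \<notin> ideal_gen (coeffs_in R) B) \<and>
     (\<forall>g'. g' \<in> I \<and> g' \<notin> ideal_gen (coeffs_in R) B \<longrightarrow> degree g \<le> degree g')"
      by (rule ex_has_least_nat) (rule g)
    then have "\<exists>g. g \<in> I \<and> g \<notin> ideal_gen (coeffs_in R) B \<and>
     (\<forall>g'. g' \<in> I \<and> g' \<notin> ideal_gen (coeffs_in R) B \<longrightarrow> degree g \<le> degree g')" by simp
    then show ?thesis unfolding \<Phi>_def by (rule someI_ex)
  qed
  define S where "S = rec_nat {} (\<lambda>_ B. insert (\<Phi> B) B)"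
  have S_simps: "S 0 = {}" "S (Suc n) = insert (\<Phi> (S n)) (S n)" for n
    by (simp_all add: S_def)
  define f where "f n = \<Phi> (S n)" for n
  have S_eq: "S n = f ` {..<n}" for n
    by (induction n) (auto simp: S_simps f_def lessThan_Suc)
  have S_sub: "finite (S n) \<and> S n \<subseteq> I" for n
    by (induction n) (use \<Phi> in \<open>auto simp: S_simps\<close>)
  have f: "f n \<in> I" "f n \<notin> ideal_gen (coeffs_in R) (S n)"
    "\<And>g'. g' \<in> I \<Longrightarrow> g' \<notin> ideal_gen (coeffs_in R) (S n) \<Longrightarrow> degree (f n) \<le> degree g'" for n
    using \<Phi>[of "S n"] S_sub[of n] by (auto simp: f_def)
  have fR: "f n \<in> coeffs_in R" for n using f(1)[of n] I by (auto simp: ideal_in_def)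
  have deg_mono: "degree (f m) \<le> degree (f n)" if "m < n" for m n
  proof (rule f(3)[OF f(1)])
    have "S m \<subseteq> S n" using that by (auto simp: S_eq)
    then show "f n \<notin> ideal_gen (coeffs_in R) (S m)" using f(2)[of n] ideal_gen_mono by blast
  qed
  define a where "a n = lead_coeff (f n)" for n
  obtain n where n: "a n \<in> ideal_gen R (a ` {..<n})"
    using noetherian_sequence[OF noeth, of a] coeff_in[OF fR] unfolding a_def by blast
  define d where "d = degree (f n)"
  \<comment> \<open>A relation between leading coefficients lifts to a combination of earlier
    elements with the same leading term as \<open>f n\<close>. Degrees along the sequence never
    decrease, so the exponents d - degree (f m) are not truncated.\<close>
  have "\<exists>g\<in>ideal_gen (coeffs_in R) (S n). (\<forall>i>d. coeff g i = 0) \<and> coeff g d = c"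
    if "c \<in> ideal_gen R (a ` {..<n})" for c
    using that
  proof (induction c rule: ideal_gen.induct)
    case zero
    then show ?case by (intro bexI[of _ 0]) (auto intro: ideal_gen.zero)
  next
    case (add c r b)
    then obtain g m where g: "g \<in> ideal_gen (coeffs_in R) (S n)" "\<forall>i>d. coeff g i = 0" "coeff g d = c"
      and m: "m < n" "b = a m" by auto
    have dm: "degree (f m) \<le> d" using deg_mono[OF m(1)] by (simp add: d_def)
    have "g + monom r (d - degree (f m)) * f m \<in> ideal_gen (coeffs_in R) (S n)"
      using g(1) add m by (intro ideal_gen.add monom_in) (auto simp: S_eq)
    moreover have "coeff (g + monom r (d - degree (f m)) * f m) i = 0" if "i > d" for i
      using that g(2) dm by (simp add: coeff_monom_mult coeff_eq_0)
    moreover have "coeff (g + monom r (d - degree (f m)) * f m) d = c + r * b"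
      using dm g(3) by (simp add: coeff_monom_mult m a_def)
    ultimately show ?case by blast
  qed
  from this[OF n] obtain g where g: "g \<in> ideal_gen (coeffs_in R) (S n)" "\<forall>i>d. coeff g i = 0" "coeff g d = a n"
    by blast
  have minus_one: "- 1 \<in> coeffs_in R" by (rule polys_ring_mems(5)[OF polys_one_mem])
  have "g \<in> I" using ideal_gen_least[OF I] S_sub g(1) by blast
  moreover have mg: "(-1) * g \<in> ideal_gen (coeffs_in R) (S n)"
    by (rule subring_of.ideal_gen_mult[OF coeffs_in_subring minus_one g(1)])
  ultimately have "f n + (-1) * g \<in> I"
    using I f(1)[of n] minus_one unfolding ideal_in_def by blast
  then have fgI: "f n - g \<in> I" by simp
  have fg: "f n - g \<notin> ideal_gen (coeffs_in R) (S n)"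
  proof
    assume "f n - g \<in> ideal_gen (coeffs_in R) (S n)"
    then have "f n - g + g \<in> ideal_gen (coeffs_in R) (S n)" using g(1) by (rule ideal_gen_add)
    then show False using f(2)[of n] by simp
  qed
  have "coeff (f n - g) i = 0" if "i \<ge> d" for i
    using that g by (cases "i = d") (auto simp: a_def d_def coeff_eq_0)
  moreover have "f n - g \<noteq> 0" using fg ideal_gen.zero by metis
  ultimately have "degree (f n - g) < d" by (intro degree_lessI) auto
  then show False using f(3)[OF fgI fg] by (simp add: d_def)
qed

text \<open>R[x] is a quotient of R[X]: generators of the preimage of an ideal are evaluated at
  \<open>x\<close>.\<close>

lemma noetherian_adjoin:
  assumes "noetherian R"
  shows "noetherian (adjoin R x)"
  unfolding noetherian_def
proof (intro allI impI)
  fix I assume I: "ideal_in (adjoin R x) I"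
  define I' where "I' = {A \<in> coeffs_in R. poly A x \<in> I}"
  have in_adj: "poly A x \<in> adjoin R x" if "A \<in> coeffs_in R" for A using that by (auto simp: adjoin_def)
  have "ideal_in (coeffs_in R) I'"
    using I unfolding ideal_in_def I'_def
    by (auto simp: polys_zero_mem in_adj intro: polys_ring_mems)
  then obtain B where B: "finite B" "B \<subseteq> I'" "I' \<subseteq> ideal_gen (coeffs_in R) B"
    using noetherian_polys[OF assms] unfolding noetherian_def by blast
  have *: "poly A x \<in> ideal_gen (adjoin R x) ((\<lambda>A. poly A x) ` B)" if "A \<in> ideal_gen (coeffs_in R) B" for A
    using that
  proof (induction A rule: ideal_gen.induct)
    case (add A r b)
    then show ?case using ideal_gen.add[OF add.IH in_adj[OF add.hyps(2)], of "poly b x"] by auto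
  qed (simp add: ideal_gen.zero)
  have "I \<subseteq> ideal_gen (adjoin R x) ((\<lambda>A. poly A x) ` B)"
  proof
    fix a assume a: "a \<in> I"
    then obtain A where "A \<in> coeffs_in R" "a = poly A x" using I by (auto simp: ideal_in_def adjoin_def)
    then have "A \<in> I'" using a by (simp add: I'_def)
    then show "a \<in> ideal_gen (adjoin R x) ((\<lambda>A. poly A x) ` B)" using * B(3) \<open>a = poly A x\<close> by blast
  qed
  moreover have "(\<lambda>A. poly A x) ` B \<subseteq> I" using B(2) by (auto simp: I'_def)
  ultimately show "\<exists>B. finite B \<and> B \<subseteq> I \<and> I \<subseteq> ideal_gen (adjoin R x) B" using B(1) by blast
qed

end

lemma noetherian_mpoly: "noetherian (UNIV :: ('v::finite, 'k::field) mpoly set)"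
proof -
  have sub: "subring_of (range (mconst :: 'k \<Rightarrow> ('v, 'k) mpoly))"
  proof
    show "1 \<in> range (mconst :: 'k \<Rightarrow> ('v, 'k) mpoly)" by (metis mconst_1 rangeI)
    have md: "mconst (a - b) = (mconst a - mconst b :: ('v, 'k) mpoly)" for a b :: 'k
      by (simp add: mconst_def single_diff)
    show "p - q \<in> range mconst" if "p \<in> range mconst" "q \<in> range mconst" for p q :: "('v, 'k) mpoly"
      using that by (auto simp flip: md)
    show "p * q \<in> range mconst" if "p \<in> range mconst" "q \<in> range mconst" for p q :: "('v, 'k) mpoly"
      using that by (auto simp flip: mconst_mult)
  qed
  have base: "noetherian (range (mconst :: 'k \<Rightarrow> ('v, 'k) mpoly))"
    unfolding noetherian_def
  proof (intro allI impI)
    fix I :: "('v, 'k) mpoly set" assume I: "ideal_in (range mconst) I"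
    show "\<exists>B. finite B \<and> B \<subseteq> I \<and> I \<subseteq> ideal_gen (range mconst) B"
    proof (cases "I \<subseteq> {0}")
      case True
      then have "I \<subseteq> ideal_gen (range mconst) {}" using ideal_gen.zero[of "range mconst" "{}"] by blast
      then show ?thesis by (intro exI[of _ "{}"]) auto
    next
      case False
      then obtain x where x: "x \<in> I" "x \<noteq> 0" by blast
      then obtain c where "x = mconst c" using I unfolding ideal_in_def by blast
      with x have c: "mconst c \<in> I" "mconst c \<noteq> (0 :: ('v, 'k) mpoly)" by simp_all
      then have "c \<noteq> 0" by (auto simp: mconst_0)
      have "mconst b \<in> ideal_gen (range mconst) {mconst c :: ('v, 'k) mpoly}" for b
        using ideal_gen.add[OF ideal_gen.zero rangeI[of mconst "b / c"], of "mconst c" "{mconst c}"] \<open>c \<noteq> 0\<close>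
        by (simp flip: mconst_mult)
      then have "I \<subseteq> ideal_gen (range mconst) {mconst c}"
        using I by (auto simp: ideal_in_def)
      then show ?thesis using c(1) by (intro exI[of _ "{mconst c}"]) auto
    qed
  qed
  have "\<exists>R. subring_of R \<and> noetherian R \<and> range mconst \<subseteq> R \<and> (mvar :: 'v \<Rightarrow> ('v, 'k) mpoly) ` S \<subseteq> R"
    if "finite S" for S
    using that
  proof (induction S rule: finite_induct)
    case empty
    then show ?case using sub base by auto
  next
    case (insert v S)
    then obtain R where R: "subring_of R" "noetherian R" "range mconst \<subseteq> R" "(mvar :: 'v \<Rightarrow> ('v, 'k) mpoly) ` S \<subseteq> R"
      by blast
    interpret subring_of R by (rule R(1))
    show ?case
      using adjoin_subring noetherian_adjoin[OF R(2)] subset_adjoin generator_in_adjoin R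
      by (intro exI[of _ "adjoin R (mvar v)"]) (simp add: subset_eq)
  qed
  from this[of UNIV] obtain R where R: "subring_of R" "noetherian R" "range mconst \<subseteq> R"
    "range (mvar :: 'v \<Rightarrow> ('v, 'k) mpoly) \<subseteq> R" by auto
  interpret subring_of R by (rule R(1))
  have "p \<in> R" for p
    by (induction p rule: mpoly_induct) (use R in \<open>auto intro: ring_mems\<close>)
  then have "R = UNIV" by blast
  then show ?thesis using R(2) by simp
qed

text \<open>A closed set may be given by infinitely many equations, whereas eventually periodic sets
  of times can be intersected only finitely often.\<close>

lemma zero_locus_finite:
  fixes P :: "('v::finite, 'k::field) mpoly set"
  shows "\<exists>P0. finite P0 \<and> zero_locus P = zero_locus P0"
proof -
  define I where "I = {p :: ('v, 'k) mpoly. \<forall>x\<in>zero_locus P. meval x p = 0}"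
  have "ideal_in UNIV I" by (auto simp: ideal_in_def I_def)
  then obtain B where B: "finite B" "B \<subseteq> I" "I \<subseteq> ideal_gen UNIV B"
    using noetherian_mpoly unfolding noetherian_def by blast
  have "meval x p = 0" if x: "x \<in> zero_locus B" and "p \<in> ideal_gen UNIV B" for x p
    using that(2) by (induction p rule: ideal_gen.induct) (use x in \<open>auto simp: zero_locus_def\<close>)
  moreover have "P \<subseteq> I" by (auto simp: I_def zero_locus_def)
  ultimately have "zero_locus B \<subseteq> zero_locus P" using B(3) by (auto simp: zero_locus_def)
  moreover have "zero_locus P \<subseteq> zero_locus B"
    using B(2) by (auto simp: zero_locus_def I_def)
  ultimately show ?thesis using B(1) by (intro exI[of _ B]) auto
qed

section \<open>Polynomials on lines\<close>

text \<open>The restriction of \<open>h\<close> to the line through the generic point with direction \<open>v\<close>.\<close>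

definition line_poly :: "'k ^ 'v \<Rightarrow> ('v::finite, 'k::comm_semiring_1) mpoly \<Rightarrow> ('v, 'k) mpoly poly"
  where "line_poly v = minsert (\<lambda>c. [:mconst c:]) (\<lambda>i. [:mvar i, mconst (v $ i):])"

lemma line_poly_simps [simp]:
  "line_poly v 0 = 0"
  "line_poly v (p + q) = line_poly v p + line_poly v q"
  "line_poly v (p * q) = line_poly v p * line_poly v q"
  "line_poly v (mconst c) = [:mconst c:]"
  "line_poly v (mvar i) = [:mvar i, mconst (v $ i):]"
proof -
  note mconst = mconst_0 mconst_1 mconst_add mconst_mult
  show "line_poly v 0 = 0" "line_poly v (p + q) = line_poly v p + line_poly v q"
    "line_poly v (mconst c) = [:mconst c:]" "line_poly v (mvar i) = [:mvar i, mconst (v $ i):]"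
    by (simp_all add: line_poly_def minsert_zero minsert_add minsert_const minsert_var mconst one_pCons)
  show "line_poly v (p * q) = line_poly v p * line_poly v q"
    unfolding line_poly_def by (rule minsert_mult) (simp_all add: mconst mult.commute)
qed

lemma line_poly_single: "line_poly v (Poly_Mapping.single e c) =
    [:mconst c:] * (\<Prod>i\<in>UNIV. [:mvar i, mconst (v $ i):] ^ Poly_Mapping.lookup e i)"
  by (simp add: line_poly_def minsert_single mconst_0 mconst_add)

lemma map_poly_meval:
  fixes x :: "'k::comm_semiring_1 ^ 'v::finite"
  shows "map_poly (meval x) (A + B) = map_poly (meval x) A + map_poly (meval x) B"
    and "map_poly (meval x) (A * B) = map_poly (meval x) A * map_poly (meval x) B"
  by (simp_all add: poly_eq_iff coeff_map_poly coeff_mult)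

lemma map_poly_meval_power:
  fixes x :: "'k::comm_semiring_1 ^ 'v::finite"
  shows "map_poly (meval x) (A ^ n) = map_poly (meval x) A ^ n"
proof (induction n)
  case 0
  show ?case by (simp add: one_pCons map_poly_pCons)
qed (simp add: map_poly_meval)

lemma poly_line_poly: "poly (map_poly (meval x) (line_poly v p)) s = meval (x + s *s v) p"
  for x :: "'k::comm_ring_1 ^ 'v::finite"
  by (induction p rule: mpoly_induct) (auto simp: map_poly_meval map_poly_pCons)

text \<open>A leading coefficient that may be 0: unlike the one attached to the degree, it is
  multiplicative in the presence of zero divisors.\<close>

definition top_coeff :: "nat \<Rightarrow> 'a::comm_semiring_1 poly \<Rightarrow> 'a \<Rightarrow> bool"
  where "top_coeff n A a \<longleftrightarrow> (\<forall>i>n. coeff A i = 0) \<and> coeff A n = a"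

lemma top_coeff_mult:
  assumes "top_coeff m A a" "top_coeff n B b"
  shows "top_coeff (m + n) (A * B) (a * b)"
  unfolding top_coeff_def
proof (intro conjI allI impI)
  have *: "coeff A i * coeff B (k - i) = 0" if "i \<le> k" "k \<ge> m + n" "k \<noteq> m + n \<or> i \<noteq> m" for i k
    using assms that unfolding top_coeff_def by (cases "i > m") auto
  show "coeff (A * B) k = 0" if "k > m + n" for k
    unfolding coeff_mult using * that by (intro sum.neutral) auto
  have "coeff (A * B) (m + n) = (\<Sum>i\<in>{m}. coeff A i * coeff B (m + n - i))"
    unfolding coeff_mult using * by (intro sum.mono_neutral_right) auto
  then show "coeff (A * B) (m + n) = a * b" using assms by (simp add: top_coeff_def)
qed

lemma top_coeff_power: "top_coeff m A a \<Longrightarrow> top_coeff (m * n) (A ^ n) (a ^ n)"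
proof (induction n)
  case 0
  then show ?case by (simp add: top_coeff_def)
next
  case (Suc n)
  then show ?case using top_coeff_mult[of m A a "m * n" "A ^ n" "a ^ n"] by simp
qed

lemma top_coeff_prod: "finite S \<Longrightarrow> (\<And>i. i \<in> S \<Longrightarrow> top_coeff (m i) (A i) (a i)) \<Longrightarrow>
    top_coeff (sum m S) (prod A S) (prod a S)"
proof (induction S rule: finite_induct)
  case empty
  then show ?case by (simp add: top_coeff_def)
next
  case (insert i S)
  then show ?case using top_coeff_mult[of "m i" "A i" "a i" "sum m S" "prod A S" "prod a S"] by simp
qed

lemma top_coeff_line_poly_single:
  "top_coeff (monom_degree e) (line_poly v (Poly_Mapping.single e c)) (mconst (meval v (Poly_Mapping.single e c)))"
  for v :: "'k::comm_semiring_1 ^ 'v::finite"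
proof -
  have lin: "top_coeff 1 [:mvar i, mconst (v $ i):] (mconst (v $ i))" for i
    by (auto simp: top_coeff_def coeff_pCons split: nat.splits)
  have "top_coeff (0 + (\<Sum>i\<in>UNIV. 1 * Poly_Mapping.lookup e i)) (line_poly v (Poly_Mapping.single e c))
      (mconst c * (\<Prod>i\<in>UNIV. mconst (v $ i) ^ Poly_Mapping.lookup e i))"
    unfolding line_poly_single
    by (intro top_coeff_mult top_coeff_prod top_coeff_power lin)
      (auto simp: top_coeff_def coeff_pCons split: nat.splits)
  moreover have pw: "mconst (a ^ n) = (mconst a ^ n :: ('v, 'k) mpoly)" for a :: 'k and n
    by (induction n) (auto simp: mconst_1 mconst_mult)
  moreover have pr: "mconst (\<Prod>i\<in>S. f i) = (\<Prod>i\<in>S. mconst (f i) :: ('v, 'k) mpoly)" for f :: "'v \<Rightarrow> 'k" and S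
    by (induction S rule: infinite_finite_induct) (auto simp: mconst_1 mconst_mult)
  ultimately show ?thesis
    by (simp add: monom_degree_UNIV meval_single mconst_mult)
qed

definition hom_top :: "('v::finite, 'k::comm_semiring_1) mpoly \<Rightarrow> ('v, 'k) mpoly"
  where "hom_top p = (\<Sum>e\<in>{e \<in> Poly_Mapping.keys p. monom_degree e = total_degree p}.
    Poly_Mapping.single e (Poly_Mapping.lookup p e))"

lemma line_poly_sum [simp]: "line_poly v (sum f A) = (\<Sum>a\<in>A. line_poly v (f a))"
  by (induction A rule: infinite_finite_induct) auto

lemma mconst_sum: "mconst (sum f A) = (\<Sum>a\<in>A. mconst (f a))"
  by (induction A rule: infinite_finite_induct) (auto simp: mconst_0 mconst_add)

lemma top_coeff_line_poly: "top_coeff (total_degree p) (line_poly v p) (mconst (meval v (hom_top p)))"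
  for v :: "'k::comm_semiring_1 ^ 'v::finite"
  unfolding top_coeff_def
proof (intro conjI allI impI)
  let ?s = "\<lambda>e. Poly_Mapping.single e (Poly_Mapping.lookup p e)"
  have lp: "line_poly v p = (\<Sum>e\<in>Poly_Mapping.keys p. line_poly v (?s e))"
    by (subst poly_mapping_sum_singles[of p]) simp
  have le: "monom_degree e \<le> total_degree p" if "e \<in> Poly_Mapping.keys p" for e
    using that by (rule monom_degree_le_total_degree)
  note top = top_coeff_line_poly_single[of _ v, unfolded top_coeff_def]
  show "coeff (line_poly v p) i = 0" if "i > total_degree p" for i
    unfolding lp coeff_sum using le that top by (intro sum.neutral) (meson le_less_trans)
  have "coeff (line_poly v p) (total_degree p) =
      (\<Sum>e\<in>{e \<in> Poly_Mapping.keys p. monom_degree e = total_degree p}. coeff (line_poly v (?s e)) (total_degree p))"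
    unfolding lp coeff_sum
  proof (rule sum.mono_neutral_right)
    show "\<forall>e\<in>Poly_Mapping.keys p - {e \<in> Poly_Mapping.keys p. monom_degree e = total_degree p}.
        coeff (line_poly v (?s e)) (total_degree p) = 0"
      using le top by (metis (mono_tags, lifting) Diff_iff mem_Collect_eq le_neq_implies_less)
  qed auto
  also have "\<dots> = (\<Sum>e\<in>{e \<in> Poly_Mapping.keys p. monom_degree e = total_degree p}. mconst (meval v (?s e)))"
  proof (intro sum.cong refl)
    fix e assume "e \<in> {e \<in> Poly_Mapping.keys p. monom_degree e = total_degree p}"
    then show "coeff (line_poly v (?s e)) (total_degree p) = mconst (meval v (?s e))"
      using top[of e "Poly_Mapping.lookup p e"] by simp
  qed
  finally show "coeff (line_poly v p) (total_degree p) = mconst (meval v (hom_top p))"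
    by (simp add: hom_top_def mconst_sum)
qed

text \<open>
  Over an infinite field a nonzero top form does not vanish everywhere. Passing to a representative
  of minimal degree of the function \<open>h\<close> is a cheap substitute for this fact.
\<close>

lemma nonvanishing_top_form:
  fixes h :: "('v::finite, 'k::field) mpoly"
  shows "(\<forall>x. meval x h = 0) \<or> (\<exists>h' v. (\<forall>x. meval x h' = meval x h) \<and> meval v (hom_top h') \<noteq> 0)"
proof (induction "total_degree h" arbitrary: h rule: less_induct)
  case less
  show ?case
  proof (cases "\<exists>v. meval v (hom_top h) \<noteq> 0")
    case True
    then show ?thesis by blast
  next
    case False
    define g where "g = h - hom_top h"
    have g: "meval x g = meval x h" for x using False by (simp add: g_def)
    have "Poly_Mapping.lookup (hom_top h) e = (if monom_degree e = total_degree h then Poly_Mapping.lookup h e else 0)" for e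
      by (simp add: hom_top_def lookup_sum lookup_single when_def in_keys_iff)
    then have keys: "Poly_Mapping.keys g \<subseteq> {e \<in> Poly_Mapping.keys h. monom_degree e \<noteq> total_degree h}"
      by (auto simp: g_def in_keys_iff lookup_minus split: if_splits)
    show ?thesis
    proof (cases "g = 0")
      case True
      then show ?thesis using g by (metis meval_0)
    next
      case nz: False
      have lt: "monom_degree e < total_degree h" if "e \<in> Poly_Mapping.keys g" for e
        using that keys monom_degree_le_total_degree[of e h] by fastforce
      obtain e where "e \<in> Poly_Mapping.keys g" using nz by (metis all_not_in_conv keys_eq_empty)
      then have "0 < total_degree h" using lt[of e] by simp
      then have "total_degree g < total_degree h"
        unfolding total_degree_def[of g] using lt by (subst Max_less_iff) auto
      from less[OF this] show ?thesis using g by metis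
    qed
  qed
qed

lemma monic_division:
  fixes H :: "'a::comm_ring_1 poly"
  assumes "top_coeff D H 1"
  shows "\<exists>Q B. A = Q * H + B \<and> (\<forall>i\<ge>D. coeff B i = 0)"
proof -
  have "(\<forall>i\<ge>D + m. coeff A i = 0) \<Longrightarrow> \<exists>Q B. A = Q * H + B \<and> (\<forall>i\<ge>D. coeff B i = 0)" for m A
  proof (induction m arbitrary: A)
    case 0
    then show ?case by (intro exI[of _ 0] exI[of _ A]) simp
  next
    case (Suc m)
    define A1 where "A1 = A - monom (coeff A (D + m)) m * H"
    have "coeff A1 i = 0" if "i \<ge> D + m" for i
      using that Suc.prems assms unfolding top_coeff_def A1_def
      by (cases "i = D + m") (auto simp: coeff_monom_mult)
    then obtain Q B where QB: "A1 = Q * H + B" "\<forall>i\<ge>D. coeff B i = 0" using Suc.IH by blast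
    then have "A = (Q + monom (coeff A (D + m)) m) * H + B"
      by (simp add: A1_def algebra_simps)
    then show ?case using QB(2) by blast
  qed
  from this[of "degree A + 1" A] show ?thesis by (simp add: coeff_eq_0)
qed

text \<open>With multiplicities \<open>p\<close> has degree p linear factors, and every one of them
  divides \<open>q\<close>.\<close>

lemma dvd_power_of_roots:
  fixes p q :: "'k::alg_closed_field poly"
  assumes "p \<noteq> 0" "\<And>x. poly p x = 0 \<Longrightarrow> poly q x = 0"
  shows "p dvd q ^ degree p"
proof -
  obtain A where A: "size A = degree p" "p = smult (lead_coeff p) (\<Prod>x\<in>#A. [:-x, 1:])"
    using alg_closed_imp_factorization[OF assms(1)] by blast
  have "poly q x = 0" if "x \<in># A" for x
  proof (rule assms(2))
    have "poly (\<Prod>x\<in>#A. [:-x, 1:]) x = 0"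
      using that by (auto simp: poly_prod_mset prod_mset_zero_iff)
    then show "poly p x = 0" by (subst A(2)) simp
  qed
  then have "(\<Prod>x\<in>#A. [:-x, 1:]) dvd q ^ size A"
  proof (induction A)
    case (add x A)
    then have "[:-x, 1:] dvd q" by (simp add: poly_eq_0_iff_dvd)
    moreover have "(\<Prod>x\<in>#A. [:-x, 1:]) dvd q ^ size A" using add by simp
    ultimately have "[:-x, 1:] * (\<Prod>x\<in>#A. [:-x, 1:]) dvd q * q ^ size A" by (rule mult_dvd_mono)
    then show ?case by (simp only: image_mset_add_mset prod_mset.add_mset size_add_mset power_Suc)
  qed simp
  then show ?thesis using assms(1) A by (metis smult_dvd_iff leading_coeff_0_iff)
qed

text \<open>
  Nullstellensatz for one polynomial: along a direction \<open>v\<close> in which \<open>h\<close> is monic, the remainder of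
  a power of \<open>f\<close> modulo \<open>h\<close> vanishes at every point, because there \<open>h\<close> splits into linear factors.
\<close>

lemma principal_nullstellensatz:
  fixes h f :: "('v::finite, 'k::alg_closed_field) mpoly"
  assumes "\<And>x. meval x h = 0 \<Longrightarrow> meval x f = 0"
  shows "\<exists>D Q. \<forall>x. meval x f ^ D = meval x Q * meval x h"
proof -
  consider "\<forall>x. meval x h = 0" | h' v where "\<forall>x. meval x h' = meval x h" "meval v (hom_top h') \<noteq> 0"
    using nonvanishing_top_form[of h] by blast
  then show ?thesis
  proof cases
    case 1
    then have "\<forall>x. meval x f ^ 1 = meval x 0 * meval x h" using assms by simp
    then show ?thesis by blast
  next
    case (2 h' v)
    \<comment> \<open>The top coefficient along \<open>v\<close> is constant, so the restriction to
      every parallel line has the same degree \<open>D\<close>. This is why one exponent and one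
      cofactor serve all points: the division is done once, at the generic point, and
      specialized.\<close>
    define D where "D = total_degree h'"
    define c where "c = meval v (hom_top h')"
    define H where "H = smult (mconst (1 / c)) (line_poly v h')"
    have top: "top_coeff D H 1"
      using top_coeff_line_poly[of h' v] 2 unfolding top_coeff_def H_def D_def[symmetric] c_def[symmetric]
      by (simp add: c_def[symmetric] mconst_1 flip: mconst_mult)
    obtain Q B where QB: "line_poly v f ^ D = Q * H + B" "\<forall>i\<ge>D. coeff B i = 0"
      using monic_division[OF top] by blast
    have "meval a f ^ D = meval a (coeff Q 0 * mconst (1 / c)) * meval a h" for a
    proof -
      let ?m = "map_poly (meval a)"
      have eq: "?m (line_poly v f) ^ D = ?m Q * ?m H + ?m B"
        using arg_cong[OF QB(1), of ?m] by (simp add: map_poly_meval map_poly_meval_power)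
      have H_eval: "poly (?m H) s = 1 / c * meval (a + s *s v) h'" for s
      proof -
        have "H = [:mconst (1 / c):] * line_poly v h'" by (simp add: H_def)
        then have "?m H = ?m [:mconst (1 / c):] * ?m (line_poly v h')" by (simp only: map_poly_meval)
        then show ?thesis by (simp add: map_poly_pCons poly_line_poly)
      qed
      have H0: "?m H \<noteq> 0" and degH: "degree (?m H) = D"
      proof -
        have cH: "coeff (?m H) D = 1" "\<And>i. i > D \<Longrightarrow> coeff (?m H) i = 0"
          using top by (auto simp: top_coeff_def coeff_map_poly)
        then show "?m H \<noteq> 0" by auto
        show "degree (?m H) = D"
          using cH by (intro antisym degree_le le_degree) auto
      qed
      have "?m H dvd ?m (line_poly v f) ^ degree (?m H)"
      proof (rule dvd_power_of_roots[OF H0])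
        fix s assume "poly (?m H) s = 0"
        then have "meval (a + s *s v) h = 0" using 2 by (simp add: H_eval c_def)
        then show "poly (?m (line_poly v f)) s = 0" by (simp add: poly_line_poly assms)
      qed
      then have dvd: "?m H dvd ?m B" unfolding degH eq by (simp add: dvd_add_right_iff)
      have "?m B = 0"
      proof (rule ccontr)
        assume nz: "?m B \<noteq> 0"
        then have "D \<le> degree (?m B)" using dvd degH by (metis dvd_imp_degree_le)
        then have "coeff (?m B) (degree (?m B)) = 0" using QB(2) by (simp add: coeff_map_poly)
        then show False using nz by simp
      qed
      then have "poly (?m (line_poly v f)) 0 ^ D = poly (?m Q) 0 * poly (?m H) 0"
        using eq by (metis add_0_right poly_mult poly_power)
      then have "meval a f ^ D = poly (?m Q) 0 * (1 / c * meval a h')"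
        by (simp add: poly_line_poly H_eval)
      moreover have "poly (?m Q) 0 = meval a (coeff Q 0)"
        by (simp add: poly_0_coeff_0 coeff_map_poly)
      ultimately show ?thesis using 2(1) by simp
    qed
    then show ?thesis by blast
  qed
qed

text \<open>On the line through the two points the polynomial has no root, so it is constant
  there.\<close>

lemma nonvanishing_imp_constant:
  fixes p :: "('v::finite, 'k::alg_closed_field) mpoly"
  assumes "\<And>x. meval x p \<noteq> 0"
  shows "meval x p = meval y p"
proof -
  define A where "A = map_poly (meval x) (line_poly (y - x) p)"
  have A: "poly A s = meval (x + s *s (y - x)) p" for s
    by (simp add: A_def poly_line_poly)
  have "degree A = 0"
    using alg_closed_imp_poly_has_root[of A] assms A by (metis gr0I)
  then obtain c where "A = [:c:]" by (rule degree_eq_zeroE)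
  then have "poly A 0 = poly A 1" by simp
  then show ?thesis by (simp add: A)
qed

section \<open>Zeros along an orbit\<close>

definition eventually_periodic :: "nat set \<Rightarrow> bool"
  where "eventually_periodic S \<longleftrightarrow> (\<exists>N k. k > 0 \<and> (\<forall>n\<ge>N. n \<in> S \<longleftrightarrow> n + k \<in> S))"

lemma eventually_periodicI: "k > 0 \<Longrightarrow> (\<And>n. n \<ge> N \<Longrightarrow> n \<in> S \<longleftrightarrow> n + k \<in> S) \<Longrightarrow> eventually_periodic S"
  unfolding eventually_periodic_def by blast

lemma period_multiple:
  fixes S :: "nat set"
  assumes "\<And>n. n \<ge> N \<Longrightarrow> n \<in> S \<longleftrightarrow> n + k \<in> S"
  shows "n \<ge> N \<Longrightarrow> n \<in> S \<longleftrightarrow> n + k * t \<in> S"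
proof (induction t)
  case (Suc t)
  then show ?case using assms[of "n + k * t"] by (simp add: algebra_simps)
qed simp

lemma eventually_periodic_Int:
  assumes "eventually_periodic S" "eventually_periodic T"
  shows "eventually_periodic (S \<inter> T)"
proof -
  obtain M k where k: "k > 0" "\<And>n. n \<ge> M \<Longrightarrow> n \<in> S \<longleftrightarrow> n + k \<in> S"
    using assms(1) unfolding eventually_periodic_def by blast
  obtain N l where l: "l > 0" "\<And>n. n \<ge> N \<Longrightarrow> n \<in> T \<longleftrightarrow> n + l \<in> T"
    using assms(2) unfolding eventually_periodic_def by blast
  show ?thesis
  proof (rule eventually_periodicI[of "k * l" "max M N"])
    show "n \<in> S \<inter> T \<longleftrightarrow> n + k * l \<in> S \<inter> T" if "n \<ge> max M N" for n
      using period_multiple[of M S k n l, OF k(2)] period_multiple[of N T l n k, OF l(2)] that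
      by (simp add: mult.commute)
  qed (use k l in simp)
qed

lemma eventually_periodic_UNIV: "eventually_periodic UNIV"
  by (rule eventually_periodicI[of 1 0]) auto

lemma eventually_periodic_eventually:
  assumes "eventually_periodic {n. Q n}" "\<And>n. n \<ge> N \<Longrightarrow> P (n + m) \<longleftrightarrow> Q n"
  shows "eventually_periodic {n. P n}"
proof -
  obtain M k where k: "k > 0" "\<And>n. n \<ge> M \<Longrightarrow> Q n \<longleftrightarrow> Q (n + k)"
    using assms(1) unfolding eventually_periodic_def by auto
  show ?thesis
  proof (rule eventually_periodicI[OF k(1), of "M + N + m"])
    fix n assume n: "n \<ge> M + N + m"
    then have "P n \<longleftrightarrow> Q (n - m)" using assms(2)[of "n - m"] by simp
    also have "\<dots> \<longleftrightarrow> Q (n - m + k)" using n by (intro k(2)) simp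
    also have "\<dots> \<longleftrightarrow> P (n + k)" using assms(2)[of "n - m + k"] n by simp
    finally show "n \<in> {n. P n} \<longleftrightarrow> n + k \<in> {n. P n}" by simp
  qed
qed

lemma eventually_periodic_imp_progressions:
  assumes "eventually_periodic S"
  shows "finite_union_of_progressions S"
proof -
  obtain N k where k: "k > 0" "\<And>n. n \<ge> N \<Longrightarrow> n \<in> S \<longleftrightarrow> n + k \<in> S"
    using assms unfolding eventually_periodic_def by blast
  \<comment> \<open>A time before \<open>N\<close> gets step 0, hence a singleton; each later
    residue class is represented by its member in [N, N + k).\<close>
  define f where "f n = {n + (if n < N then 0 else k) * t | t. True}" for n
  have "S = \<Union>(f ` {n \<in> S. n < N + k})"
  proof (intro set_eqI iffI)
    fix n assume n: "n \<in> S"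
    show "n \<in> \<Union>(f ` {n \<in> S. n < N + k})"
    proof (cases "n < N")
      case True
      then have "n \<in> f n" by (auto simp: f_def)
      then show ?thesis using n True by auto
    next
      case False
      define r where "r = N + (n - N) mod k"
      have eq: "n = r + k * ((n - N) div k)" using False by (simp add: r_def)
      have r: "r \<ge> N" "r < N + k" using k by (simp_all add: r_def)
      then have "r \<in> S" using period_multiple[of N S k r "(n - N) div k", OF k(2)] n eq by simp
      moreover have "n \<in> f r" using r(1) eq by (auto simp: f_def)
      ultimately show ?thesis using r(2) by blast
    qed
  next
    fix n assume "n \<in> \<Union>(f ` {n \<in> S. n < N + k})"
    then obtain r t where r: "r \<in> S" "n = r + (if r < N then 0 else k) * t" by (auto simp: f_def)
    then show "n \<in> S" using period_multiple[of N S k r t, OF k(2)] by (auto split: if_splits)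
  qed
  moreover have "arithmetic_progression (f n)" for n
    unfolding arithmetic_progression_def f_def by blast
  ultimately show ?thesis
    unfolding finite_union_of_progressions_def by (intro exI[of _ "f ` {n \<in> S. n < N + k}"]) auto
qed

text \<open>
  \<open>weighted I y w f\<close>: the function \<open>f\<close> is a sum of terms \<open>a * m\<close> where \<open>m\<close> is a monomial of degree
  \<open>e\<close> in the coordinates centred at \<open>y\<close> and \<open>a \<in> I (w - e)\<close>.
\<close>

inductive weighted :: "(nat \<Rightarrow> 'a::comm_ring_1 set) \<Rightarrow> 'a ^ 'n \<Rightarrow> nat \<Rightarrow> ('a ^ 'n \<Rightarrow> 'a) \<Rightarrow> bool"
  for I and y where
  const: "a \<in> I w \<Longrightarrow> weighted I y w (\<lambda>x. a)"
| coord: "weighted I y 1 (\<lambda>x. x $ i - y $ i)"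
| add: "weighted I y w f \<Longrightarrow> weighted I y w g \<Longrightarrow> weighted I y w (\<lambda>x. f x + g x)"
| mult: "weighted I y i f \<Longrightarrow> weighted I y j g \<Longrightarrow> weighted I y (i + j) (\<lambda>x. f x * g x)"
| mono: "weighted I y i f \<Longrightarrow> j \<le> i \<Longrightarrow> weighted I y j f"

section \<open>Taylor expansion and differences with weights\<close>

context filtered_ring
begin

lemma weighted_eval: "weighted I y w f \<Longrightarrow> f y \<in> I w"
proof (induction rule: weighted.induct)
  case (mono i f j)
  then show ?case using fil_antimono by blast
qed (auto intro: fil_add fil_mult fil_zero)

lemma weighted_sum: "(\<And>a. a \<in> A \<Longrightarrow> weighted I y w (f a)) \<Longrightarrow> weighted I y w (\<lambda>x. \<Sum>a\<in>A. f a x)"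
proof (induction A rule: infinite_finite_induct)
  case (insert a A)
  then show ?case using weighted.add[of I y w "f a" "\<lambda>x. \<Sum>a\<in>A. f a x"] by simp
qed (auto intro: weighted.const fil_zero)

lemma weighted_coord0: "y $ i \<in> R \<Longrightarrow> weighted I y 0 (\<lambda>x. x $ i)"
  using weighted.add[OF weighted.mono[OF weighted.coord[of I y i], of 0] weighted.const[of "y $ i" I 0]]
  by (simp add: fil_0)

lemma weighted_cmult: "a \<in> I i \<Longrightarrow> weighted I y j g \<Longrightarrow> weighted I y (i + j) (\<lambda>x. a * g x)"
  by (rule weighted.mult[OF weighted.const])

lemma weighted_scale: "a \<in> R \<Longrightarrow> weighted I y j g \<Longrightarrow> weighted I y j (\<lambda>x. a * g x)"
  using weighted_cmult[of a 0 y j g] by (simp add: fil_0)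

lemma weighted_compose:
  assumes "weighted I y' w g" "\<And>v. weighted I y 1 (\<lambda>x. h x $ v - y' $ v)"
  shows "weighted I y w (\<lambda>x. g (h x))"
  using assms(1)
proof (induction rule: weighted.induct)
  case (coord i)
  then show ?case by (rule assms(2))
qed (auto intro: weighted.intros)

lemma weighted_meval:
  assumes "mcoeffs_in R p" "\<And>v. weighted I y 0 (\<lambda>x. h x $ v)"
  shows "weighted I y 0 (\<lambda>x. meval (h x) p)"
  using assms(1) zero_mem
proof (induction p rule: mpoly_induct_in)
  case (mult p q)
  then show ?case using weighted.mult[of I y 0 "\<lambda>x. meval (h x) p" 0] by simp
qed (auto intro: weighted.const weighted.add assms(2) simp: fil_0)

lemma weighted_linear:
  "(\<And>v. L v \<in> R) \<Longrightarrow> weighted I y 1 (\<lambda>x. \<Sum>v\<in>UNIV. L v * (x $ v - y $ v))"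
  by (intro weighted_sum weighted_scale weighted.coord)

text \<open>Only products have content: the remainder of p q is made of the remainders of the
  factors and the product of their linear parts, which has weight 1 + 1.\<close>

lemma weighted_taylor:
  fixes y :: "'a ^ 'n"
  assumes p: "mcoeffs_in R p" and y: "\<And>i. y $ i \<in> R"
  shows "weighted I y 2 (\<lambda>x. meval x p - meval y p - (\<Sum>v\<in>UNIV. meval y (mpderiv v p) * (x $ v - y $ v)))"
proof -
  define L where "L p x = (\<Sum>v\<in>UNIV. meval y (mpderiv v p) * (x $ v - y $ v))" for p and x :: "'a ^ 'n"
  have "mcoeffs_in R p \<and> weighted I y 2 (\<lambda>x. meval x p - meval y p - L p x)"
    using p zero_mem
  proof (induction p rule: mpoly_induct_in)
    case (const c)
    have "mcoeffs_in R (mconst c)" unfolding mconst_def using const by (rule mcoeffs_in_single)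
    then show ?case by (auto simp: L_def intro: weighted.const fil_zero)
  next
    case (var i)
    have "mcoeffs_in R (mvar i)" unfolding mvar_def by (rule mcoeffs_in_single[OF one_mem])
    moreover have "L (mvar i) x = x $ i - y $ i" for x
      by (simp add: L_def if_distrib[of "meval y"] if_distrib[of "\<lambda>a. a * _"] cong: if_cong)
    ultimately show ?case by (auto intro: weighted.const fil_zero)
  next
    case (add p q)
    have "L (p + q) x = L p x + L q x" for x by (simp add: L_def distrib_right sum.distrib)
    then have "(\<lambda>x. meval x (p + q) - meval y (p + q) - L (p + q) x) =
      (\<lambda>x. (meval x p - meval y p - L p x) + (meval x q - meval y q - L q x))"
      by (simp add: fun_eq_iff)
    moreover have "weighted I y 2 (\<lambda>x. (meval x p - meval y p - L p x) + (meval x q - meval y q - L q x))"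
      using add by (intro weighted.add) simp_all
    ultimately show ?case using add by (simp add: mcoeffs_in_add)
  next
    case (mult p q)
    have L: "weighted I y 1 (L r)" "weighted I y 0 (L r)" if "mcoeffs_in R r" for r
    proof -
      show *: "weighted I y 1 (L r)"
        unfolding L_def using that by (intro weighted_linear meval_mem mcoeffs_in_mpderiv y)
      show "weighted I y 0 (L r)" by (rule weighted.mono[OF *]) simp
    qed
    have w0: "weighted I y 0 (\<lambda>x. meval x q)" "weighted I y 0 (\<lambda>x. meval y p + L p x)"
      using mult y by (auto intro!: weighted_meval weighted_coord0 weighted.add weighted.const L meval_mem simp: fil_0)
    have "L (p * q) x = L p x * meval y q + meval y p * L q x" for x
      unfolding L_def sum_distrib_left sum_distrib_right sum.distrib[symmetric]
      by (intro sum.cong refl) (simp add: algebra_simps)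
    then have "(\<lambda>x. meval x (p * q) - meval y (p * q) - L (p * q) x) =
      (\<lambda>x. ((meval x p - meval y p - L p x) * meval x q + (meval y p + L p x) * (meval x q - meval y q - L q x))
        + L p x * L q x)"
      by (simp add: fun_eq_iff algebra_simps)
    moreover have "weighted I y 2 (\<lambda>x. ((meval x p - meval y p - L p x) * meval x q + (meval y p + L p x) * (meval x q - meval y q - L q x))
        + L p x * L q x)"
      using weighted.mult[of I y 2 "\<lambda>x. meval x p - meval y p - L p x" 0] weighted.mult[of I y 0 _ 2]
        weighted.mult[OF L(1)[of p] L(1)[of q]] mult w0
      by (intro weighted.add) (auto simp: numeral_2_eq_2)
    moreover have "mcoeffs_in R (p * q)" using mult by (intro mcoeffs_in_mult) simp_all
    ultimately show ?case by (simp only: simp_thms)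
  qed
  then show ?thesis by (simp add: L_def)
qed

text \<open>A map that is the identity up to weight 2 moves coordinates, of weight 1, by functions
  of weight 2, and a Leibniz rule passes this gain of one on to products. Consequently the i-th
  forward difference has order i at \<open>y\<close>, as a convergent Newton series
  requires.\<close>

lemma weighted_difference:
  assumes "weighted I y w g" "\<And>v. weighted I y 2 (\<lambda>x. \<psi> x $ v - x $ v)"
  shows "weighted I y (w + 1) (\<lambda>x. g (\<psi> x) - g x)"
  using assms(1)
proof (induction rule: weighted.induct)
  case (const a w)
  then show ?case by (auto intro: weighted.const fil_zero)
next
  case (coord i)
  then show ?case using assms(2)[of i] by (simp add: numeral_2_eq_2)
next
  case (add w f g)
  have "(\<lambda>x. f (\<psi> x) + g (\<psi> x) - (f x + g x)) = (\<lambda>x. (f (\<psi> x) - f x) + (g (\<psi> x) - g x))"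
    by (simp add: fun_eq_iff)
  then show ?case using weighted.add[OF add.IH] by simp
next
  case (mult i f j g)
  have "weighted I y j (\<lambda>x. g x + (g (\<psi> x) - g x))"
    by (rule weighted.add[OF mult.hyps(2) weighted.mono[OF mult.IH(2)]]) simp
  then have g: "weighted I y j (\<lambda>x. g (\<psi> x))" by simp
  have "weighted I y (i + j + 1) (\<lambda>x. (f (\<psi> x) - f x) * g (\<psi> x) + f x * (g (\<psi> x) - g x))"
    using weighted.mult[OF mult.IH(1) g] weighted.mult[OF mult.hyps(1) mult.IH(2)]
    by (intro weighted.add) simp_all
  moreover have "(\<lambda>x. f (\<psi> x) * g (\<psi> x) - f x * g x) =
      (\<lambda>x. (f (\<psi> x) - f x) * g (\<psi> x) + f x * (g (\<psi> x) - g x))"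
    by (simp add: fun_eq_iff algebra_simps)
  ultimately show ?case by simp
next
  case (mono i f j)
  then show ?case by (intro weighted.mono[OF mono.IH]) simp
qed

end

definition fwd_diff :: "('b \<Rightarrow> 'b) \<Rightarrow> ('b \<Rightarrow> 'a::ab_group_add) \<Rightarrow> 'b \<Rightarrow> 'a"
  where "fwd_diff \<psi> g = (\<lambda>x. g (\<psi> x) - g x)"

lemma newton_interpolation:
  fixes g :: "'b \<Rightarrow> 'a::comm_ring_1"
  shows "g ((\<psi> ^^ n) y) = (\<Sum>i\<le>n. of_nat (n choose i) * (fwd_diff \<psi> ^^ i) g y)"
proof (induction n arbitrary: g)
  case (Suc n)
  define a where "a i = (fwd_diff \<psi> ^^ i) g y" for i
  have "g ((\<psi> ^^ Suc n) y) = g ((\<psi> ^^ n) y) + fwd_diff \<psi> g ((\<psi> ^^ n) y)"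
    by (simp add: fwd_diff_def)
  also have "\<dots> = (\<Sum>i\<le>n. of_nat (n choose i) * a i) + (\<Sum>i\<le>n. of_nat (n choose i) * a (Suc i))"
    unfolding Suc.IH[of g] Suc.IH[of "fwd_diff \<psi> g"] by (simp add: a_def funpow_swap1)
  also have "(\<Sum>i\<le>n. of_nat (n choose i) * a i) = (\<Sum>i\<le>Suc n. of_nat (n choose i) * a i)"
    by (simp add: binomial_eq_0)
  also have "\<dots> = a 0 + (\<Sum>i\<le>n. of_nat (n choose Suc i) * a (Suc i))"
    by (subst sum.atMost_Suc_shift) simp
  also have "\<dots> + (\<Sum>i\<le>n. of_nat (n choose i) * a (Suc i)) =
      a 0 + (\<Sum>i\<le>n. of_nat (Suc n choose Suc i) * a (Suc i))"
    by (simp add: algebra_simps sum.distrib)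
  also have "\<dots> = (\<Sum>i\<le>Suc n. of_nat (Suc n choose i) * a i)"
    by (subst sum.atMost_Suc_shift) simp
  finally show ?case by (simp add: a_def)
qed simp

context padic_ring
begin

lemma near_identity_zeros:
  fixes y :: "'a ^ 'n"
  assumes \<psi>: "\<And>v. weighted I y 2 (\<lambda>x. \<psi> x $ v - x $ v)"
    and g: "weighted I y 0 g"
    and haus: "\<And>x. (\<And>c. x \<in> I c) \<Longrightarrow> x = 0"
    and inf: "infinite {n. g ((\<psi> ^^ n) y) = 0}"
  shows "g ((\<psi> ^^ n) y) = 0"
proof -
  have w: "weighted I y i ((fwd_diff \<psi> ^^ i) g)" for i
  proof (induction i)
    case (Suc i)
    then show ?case using weighted_difference[OF Suc \<psi>] by (simp add: fwd_diff_def)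
  qed (simp add: g)
  show ?thesis
    by (rule newton_series_zero[where a = "\<lambda>n. g ((\<psi> ^^ n) y)" and b = "\<lambda>i. (fwd_diff \<psi> ^^ i) g y"])
      (use newton_interpolation weighted_eval[OF w] inf haus in auto)
qed

text \<open>
  By the pigeonhole principle some iterate \<open>\<psi>\<close> of \<open>\<Phi>\<close> returns to its starting
  point modulo \<open>I 2\<close> and has the identity as its differential modulo \<open>I 1\<close>.
\<close>

lemma etale_orbit_zeros:
  fixes \<Phi> :: "('n::finite, 'a, 'n) pmap" and x :: "nat \<Rightarrow> 'a ^ 'n"
  assumes \<Phi>: "\<And>i. mcoeffs_in R (\<Phi> $ i)"
    and x_mem: "\<And>i. x 0 $ i \<in> R"
    and x_Suc: "\<And>n. x (Suc n) = pmap_eval \<Phi> (x n)"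
    and inj: "\<And>n a. (\<And>i. a i \<in> R) \<Longrightarrow> (\<And>v. (\<Sum>i\<in>UNIV. a i * meval (x n) (mpderiv v (\<Phi> $ i))) \<in> I 1)
      \<Longrightarrow> (\<And>i. a i \<in> I 1)"
    and haus: "\<And>x. (\<And>c. x \<in> I c) \<Longrightarrow> x = 0"
    and g: "mcoeffs_in R g"
  shows "eventually_periodic {n. meval (x n) g = 0}"
proof -
  have xR: "x n $ i \<in> R" for n i
    by (induction n arbitrary: i) (auto simp: x_Suc x_mem intro: meval_mem \<Phi>)
  have x_add: "x (n + m) = (pmap_eval \<Phi> ^^ m) (x n)" for n m
    by (induction m) (auto simp: x_Suc)
  define A where "A n = (\<chi> i v. meval (x n) (mpderiv v (\<Phi> $ i)))" for n
  have AR: "A n $ i $ v \<in> R" for n i v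
    unfolding A_def by (simp add: meval_mem mcoeffs_in_mpderiv \<Phi> xR)
  \<comment> \<open>By the chain rule \<open>Q n m\<close> is the differential of the m-th iterate
    at \<open>x n\<close>; \<open>jet\<close> confirms this as a first-order expansion.\<close>
  define Q where "Q n = rec_nat (mat 1) (\<lambda>m B. A (n + m) ** B)" for n
  have Q_simps: "Q n 0 = mat 1" "Q n (Suc m) = A (n + m) ** Q n m" for n m
    by (simp_all add: Q_def)
  have QR: "Q n m $ i $ v \<in> R" for n m i v
  proof (induction m arbitrary: i v)
    case 0
    show ?case by (simp add: Q_simps mat_def one_mem zero_mem)
  next
    case (Suc m)
    have "Q n (Suc m) $ i $ v = (\<Sum>u\<in>UNIV. A (n + m) $ i $ u * Q n m $ u $ v)"
      by (simp add: Q_simps matrix_matrix_mult_def)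
    also have "\<dots> \<in> R" by (intro sum_mem mult_mem AR Suc)
    finally show ?case .
  qed
  have Q_add: "Q 0 (n + m) = Q n m ** Q 0 n" for n m
    by (induction m) (simp_all add: Q_simps matrix_mul_assoc)
  define d where "d n z v = z $ v - x n $ v" for n v and z :: "'a ^ 'n"
  have jet: "weighted I (x n) 2 (\<lambda>z. (pmap_eval \<Phi> ^^ m) z $ i - x (n + m) $ i - (\<Sum>v\<in>UNIV. Q n m $ i $ v * d n z v))"
    for n m i
  proof (induction m arbitrary: i)
    case 0
    have "(\<Sum>v\<in>UNIV. Q n 0 $ i $ v * d n z v) = d n z i" for z
      by (simp add: Q_simps mat_def if_distrib[of "\<lambda>a. a * _"] cong: if_cong)
    then show ?case by (auto simp: d_def intro: weighted.const fil_zero)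
  next
    case (Suc m)
    define h where "h = pmap_eval \<Phi> ^^ m"
    define y' where "y' = x (n + m)"
    define e where "e u z = h z $ u - y' $ u - (\<Sum>v\<in>UNIV. Q n m $ u $ v * d n z v)" for u z
    have e: "weighted I (x n) 2 (e u)" for u
      using Suc[of u] unfolding e_def h_def y'_def .
    have "weighted I (x n) 1 (\<lambda>z. e u z + (\<Sum>v\<in>UNIV. Q n m $ u $ v * (z $ v - x n $ v)))" for u
      by (intro weighted.add weighted_linear QR weighted.mono[OF e]) simp
    then have h: "weighted I (x n) 1 (\<lambda>z. h z $ u - y' $ u)" for u
      by (simp add: e_def d_def)
    define T where "T z = meval z (\<Phi> $ i) - meval y' (\<Phi> $ i) - (\<Sum>v\<in>UNIV. meval y' (mpderiv v (\<Phi> $ i)) * (z $ v - y' $ v))" for z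
    have T: "weighted I (x n) 2 (\<lambda>z. T (h z))"
      unfolding T_def
      by (rule weighted_compose[OF weighted_taylor h]) (auto simp: \<Phi> y'_def xR)
    have "weighted I (x n) 2 (\<lambda>z. T (h z) + (\<Sum>u\<in>UNIV. A (n + m) $ i $ u * e u z))"
      by (intro weighted.add T weighted_sum weighted_scale AR e)
    moreover have "T (h z) + (\<Sum>u\<in>UNIV. A (n + m) $ i $ u * e u z) =
        (pmap_eval \<Phi> ^^ Suc m) z $ i - x (n + Suc m) $ i - (\<Sum>v\<in>UNIV. Q n (Suc m) $ i $ v * d n z v)" for z
    proof -
      have "(\<Sum>v\<in>UNIV. Q n (Suc m) $ i $ v * d n z v) =
          (\<Sum>v\<in>UNIV. \<Sum>u\<in>UNIV. A (n + m) $ i $ u * (Q n m $ u $ v * d n z v))"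
        by (simp add: Q_simps matrix_matrix_mult_def sum_distrib_right mult.assoc)
      also have "\<dots> = (\<Sum>u\<in>UNIV. A (n + m) $ i $ u * (\<Sum>v\<in>UNIV. Q n m $ u $ v * d n z v))"
        by (subst sum.swap) (simp add: sum_distrib_left)
      finally show ?thesis
        by (simp add: T_def e_def h_def A_def y'_def x_Suc right_diff_distrib sum_subtractf)
    qed
    ultimately show ?case by simp
  qed
  have near: "weighted I (x n) 1 (\<lambda>z. (pmap_eval \<Phi> ^^ m) z $ i - x (n + m) $ i)" for n m i
  proof -
    have "weighted I (x n) 1 (\<lambda>z. ((pmap_eval \<Phi> ^^ m) z $ i - x (n + m) $ i - (\<Sum>v\<in>UNIV. Q n m $ i $ v * d n z v))
        + (\<Sum>v\<in>UNIV. Q n m $ i $ v * (z $ v - x n $ v)))"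
      by (intro weighted.add weighted_linear QR weighted.mono[OF jet]) simp
    then show ?thesis by (simp add: d_def)
  qed
  have left_inj: "a i \<in> I 1" if "\<And>i. a i \<in> R" "\<And>v. (\<Sum>u\<in>UNIV. a u * Q 0 n $ u $ v) \<in> I 1" for n a i
    using that
  proof (induction n arbitrary: a i)
    case 0
    from 0(2)[of i] show ?case
      by (simp add: Q_simps mat_def if_distrib[of "\<lambda>b. _ * b"] cong: if_cong)
  next
    case (Suc n)
    define b where "b w = (\<Sum>u\<in>UNIV. a u * A n $ u $ w)" for w
    have "b w \<in> I 1" for w
    proof (rule Suc.IH)
      show "b w \<in> R" for w unfolding b_def using Suc.prems(1) AR by (intro sum_mem mult_mem)
      show "(\<Sum>w\<in>UNIV. b w * Q 0 n $ w $ v) \<in> I 1" for v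
      proof -
        have "(\<Sum>w\<in>UNIV. b w * Q 0 n $ w $ v) = (\<Sum>w\<in>UNIV. \<Sum>u\<in>UNIV. a u * (A n $ u $ w * Q 0 n $ w $ v))"
          by (simp add: b_def sum_distrib_right mult.assoc)
        also have "\<dots> = (\<Sum>u\<in>UNIV. a u * Q 0 (Suc n) $ u $ v)"
          by (subst sum.swap) (simp add: Q_simps matrix_matrix_mult_def sum_distrib_left)
        finally show ?thesis using Suc.prems(2) by simp
      qed
    qed
    then show ?case using inj[of a n i] Suc.prems(1) by (simp add: b_def A_def)
  qed
  obtain F1 where F1: "finite F1" "\<And>a. a \<in> R \<Longrightarrow> \<exists>b\<in>F1. a - b \<in> I 1" using finite_quot[of 1] by blast
  obtain F2 where F2: "finite F2" "\<And>a. a \<in> R \<Longrightarrow> \<exists>b\<in>F2. a - b \<in> I 2" using finite_quot[of 2] by blast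
  obtain r1 where r1: "\<And>a. a \<in> R \<Longrightarrow> r1 a \<in> F1 \<and> a - r1 a \<in> I 1" using F1(2) by metis
  obtain r2 where r2: "\<And>a. a \<in> R \<Longrightarrow> r2 a \<in> F2 \<and> a - r2 a \<in> I 2" using F2(2) by metis
  \<comment> \<open>Pigeonhole data: the point modulo \<open>I 2\<close> together with the
    differential from time 0 modulo \<open>I 1\<close>.\<close>
  define c :: "nat \<Rightarrow> 'n + 'n \<times> 'n \<Rightarrow> 'a"
    where "c n = case_sum (\<lambda>i. r2 (x n $ i)) (\<lambda>(i, v). r1 (Q 0 n $ i $ v))" for n
  have "c n \<in> PiE UNIV (\<lambda>_. F1 \<union> F2)" for n
    using r1[OF QR] r2[OF xR] by (auto simp: c_def split: sum.splits)
  then have "range c \<subseteq> PiE UNIV (\<lambda>_. F1 \<union> F2)" by blast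
  moreover have "finite (PiE (UNIV :: ('n + 'n \<times> 'n) set) (\<lambda>_. F1 \<union> F2))"
    using F1 F2 by (intro finite_PiE) auto
  ultimately have "finite (range c)" by (rule finite_subset)
  then have "\<not> inj c" using range_inj_infinite by blast
  then obtain m n where "m \<noteq> n" "c m = c n" by (auto simp: inj_def)
  then obtain n0 k where k: "k > 0" "c n0 = c (n0 + k)"
    by (metis linorder_neqE_nat less_imp_add_positive)
  have x_near: "x (n0 + k) $ i - x n0 $ i \<in> I 2" for i
  proof -
    have "r2 (x n0 $ i) = r2 (x (n0 + k) $ i)" using fun_cong[OF k(2), of "Inl i"] by (simp add: c_def)
    then show ?thesis
      using fil_diff[OF conjunct2[OF r2[OF xR[of "n0 + k" i]]] conjunct2[OF r2[OF xR[of n0 i]]]] by simp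
  qed
  have Q_near: "Q 0 (n0 + k) $ i $ v - Q 0 n0 $ i $ v \<in> I 1" for i v
  proof -
    have "r1 (Q 0 n0 $ i $ v) = r1 (Q 0 (n0 + k) $ i $ v)"
      using fun_cong[OF k(2), of "Inr (i, v)"] by (simp add: c_def)
    then show ?thesis
      using fil_diff[OF conjunct2[OF r1[OF QR[of 0 "n0 + k" i v]]] conjunct2[OF r1[OF QR[of 0 n0 i v]]]] by simp
  qed
  define \<delta> where "\<delta> i v = Q n0 k $ i $ v - (if i = v then 1 else 0)" for i v
  have \<delta>_R: "\<delta> i v \<in> R" for i v unfolding \<delta>_def using QR by (auto intro: diff_mem one_mem zero_mem)
  \<comment> \<open>Coinciding differentials at times n0 and n0 + k say that (\<open>Q n0 k\<close>
    - 1) \<open>Q 0 n0\<close> vanishes modulo \<open>I 1\<close>; injectivity on row vectors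
    removes the right factor.\<close>
  have \<delta>: "\<delta> i v \<in> I 1" for i v
  proof (rule left_inj[OF \<delta>_R])
    fix w
    have "(\<Sum>u\<in>UNIV. \<delta> i u * Q 0 n0 $ u $ w) = Q 0 (n0 + k) $ i $ w - Q 0 n0 $ i $ w"
      by (simp add: \<delta>_def Q_add matrix_matrix_mult_def left_diff_distrib sum_subtractf
          if_distrib[of "\<lambda>b. b * _"] cong: if_cong)
    then show "(\<Sum>u\<in>UNIV. \<delta> i u * Q 0 n0 $ u $ w) \<in> I 1" using Q_near by simp
  qed
  define y where "y = x n0"
  define \<psi> where "\<psi> = pmap_eval \<Phi> ^^ k"
  have \<psi>: "weighted I y 2 (\<lambda>z. \<psi> z $ i - z $ i)" for i
  proof -
    \<comment> \<open>Three contributions of weight 2: the Taylor remainder, a displacement in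
      \<open>I 2\<close>, and \<delta> of order 1 times a coordinate of weight 1.\<close>
    have "weighted I y 2 (\<lambda>z. (\<psi> z $ i - x (n0 + k) $ i - (\<Sum>v\<in>UNIV. Q n0 k $ i $ v * d n0 z v))
        + (x (n0 + k) $ i - y $ i) + (\<Sum>v\<in>UNIV. \<delta> i v * (z $ v - y $ v)))"
      unfolding y_def \<psi>_def
      by (intro weighted.add jet weighted.const x_near weighted_sum
          weighted_cmult[OF \<delta> weighted.coord, unfolded one_add_one])
    moreover have "(\<psi> z $ i - x (n0 + k) $ i - (\<Sum>v\<in>UNIV. Q n0 k $ i $ v * d n0 z v))
        + (x (n0 + k) $ i - y $ i) + (\<Sum>v\<in>UNIV. \<delta> i v * (z $ v - y $ v)) = \<psi> z $ i - z $ i" for z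
    proof -
      have "(\<Sum>v\<in>UNIV. \<delta> i v * (z $ v - y $ v)) = (\<Sum>v\<in>UNIV. Q n0 k $ i $ v * d n0 z v) - (z $ i - y $ i)"
        by (simp add: \<delta>_def d_def y_def left_diff_distrib sum_subtractf if_distrib[of "\<lambda>b. b * _"] cong: if_cong)
      then show ?thesis by simp
    qed
    ultimately show ?thesis by (simp only:)
  qed
  \<comment> \<open>One function for each residue j modulo \<open>k\<close>: along its class of
    times it vanishes identically or only finitely often.\<close>
  define G where "G j z = meval ((pmap_eval \<Phi> ^^ j) z) g" for j z
  have G: "weighted I y 0 (G j)" for j
    unfolding G_def
  proof (rule weighted_meval[OF g])
    fix v
    have "weighted I y 0 (\<lambda>z. ((pmap_eval \<Phi> ^^ j) z $ v - x (n0 + j) $ v) + x (n0 + j) $ v)"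
      unfolding y_def by (intro weighted.add weighted.mono[OF near] weighted.const) (auto simp: fil_0 xR)
    then show "weighted I y 0 (\<lambda>z. (pmap_eval \<Phi> ^^ j) z $ v)" by simp
  qed
  have G_orbit: "G j ((\<psi> ^^ t) y) = meval (x (n0 + j + k * t)) g" for j t
  proof -
    have "(\<psi> ^^ t) y = x (n0 + k * t)" by (simp add: \<psi>_def y_def x_add funpow_mult mult.commute)
    then have "(pmap_eval \<Phi> ^^ j) ((\<psi> ^^ t) y) = x (n0 + k * t + j)" by (simp add: x_add[of "n0 + k * t"])
    then show ?thesis by (simp add: G_def add_ac)
  qed
  have "\<exists>T. \<forall>t\<ge>T. meval (x (n0 + j + k * t)) g = 0 \<longleftrightarrow> meval (x (n0 + j + k * Suc t)) g = 0" for j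
  proof (cases "infinite {t. G j ((\<psi> ^^ t) y) = 0}")
    case True
    have "G j ((\<psi> ^^ t) y) = 0" for t
      using near_identity_zeros[OF \<psi> G _ True] haus by blast
    then show ?thesis unfolding G_orbit by (simp del: mult_Suc_right)
  next
    case False
    then obtain T where "\<And>t. G j ((\<psi> ^^ t) y) = 0 \<Longrightarrow> t < T"
      by (auto simp: finite_nat_iff_bounded subset_eq)
    then have "\<forall>t\<ge>T. meval (x (n0 + j + k * t)) g \<noteq> 0" unfolding G_orbit by (meson not_less)
    then show ?thesis by (meson le_SucI)
  qed
  then obtain T where T: "\<And>j t. t \<ge> T j \<Longrightarrow> meval (x (n0 + j + k * t)) g = 0 \<longleftrightarrow> meval (x (n0 + j + k * Suc t)) g = 0"
    by metis
  define N where "N = n0 + k * Suc (\<Sum>j<k. T j)"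
  show ?thesis
  proof (rule eventually_periodicI[OF k(1), of N])
    fix n assume n: "n \<ge> N"
    define j where "j = (n - n0) mod k"
    define t where "t = (n - n0) div k"
    have n_eq: "n = n0 + j + k * t" using n by (simp add: j_def t_def N_def)
    have "Suc (\<Sum>j<k. T j) \<le> t"
      using n k(1) by (simp add: t_def N_def less_eq_div_iff_mult_less_eq mult.commute le_diff_conv2)
    moreover have "T j \<le> (\<Sum>j<k. T j)" using k(1) by (intro member_le_sum) (auto simp: j_def)
    ultimately have "T j \<le> t" by simp
    from T[OF this] show "n \<in> {n. meval (x n) g = 0} \<longleftrightarrow> n + k \<in> {n. meval (x n) g = 0}"
      by (simp add: n_eq algebra_simps)
  qed
qed

end

section \<open>Skew products\<close>

definition fiber :: "'k ^ ('m::finite + 'r::finite) \<Rightarrow> 'k ^ 'r"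
  where "fiber x = (\<chi> j. x $ Inr j)"

definition join :: "'k ^ 'm \<Rightarrow> 'k ^ 'r \<Rightarrow> 'k ^ ('m::finite + 'r::finite)"
  where "join u z = (\<chi> c. case c of Inl i \<Rightarrow> u $ i | Inr j \<Rightarrow> z $ j)"

lemma fiber_nth [simp]: "fiber x $ j = x $ Inr j"
  by (simp add: fiber_def)

lemma join_nth [simp]: "join u z $ Inl i = u $ i" "join u z $ Inr j = z $ j"
  by (simp_all add: join_def)

lemma base_join [simp]: "base (join u z) = u" and fiber_join [simp]: "fiber (join u z) = z"
  by (simp_all add: vec_eq_iff)

lemma join_base_fiber [simp]: "join (base x) (fiber x) = x"
proof -
  have "join (base x) (fiber x) $ c = x $ c" for c by (cases c) simp_all
  then show ?thesis by (simp add: vec_eq_iff)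
qed

lemma sum_UNIV_Plus: "(\<Sum>c\<in>UNIV. f c) = (\<Sum>i\<in>UNIV. f (Inl i)) + (\<Sum>j\<in>UNIV. f (Inr j))"
  for f :: "'m::finite + 'r::finite \<Rightarrow> 'a::comm_monoid_add"
  unfolding UNIV_Plus_UNIV[symmetric] by (subst sum.Plus) simp_all

lemma prod_UNIV_Plus: "(\<Prod>c\<in>UNIV. f c) = (\<Prod>i\<in>UNIV. f (Inl i)) * (\<Prod>j\<in>UNIV. f (Inr j))"
  for f :: "'m::finite + 'r::finite \<Rightarrow> 'a::comm_monoid_mult"
  unfolding UNIV_Plus_UNIV[symmetric] by (subst prod.Plus) simp_all

lemma skew_product_nth:
  "skew_product T \<rho> M $ Inl i = pull_base (T $ i)"
  "skew_product T \<rho> M $ Inr j = \<rho> * (\<Sum>l\<in>UNIV. pull_base (M $ j $ l) * mvar (Inr l))"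
  by (simp_all add: skew_product_def fiber_part_def matrix_vector_mult_def map_matrix_def fiber_coords_def)

lemma fiber_part_nth: "fiber_part \<rho> M $ j = skew_product T \<rho> M $ Inr j"
  by (simp add: skew_product_def)

lemma base_skew_product: "base (pmap_eval (skew_product T \<rho> M) x) = pmap_eval T (base x)"
  for T :: "('m::finite, 'k::comm_semiring_1, 'm) pmap"
  by (simp add: vec_eq_iff skew_product_nth)

lemma fiber_skew_product:
  "fiber (pmap_eval (skew_product T \<rho> M) x) = meval x \<rho> *s (map_matrix (meval (base x)) M *v fiber x)"
  for T :: "('m::finite, 'k::comm_semiring_1, 'm) pmap"
  by (simp add: vec_eq_iff skew_product_nth matrix_vector_mult_def map_matrix_def)

lemma mpderiv_skew_product:
  fixes T :: "('m::finite, 'k::comm_semiring_1, 'm) pmap" and M :: "('m, 'k) mpoly ^ 'r::finite ^ 'r"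
  shows "mpderiv (Inl a) (skew_product T \<rho> M $ Inl i) = pull_base (mpderiv a (T $ i))"
    and "mpderiv (Inr l) (skew_product T \<rho> M $ Inl i) = 0"
    and "mpderiv (Inr l) (skew_product T \<rho> M $ Inr j) =
      mpderiv (Inr l) \<rho> * (\<Sum>l\<in>UNIV. pull_base (M $ j $ l) * mvar (Inr l)) + \<rho> * pull_base (M $ j $ l)"
  by (simp_all add: skew_product_nth if_distrib[of "\<lambda>b. _ * b"] cong: if_cong)

text \<open>
  On the line \<open>s \<mapsto> (u, s z)\<close> the map acts as \<open>s \<mapsto> s * \<rho>(u, s z)\<close>; this is the derivative at \<open>s = 1\<close>.
\<close>

definition radial_derivative :: "('m + 'r, 'k) mpoly \<Rightarrow> ('m + 'r::finite, 'k::comm_semiring_1) mpoly"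
  where "radial_derivative \<rho> = \<rho> + (\<Sum>l\<in>UNIV. mvar (Inr l) * mpderiv (Inr l) \<rho>)"

lemma mpderiv_1 [simp]: "mpderiv v 1 = 0"
  using mpderiv_const[of v 1] by (simp only: mconst_1)

lemma radial_derivative_one: "radial_derivative 1 = 1"
  by (simp add: radial_derivative_def)

text \<open>The vertical Jacobian is \<rho> M plus the column M z times the gradient of \<rho>.
  Applied to \<open>z\<close> it therefore gives M z times the radial derivative, so at a zero of
  the latter a nonzero \<open>z\<close> lies in the kernel.\<close>

lemma radial_derivative_zero_critical:
  fixes M :: "('m::finite, 'k::field) mpoly ^ 'r::finite ^ 'r"
  assumes "meval x (radial_derivative \<rho>) = 0" "fiber x \<noteq> 0"
  shows "x \<in> vertical_critical_locus \<rho> M"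
proof -
  define Y where "Y = map_matrix (meval x) (vertical_jacobian (fiber_part \<rho> M))"
  define b where "b j = (\<Sum>l\<in>UNIV. meval (base x) (M $ j $ l) * x $ Inr l)" for j
  have "Y *v fiber x = 0"
  proof (subst vec_eq_iff, rule allI)
    fix j
    have "(Y *v fiber x) $ j = (\<Sum>l\<in>UNIV. (meval x (mpderiv (Inr l) \<rho>) * b j + meval x \<rho> * meval (base x) (M $ j $ l)) * x $ Inr l)"
      unfolding Y_def vertical_jacobian_def map_matrix_def matrix_vector_mult_def b_def
      by (simp add: fiber_part_nth[where T = undefined] mpderiv_skew_product)
    also have "\<dots> = b j * (\<Sum>l\<in>UNIV. x $ Inr l * meval x (mpderiv (Inr l) \<rho>)) +
        meval x \<rho> * (\<Sum>l\<in>UNIV. meval (base x) (M $ j $ l) * x $ Inr l)"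
      unfolding sum_distrib_left sum.distrib[symmetric] by (intro sum.cong refl) (simp add: algebra_simps)
    also have "\<dots> = b j * meval x (radial_derivative \<rho>)"
      unfolding b_def[symmetric] by (simp add: radial_derivative_def algebra_simps)
    finally show "(Y *v fiber x) $ j = 0 $ j" using assms(1) by simp
  qed
  then have "\<not> invertible Y"
    using assms(2) unfolding invertible_left_inverse matrix_left_invertible_ker by blast
  then have "det Y = 0" by (simp add: invertible_det_nz)
  then show ?thesis
    by (simp add: vertical_critical_locus_def zero_locus_def meval_det Y_def)
qed

definition pmap_coeffs_in :: "'k::zero set \<Rightarrow> ('v, 'k, 'w::finite) pmap \<Rightarrow> bool"
  where "pmap_coeffs_in R f \<longleftrightarrow> (\<forall>i. mcoeffs_in R (f $ i))"

definition mat_coeffs_in :: "'k::zero set \<Rightarrow> ('v, 'k) mpoly ^ 'c::finite ^ 'r::finite \<Rightarrow> bool"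
  where "mat_coeffs_in R M \<longleftrightarrow> (\<forall>i j. mcoeffs_in R (M $ i $ j))"

context subring_of
begin

lemma det_mem: "(\<And>i j. A $ i $ j \<in> R) \<Longrightarrow> det A \<in> R"
  unfolding det_def by (intro sum_mem mult_mem of_int_mem prod_mem)

lemma mcoeffs_in_mvar: "mcoeffs_in R (mvar v)"
  unfolding mvar_def by (rule mcoeffs_in_single[OF one_mem])

lemma mcoeffs_in_1: "mcoeffs_in R 1"
  using mcoeffs_in_single[OF one_mem, of 0] by simp

lemma mcoeffs_in_skew_product:
  fixes T :: "('m::finite, 'a, 'm) pmap" and M :: "('m, 'a) mpoly ^ 'r::finite ^ 'r"
  assumes "pmap_coeffs_in R T" "mcoeffs_in R \<rho>" "mat_coeffs_in R M"
  shows "mcoeffs_in R (skew_product T \<rho> M $ c)"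
proof (cases c)
  case (Inl i)
  then show ?thesis using assms by (simp add: skew_product_nth pmap_coeffs_in_def mcoeffs_in_pull_base)
next
  case (Inr j)
  then show ?thesis
    using assms unfolding mat_coeffs_in_def Inr skew_product_nth
    by (intro mcoeffs_in_mult mcoeffs_in_sum mcoeffs_in_pull_base mcoeffs_in_mvar) auto
qed

lemma mcoeffs_in_radial_derivative: "mcoeffs_in R \<rho> \<Longrightarrow> mcoeffs_in R (radial_derivative \<rho>)"
  unfolding radial_derivative_def
  by (intro mcoeffs_in_add mcoeffs_in_sum mcoeffs_in_mult mcoeffs_in_mvar mcoeffs_in_mpderiv)

lemma orbit_mem:
  fixes F :: "('n::finite, 'a, 'n) pmap"
  assumes "\<And>c. mcoeffs_in R (F $ c)" "\<And>c. x0 $ c \<in> R"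
  shows "(pmap_eval F ^^ n) x0 $ c \<in> R"
proof (induction n arbitrary: c)
  case (Suc n)
  have "(pmap_eval F ^^ Suc n) x0 $ c = meval ((pmap_eval F ^^ n) x0) (F $ c)" by simp
  also have "\<dots> \<in> R" by (rule meval_mem[OF assms(1) Suc])
  finally show ?case .
qed (simp add: assms(2))

end

context prime_frame
begin

lemma hausdorff: "(\<And>c. b \<in> J c) \<Longrightarrow> b = 0"
proof -
  assume b: "\<And>c. b \<in> J c"
  obtain C where C: "\<forall>S. \<forall>b\<in>R. \<nu> b \<le> 2 ^ S \<and> b \<in> J (C * (S + 1)) \<longrightarrow> b = 0" using P_liouville by blast
  have "\<nu> b \<le> 2 ^ \<nu> b" by (rule less_imp_le) (rule less_exp)
  then show "b = 0" using C b fil_mem by blast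
qed

text \<open>Cramer's rule solves A X = e_i over \<open>R\<close>, the determinant being a unit
  there, and pairing the row vector with A X isolates \<open>a i\<close>.\<close>

lemma left_null_vector:
  fixes A :: "'a ^ 'm::finite ^ 'm"
  assumes A: "\<And>i v. A $ i $ v \<in> R" and det: "det A \<noteq> 0" "1 / det A \<in> R"
    and a: "\<And>i. a i \<in> R" "\<And>v. (\<Sum>i\<in>UNIV. a i * A $ i $ v) \<in> J c"
  shows "a i \<in> J c"
proof -
  define X where "X = (\<chi> k. det (\<chi> i' j. if j = k then axis i 1 $ i' else A $ i' $ j) / det A)"
  have X: "A *v X = axis i 1" unfolding cramer[OF det(1)] X_def by (rule refl)
  have XR: "X $ v \<in> R" for v
  proof -
    have "det (\<chi> i' j. if j = v then axis i 1 $ i' else A $ i' $ j) \<in> R"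
      by (rule det_mem) (auto simp: axis_def A intro: one_mem zero_mem)
    then have "det (\<chi> i' j. if j = v then axis i 1 $ i' else A $ i' $ j) * (1 / det A) \<in> R"
      using det(2) by (rule mult_mem)
    then show ?thesis by (simp add: X_def)
  qed
  have "a i = (\<Sum>i'\<in>UNIV. a i' * (A *v X) $ i')"
    by (simp add: X axis_def if_distrib[of "\<lambda>b. _ * b"] cong: if_cong)
  also have "\<dots> = (\<Sum>i'\<in>UNIV. \<Sum>v\<in>UNIV. a i' * A $ i' $ v * X $ v)"
    by (simp add: matrix_vector_mult_def sum_distrib_left mult.assoc)
  also have "\<dots> = (\<Sum>v\<in>UNIV. (\<Sum>i'\<in>UNIV. a i' * A $ i' $ v) * X $ v)"
    by (subst sum.swap) (simp add: sum_distrib_right)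
  also have "\<dots> \<in> J c" by (rule fil_sum, rule fil_mult_right[OF XR a(2)])
  finally show ?thesis .
qed

text \<open>The differential is block triangular. Let a row vector be killed modulo
  \<open>J 1\<close>. Contracting its fiber equations with \<open>z\<close> leaves the radial
  derivative times a scalar \<open>s\<close>, so \<open>s\<close> lies in \<open>J 1\<close>; hence
  so do \<rho> \<open>b l\<close> and \<open>b l\<close>, next the fiber entries by means of
  \<open>N\<close>, and at last the base entries. The lemma serves F itself and, with \<rho>
  replaced by 1, the map that F shadows.\<close>

lemma skew_etale_orbit:
  fixes T :: "('m::finite, 'a, 'm) pmap" and M N :: "('m, 'a) mpoly ^ 'r::finite ^ 'r"
  assumes T: "pmap_coeffs_in R T" and \<rho>: "mcoeffs_in R \<rho>" and M: "mat_coeffs_in R M" and N: "mat_coeffs_in R N"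
    and MN: "M ** N = mat 1"
    and det: "\<And>u. det (map_matrix (meval u) (jacobian T)) = c" "c \<noteq> 0" "1 / c \<in> R"
    and x0: "\<And>c. x0 $ c \<in> R"
    and nonP: "\<And>n. meval ((pmap_eval (skew_product T \<rho> M) ^^ n) x0) \<rho> \<notin> P"
      "\<And>n. meval ((pmap_eval (skew_product T \<rho> M) ^^ n) x0) (radial_derivative \<rho>) \<notin> P"
    and g: "mcoeffs_in R g"
  shows "eventually_periodic {n. meval ((pmap_eval (skew_product T \<rho> M) ^^ n) x0) g = 0}"
proof (rule etale_orbit_zeros[where \<Phi> = "skew_product T \<rho> M"])
  let ?F = "skew_product T \<rho> M"
  let ?x = "\<lambda>n. (pmap_eval ?F ^^ n) x0"
  have F: "mcoeffs_in R (?F $ i)" for i by (rule mcoeffs_in_skew_product[OF T \<rho> M])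
  show "mcoeffs_in R (?F $ i)" for i by (rule F)
  show "?x 0 $ i \<in> R" for i by (simp add: x0)
  show "?x (Suc n) = pmap_eval ?F (?x n)" for n by simp
  show "b = 0" if "\<And>c. b \<in> J c" for b using that by (rule hausdorff)
  show "mcoeffs_in R g" by (rule g)
  fix n and a :: "'m + 'r \<Rightarrow> 'a"
  define x where "x = ?x n"
  have xR: "x $ i \<in> R" for i unfolding x_def by (rule orbit_mem[OF F x0])
  have evR: "meval x f \<in> R" if "mcoeffs_in R f" for f using that xR by (rule meval_mem)
  have bR: "meval (base x) f \<in> R" if "mcoeffs_in R f" for f using that by (rule meval_mem) (simp add: xR)
  have MR: "meval (base x) (M $ i $ j) \<in> R" "meval (base x) (N $ i $ j) \<in> R" for i j
    using M N by (auto simp: mat_coeffs_in_def intro: bR)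
  assume aR: "\<And>i. a i \<in> R"
    and null: "\<And>v. (\<Sum>i\<in>UNIV. a i * meval (?x n) (mpderiv v (?F $ i))) \<in> J 1"
  define b where "b l = (\<Sum>j\<in>UNIV. a (Inr j) * meval (base x) (M $ j $ l))" for l
  have bl: "b l \<in> R" for l unfolding b_def by (intro sum_mem mult_mem aR MR)
  define s where "s = (\<Sum>l\<in>UNIV. b l * x $ Inr l)"
  have sR: "s \<in> R" unfolding s_def by (intro sum_mem mult_mem bl xR)
  have dR: "meval x (mpderiv v \<rho>) \<in> R" for v by (intro evR mcoeffs_in_mpderiv \<rho>)
  have e: "meval x (mpderiv (Inr l) \<rho>) * s + meval x \<rho> * b l \<in> J 1" for l
  proof -
    have s: "s = (\<Sum>j\<in>UNIV. a (Inr j) * (\<Sum>l\<in>UNIV. meval (base x) (M $ j $ l) * x $ Inr l))"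
      unfolding s_def b_def sum_distrib_right sum_distrib_left by (subst sum.swap) (simp add: mult.assoc)
    have "(\<Sum>i\<in>UNIV. a i * meval x (mpderiv (Inr l) (?F $ i))) = meval x (mpderiv (Inr l) \<rho>) * s + meval x \<rho> * b l"
      unfolding sum_UNIV_Plus s b_def
      by (simp add: mpderiv_skew_product distrib_left sum.distrib sum_distrib_left mult_ac)
    then show ?thesis using null[of "Inr l"] by (simp add: x_def)
  qed
  have "(\<Sum>l\<in>UNIV. x $ Inr l * (meval x (mpderiv (Inr l) \<rho>) * s + meval x \<rho> * b l)) \<in> J 1"
    by (intro fil_sum fil_mult_left xR e)
  moreover have "(\<Sum>l\<in>UNIV. x $ Inr l * (meval x (mpderiv (Inr l) \<rho>) * s + meval x \<rho> * b l))
      = (\<Sum>l\<in>UNIV. x $ Inr l * meval x (mpderiv (Inr l) \<rho>)) * s + meval x \<rho> * s"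
    by (simp add: s_def[symmetric] distrib_left sum.distrib sum_distrib_right mult_ac)
      (simp add: s_def sum_distrib_left mult_ac)
  moreover have "\<dots> = meval x (radial_derivative \<rho>) * s"
    by (simp add: radial_derivative_def distrib_right)
  ultimately have "meval x (radial_derivative \<rho>) * s \<in> J 1" by simp
  then have s1: "s \<in> J 1"
    by (rule P_cancel[OF evR[OF mcoeffs_in_radial_derivative[OF \<rho>]] nonP(2)[of n, folded x_def] sR])
  have b1: "b l \<in> J 1" for l
  proof -
    have "(meval x (mpderiv (Inr l) \<rho>) * s + meval x \<rho> * b l) - meval x (mpderiv (Inr l) \<rho>) * s \<in> J 1"
      by (rule fil_diff[OF e fil_mult_left[OF dR s1]])
    then have "meval x \<rho> * b l \<in> J 1" by simp
    then show ?thesis by (rule P_cancel[OF evR[OF \<rho>] nonP(1)[of n, folded x_def] bl])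
  qed
  have MN': "(\<Sum>l\<in>UNIV. meval (base x) (M $ j $ l) * meval (base x) (N $ l $ i)) = (if j = i then 1 else 0)" for i j
  proof -
    have "(M ** N) $ j $ i = mat 1 $ j $ i" by (simp add: MN)
    from arg_cong[OF this, of "meval (base x)"] show ?thesis
      by (simp add: matrix_matrix_mult_def mat_def split: if_splits)
  qed
  have fib: "a (Inr i) \<in> J 1" for i
  proof -
    have "(\<Sum>l\<in>UNIV. b l * meval (base x) (N $ l $ i)) =
        (\<Sum>j\<in>UNIV. a (Inr j) * (\<Sum>l\<in>UNIV. meval (base x) (M $ j $ l) * meval (base x) (N $ l $ i)))"
      unfolding b_def sum_distrib_right sum_distrib_left by (subst sum.swap) (simp add: mult.assoc)
    also have "\<dots> = a (Inr i)"
      unfolding MN' by (simp add: if_distrib[of "\<lambda>b. _ * b"] cong: if_cong)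
    finally show ?thesis using fil_sum[of UNIV "\<lambda>l. b l * meval (base x) (N $ l $ i)" 1] fil_mult_right[OF MR(2) b1] by simp
  qed
  have "a (Inl i) \<in> J 1" for i
  proof (rule left_null_vector[where A = "map_matrix (meval (base x)) (jacobian T)" and a = "\<lambda>i. a (Inl i)"])
    show "map_matrix (meval (base x)) (jacobian T) $ i $ v \<in> R" for i v
      using T by (auto simp: map_matrix_def jacobian_def pmap_coeffs_in_def intro!: bR mcoeffs_in_mpderiv)
    show "det (map_matrix (meval (base x)) (jacobian T)) \<noteq> 0" "1 / det (map_matrix (meval (base x)) (jacobian T)) \<in> R"
      using det by simp_all
    show "a (Inl i) \<in> R" for i by (rule aR)
    fix v
    have "(\<Sum>j\<in>UNIV. a (Inr j) * meval x (mpderiv (Inl v) (?F $ Inr j))) \<in> J 1"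
      by (intro fil_sum fil_mult_right fib evR mcoeffs_in_mpderiv F)
    from fil_diff[OF null[of "Inl v", unfolded sum_UNIV_Plus, folded x_def] this]
    show "(\<Sum>i\<in>UNIV. a (Inl i) * map_matrix (meval (base x)) (jacobian T) $ i $ v) \<in> J 1"
      by (simp add: mpderiv_skew_product map_matrix_def jacobian_def)
  qed
  then show "a i \<in> J 1" for i using fib by (cases i) auto
qed

end

section \<open>Sizes along an orbit\<close>

context filtered_ring
begin

lemma fil_prod: "(\<And>a. a \<in> A \<Longrightarrow> f a \<in> I (w a)) \<Longrightarrow> prod f A \<in> I (sum w A)"
  by (induction A rule: infinite_finite_induct) (auto intro: fil_mult simp: fil_0 one_mem)

lemma fiber_ideal_eval:
  fixes x :: "'a ^ ('m::finite + 'r::finite)"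
  assumes "\<rho> \<in> fiber_ideal_power e" "mcoeffs_in R \<rho>" "\<And>i. x $ i \<in> R" "\<And>j. x $ Inr j \<in> I c"
  shows "meval x \<rho> \<in> I (e * c)"
proof -
  have "meval x \<rho> = (\<Sum>k\<in>Poly_Mapping.keys \<rho>. Poly_Mapping.lookup \<rho> k * (\<Prod>v\<in>UNIV. x $ v ^ Poly_Mapping.lookup k v))"
    unfolding meval_def by (rule minsert_superset) auto
  also have "\<dots> \<in> I (e * c)"
  proof (rule fil_sum)
    fix k assume k: "k \<in> Poly_Mapping.keys \<rho>"
    have "(\<Prod>j\<in>UNIV. x $ Inr j ^ Poly_Mapping.lookup k (Inr j)) \<in> I (\<Sum>j\<in>UNIV. c * Poly_Mapping.lookup k (Inr j))"
      by (intro fil_prod fil_power assms(4))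
    moreover have "e * c \<le> (\<Sum>j\<in>UNIV. c * Poly_Mapping.lookup k (Inr j))"
      using assms(1) k by (simp add: fiber_ideal_power_def mult.commute flip: sum_distrib_left)
    ultimately have "(\<Prod>j\<in>UNIV. x $ Inr j ^ Poly_Mapping.lookup k (Inr j)) \<in> I (e * c)"
      by (rule fil_antimono)
    then show "Poly_Mapping.lookup \<rho> k * (\<Prod>v\<in>UNIV. x $ v ^ Poly_Mapping.lookup k v) \<in> I (e * c)"
      unfolding prod_UNIV_Plus
      by (rule fil_mult_left[OF mcoeffs_inD[OF assms(2)] fil_mult_left[rotated]]) (intro prod_mem power_mem assms(3))
  qed
  finally show ?thesis .
qed

text \<open>A step multiplies the order of the fiber by d: a factor d - 1 comes from \<rho> and one
  more from the linear term. It is applied to two filtrations, \<open>J\<close> and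
  \<open>coord_ideal\<close>.\<close>

lemma fiber_superattraction:
  fixes T :: "('m::finite, 'a, 'm) pmap" and M :: "('m, 'a) mpoly ^ 'r::finite ^ 'r"
  assumes T: "pmap_coeffs_in R T" and \<rho>: "mcoeffs_in R \<rho>" and M: "mat_coeffs_in R M"
    and d: "\<rho> \<in> fiber_ideal_power (d - 1)" "d \<ge> 1"
    and x0: "\<And>i. x0 $ i \<in> R" "\<And>j. x0 $ Inr j \<in> I c"
  shows "(pmap_eval (skew_product T \<rho> M) ^^ n) x0 $ Inr j \<in> I (d ^ n * c)"
proof (induction n arbitrary: j)
  case 0
  then show ?case by (simp add: x0)
next
  case (Suc n)
  define x where "x = (pmap_eval (skew_product T \<rho> M) ^^ n) x0"
  have xR: "x $ i \<in> R" for i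
    unfolding x_def by (rule orbit_mem[OF mcoeffs_in_skew_product[OF T \<rho> M] x0(1)])
  have xI: "x $ Inr j \<in> I (d ^ n * c)" for j unfolding x_def by (rule Suc)
  have "meval x \<rho> \<in> I ((d - 1) * (d ^ n * c))" by (rule fiber_ideal_eval[OF d(1) \<rho> xR xI])
  moreover have "(\<Sum>l\<in>UNIV. meval (base x) (M $ j $ l) * x $ Inr l) \<in> I (d ^ n * c)"
  proof (intro fil_sum fil_mult_left xI)
    show "meval (base x) (M $ j $ l) \<in> R" for l
      using M by (intro meval_mem) (auto simp: mat_coeffs_in_def xR)
  qed
  ultimately have "meval x \<rho> * (\<Sum>l\<in>UNIV. meval (base x) (M $ j $ l) * x $ Inr l) \<in> I ((d - 1) * (d ^ n * c) + d ^ n * c)"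
    by (rule fil_mult)
  moreover have "(d - 1) * (d ^ n * c) + d ^ n * c = d ^ Suc n * c"
    using d(2) by (cases d) (simp_all add: algebra_simps)
  ultimately have "meval x \<rho> * (\<Sum>l\<in>UNIV. meval (base x) (M $ j $ l) * x $ Inr l) \<in> I (d ^ Suc n * c)"
    by (simp only:)
  then show ?case by (simp add: skew_product_nth x_def)
qed

end

text \<open>The powers of the ideal generated by the coordinates of \<zeta>. Coordinates in
  \<open>P\<close> need not lie in \<open>J 1\<close>, so attraction has to be measured in their own
  adic filtration at the start.\<close>

definition coord_ideal :: "'a::comm_ring_1 set \<Rightarrow> 'a ^ 'r::finite \<Rightarrow> nat \<Rightarrow> 'a set"
  where "coord_ideal R \<zeta> w = {meval \<zeta> p | p. mcoeffs_in R p \<and> (\<forall>k\<in>Poly_Mapping.keys p. w \<le> monom_degree k)}"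

lemma (in subring_of) coord_ideal_filtered:
  assumes \<zeta>: "\<And>j. \<zeta> $ j \<in> R"
  shows "filtered_ring R (coord_ideal R \<zeta>)"
proof
  show "coord_ideal R \<zeta> 0 = R"
  proof
    show "coord_ideal R \<zeta> 0 \<subseteq> R" using \<zeta> by (auto simp: coord_ideal_def intro: meval_mem)
    show "R \<subseteq> coord_ideal R \<zeta> 0"
    proof
      fix a assume "a \<in> R"
      then have "mcoeffs_in R (mconst a :: ('b, 'a) mpoly)" unfolding mconst_def by (rule mcoeffs_in_single)
      then show "a \<in> coord_ideal R \<zeta> 0"
        unfolding coord_ideal_def by (intro CollectI exI[of _ "mconst a"]) simp
    qed
  qed
  show "coord_ideal R \<zeta> (Suc c) \<subseteq> coord_ideal R \<zeta> c" for c
    unfolding coord_ideal_def using Suc_leD by blast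
  show "0 \<in> coord_ideal R \<zeta> c" for c
    unfolding coord_ideal_def by (intro CollectI exI[of _ 0]) (simp add: mcoeffs_in_0)
  show "a - b \<in> coord_ideal R \<zeta> c" if ab: "a \<in> coord_ideal R \<zeta> c" "b \<in> coord_ideal R \<zeta> c" for a b c
  proof -
    obtain p where p: "a = meval \<zeta> p" "mcoeffs_in R p" "\<forall>k\<in>Poly_Mapping.keys p. c \<le> monom_degree k"
      using ab(1) unfolding coord_ideal_def by blast
    obtain q where q: "b = meval \<zeta> q" "mcoeffs_in R q" "\<forall>k\<in>Poly_Mapping.keys q. c \<le> monom_degree k"
      using ab(2) unfolding coord_ideal_def by blast
    have "mcoeffs_in R (p - q)" using p q by (auto simp: mcoeffs_in_def lookup_minus intro: diff_mem)
    moreover have "\<forall>k\<in>Poly_Mapping.keys (p - q). c \<le> monom_degree k"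
      using p(3) q(3) by (auto simp: in_keys_iff lookup_minus) 
    ultimately show ?thesis unfolding coord_ideal_def using p(1) q(1)
      by (intro CollectI exI[of _ "p - q"]) simp
  qed
  show "a * b \<in> coord_ideal R \<zeta> (i + j)" if ab: "a \<in> coord_ideal R \<zeta> i" "b \<in> coord_ideal R \<zeta> j" for a b i j
  proof -
    obtain p where p: "a = meval \<zeta> p" "mcoeffs_in R p" "\<forall>k\<in>Poly_Mapping.keys p. i \<le> monom_degree k"
      using ab(1) unfolding coord_ideal_def by blast
    obtain q where q: "b = meval \<zeta> q" "mcoeffs_in R q" "\<forall>k\<in>Poly_Mapping.keys q. j \<le> monom_degree k"
      using ab(2) unfolding coord_ideal_def by blast
    have "\<forall>k\<in>Poly_Mapping.keys (p * q). i + j \<le> monom_degree k"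
    proof
      fix k assume "k \<in> Poly_Mapping.keys (p * q)"
      then obtain k1 k2 where "k = k1 + k2" "k1 \<in> Poly_Mapping.keys p" "k2 \<in> Poly_Mapping.keys q"
        using keys_mult[of p q] by auto
      then show "i + j \<le> monom_degree k"
        using p(3) q(3) by (auto simp: monom_degree_UNIV lookup_add sum.distrib intro: add_mono)
    qed
    then show ?thesis unfolding coord_ideal_def using p q
      by (intro CollectI exI[of _ "p * q"]) (simp add: mcoeffs_in_mult)
  qed
qed

context prime_frame
begin

text \<open>The ideal generated by the initial fiber coordinates is nilpotent modulo
  \<open>J 1\<close>, and after n steps the fiber lies in its power d^n.\<close>

lemma fiber_enters_J1:
  fixes T :: "('m::finite, 'a, 'm) pmap" and M :: "('m, 'a) mpoly ^ 'r::finite ^ 'r"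
  assumes T: "pmap_coeffs_in R T" and \<rho>: "mcoeffs_in R \<rho>" and M: "mat_coeffs_in R M"
    and d: "\<rho> \<in> fiber_ideal_power (d - 1)" "d \<ge> 2"
    and x0: "\<And>i. x0 $ i \<in> R" "\<And>j. x0 $ Inr j \<in> P"
  shows "\<exists>n. \<forall>j. (pmap_eval (skew_product T \<rho> M) ^^ n) x0 $ Inr j \<in> J 1"
proof -
  define \<zeta> where "\<zeta> = fiber x0"
  have \<zeta>R: "\<zeta> $ j \<in> R" for j by (simp add: \<zeta>_def x0)
  interpret V: filtered_ring R "coord_ideal R \<zeta>" by (rule coord_ideal_filtered[OF \<zeta>R])
  have "\<zeta> $ j \<in> coord_ideal R \<zeta> 1" for j
  proof -
    have "\<forall>k\<in>Poly_Mapping.keys (mvar j :: ('r, 'a) mpoly). 1 \<le> monom_degree k"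
      by (simp add: mvar_def monom_degree_UNIV lookup_single when_def)
    then show ?thesis
      unfolding coord_ideal_def by (intro CollectI exI[of _ "mvar j"] conjI mcoeffs_in_mvar) simp_all
  qed
  then have V: "(pmap_eval (skew_product T \<rho> M) ^^ n) x0 $ Inr j \<in> coord_ideal R \<zeta> (d ^ n * 1)" for n j
    using d by (intro V.fiber_superattraction[OF T \<rho> M d(1) _ x0(1)]) (auto simp: \<zeta>_def)
  have "\<forall>j. \<exists>m. \<zeta> $ j ^ m \<in> J 1" using P_nil x0(2) by (simp add: \<zeta>_def)
  then obtain m where m: "\<And>j. \<zeta> $ j ^ m j \<in> J 1" by metis
  \<comment> \<open>A monomial of degree above \<open>N\<close> must contain some coordinate
    \<zeta>_j to the power \<open>m j\<close> or more.\<close>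
  define N where "N = (\<Sum>j\<in>UNIV. m j)"
  have sub: "coord_ideal R \<zeta> w \<subseteq> J 1" if w: "w > N" for w
  proof
    fix a assume "a \<in> coord_ideal R \<zeta> w"
    then obtain p where p: "a = meval \<zeta> p" "mcoeffs_in R p" "\<forall>k\<in>Poly_Mapping.keys p. w \<le> monom_degree k"
      unfolding coord_ideal_def by blast
    have "meval \<zeta> p = (\<Sum>k\<in>Poly_Mapping.keys p. Poly_Mapping.lookup p k * (\<Prod>v\<in>UNIV. \<zeta> $ v ^ Poly_Mapping.lookup k v))"
      unfolding meval_def by (rule minsert_superset) auto
    also have "\<dots> \<in> J 1"
    proof (intro fil_sum)
      fix k assume k: "k \<in> Poly_Mapping.keys p"
      have "\<exists>j. m j \<le> Poly_Mapping.lookup k j"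
      proof (rule ccontr)
        assume "\<nexists>j. m j \<le> Poly_Mapping.lookup k j"
        then have "monom_degree k \<le> N"
          unfolding monom_degree_UNIV N_def by (intro sum_mono) (meson nat_le_linear)
        then show False using p(3) k w by auto
      qed
      then obtain j where j: "m j \<le> Poly_Mapping.lookup k j" by blast
      have "\<zeta> $ j ^ Poly_Mapping.lookup k j = \<zeta> $ j ^ (Poly_Mapping.lookup k j - m j) * \<zeta> $ j ^ m j"
        using j by (simp flip: power_add)
      also have "\<dots> \<in> J 1" by (rule fil_mult_left[OF power_mem[OF \<zeta>R] m])
      finally have jJ: "\<zeta> $ j ^ Poly_Mapping.lookup k j \<in> J 1" .
      have rest: "(\<Prod>v\<in>UNIV - {j}. \<zeta> $ v ^ Poly_Mapping.lookup k v) \<in> R"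
        by (intro prod_mem power_mem \<zeta>R)
      have "(\<Prod>v\<in>UNIV. \<zeta> $ v ^ Poly_Mapping.lookup k v) = \<zeta> $ j ^ Poly_Mapping.lookup k j * (\<Prod>v\<in>UNIV - {j}. \<zeta> $ v ^ Poly_Mapping.lookup k v)"
        by (rule prod.remove) auto
      also have "\<dots> \<in> J 1" by (rule fil_mult_right[OF rest jJ])
      finally show "Poly_Mapping.lookup p k * (\<Prod>v\<in>UNIV. \<zeta> $ v ^ Poly_Mapping.lookup k v) \<in> J 1"
        by (rule fil_mult_left[OF mcoeffs_inD[OF p(2)]])
    qed
    finally show "a \<in> J 1" using p(1) by simp
  qed
  have "N + 1 < 2 ^ (N + 1)" by (rule less_exp)
  also have "(2::nat) ^ (N + 1) \<le> d ^ (N + 1)" using d(2) by (rule power_mono) simp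
  finally have "d ^ (N + 1) * 1 > N" by simp
  then show ?thesis using sub V[of "N + 1"] by blast
qed

end

section \<open>Growth of sizes\<close>

context normed_subring
begin

lemma meval_size_exp:
  fixes p :: "('v::finite, 'a) mpoly"
  assumes "mcoeffs_in R p" "total_degree p \<le> D"
  shows "\<exists>c. \<forall>x L. (\<forall>i. x $ i \<in> R \<and> \<nu> (x $ i) \<le> 2 ^ L) \<longrightarrow> \<nu> (meval x p) \<le> 2 ^ (c + D * L)"
proof -
  obtain C where C: "\<And>x X. (\<And>i. x $ i \<in> R) \<Longrightarrow> (\<And>i. \<nu> (x $ i) \<le> X) \<Longrightarrow> X \<ge> 1 \<Longrightarrow>
    \<nu> (meval x p) \<le> C * X ^ total_degree p"
    using meval_size[OF assms(1)] by blast
  show ?thesis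
  proof (intro exI[of _ C] allI impI)
    fix x :: "'a ^ 'v" and L assume x: "\<forall>i. x $ i \<in> R \<and> \<nu> (x $ i) \<le> 2 ^ L"
    then have "\<nu> (meval x p) \<le> C * (2 ^ L) ^ total_degree p" by (intro C) auto
    also have "\<dots> \<le> 2 ^ C * (2 ^ L) ^ D"
      using assms(2) by (intro mult_le_mono power_increasing less_imp_le[OF less_exp]) auto
    also have "\<dots> = 2 ^ (C + D * L)" by (simp add: power_add power_mult mult.commute[of D])
    finally show "\<nu> (meval x p) \<le> 2 ^ (C + D * L)" .
  qed
qed

lemma meval_size_family:
  fixes p :: "'i::finite \<Rightarrow> ('v::finite, 'a) mpoly"
  assumes "\<And>a. mcoeffs_in R (p a)" "\<And>a. total_degree (p a) \<le> D"
  obtains c where "\<And>x L a. (\<And>i. x $ i \<in> R) \<Longrightarrow> (\<And>i. \<nu> (x $ i) \<le> 2 ^ L) \<Longrightarrow> \<nu> (meval x (p a)) \<le> 2 ^ (c + D * L)"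
proof -
  obtain c where c: "\<And>a. \<forall>x L. (\<forall>i. x $ i \<in> R \<and> \<nu> (x $ i) \<le> 2 ^ L) \<longrightarrow> \<nu> (meval x (p a)) \<le> 2 ^ (c a + D * L)"
    using meval_size_exp[OF assms] by metis
  show ?thesis
  proof (rule that[of "sum c UNIV"])
    fix x :: "'a ^ 'v" and L a assume "\<And>i. x $ i \<in> R" "\<And>i. \<nu> (x $ i) \<le> 2 ^ L"
    then have "\<nu> (meval x (p a)) \<le> 2 ^ (c a + D * L)" using c by blast
    also have "\<dots> \<le> 2 ^ (sum c UNIV + D * L)"
      by (intro power_increasing add_mono member_le_sum) auto
    finally show "\<nu> (meval x (p a)) \<le> 2 ^ (sum c UNIV + D * L)" .
  qed
qed

text \<open>Under T^q a logarithmic size L becomes at most c + D L, so j blocks of q steps lead to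
  (L0 + c j) D^j, where L0 bounds the first q points.\<close>

lemma base_orbit_size:
  fixes T :: "('m::finite, 'a, 'm) pmap"
  assumes T: "pmap_coeffs_in R T" and Tq: "pmap_coeffs_in R (pmap_iterate q T)"
    and deg: "\<And>i. total_degree (pmap_iterate q T $ i) \<le> D" and D: "D \<ge> 1" and q: "q \<ge> 1"
    and u0: "\<And>i. u0 $ i \<in> R"
  obtains C where "\<And>n i. \<nu> ((pmap_eval T ^^ n) u0 $ i) \<le> 2 ^ (C * ((n + 1) * D ^ (n div q)))"
proof -
  define u where "u n = (pmap_eval T ^^ n) u0" for n
  have uR: "u n $ i \<in> R" for n i
    unfolding u_def using T u0 by (intro orbit_mem) (auto simp: pmap_coeffs_in_def)
  obtain c where c: "\<And>x L a. (\<And>i. x $ i \<in> R) \<Longrightarrow> (\<And>i. \<nu> (x $ i) \<le> 2 ^ L) \<Longrightarrow>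
      \<nu> (meval x (pmap_iterate q T $ a)) \<le> 2 ^ (c + D * L)"
    using meval_size_family[of "\<lambda>a. pmap_iterate q T $ a" D] Tq deg unfolding pmap_coeffs_in_def by blast
  define L0 where "L0 = (\<Sum>i<q. \<Sum>a\<in>UNIV. \<nu> (u i $ a))"
  have main: "\<nu> (u (i + q * j) $ a) \<le> 2 ^ ((L0 + c * j) * D ^ j)" if i: "i < q" for i j a
  proof (induction j arbitrary: a)
    case 0
    have "\<nu> (u i $ a) \<le> (\<Sum>a\<in>UNIV. \<nu> (u i $ a))" by (rule member_le_sum) auto
    also have "\<dots> \<le> L0" unfolding L0_def using i by (intro member_le_sum) auto
    also have "L0 \<le> 2 ^ L0" by (rule less_imp_le[OF less_exp])
    finally show ?case by simp
  next
    case (Suc j)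
    have "u (i + q * Suc j) = (pmap_eval T ^^ (q + (i + q * j))) u0"
      unfolding u_def by (simp add: algebra_simps)
    also have "\<dots> = (pmap_eval T ^^ q) (u (i + q * j))"
      unfolding u_def funpow_add by simp
    also have "\<dots> = pmap_eval (pmap_iterate q T) (u (i + q * j))" by (rule pmap_eval_iterate[symmetric])
    finally have "\<nu> (u (i + q * Suc j) $ a) \<le> 2 ^ (c + D * ((L0 + c * j) * D ^ j))"
      using c[OF uR Suc, of a] by simp
    also have "\<dots> \<le> 2 ^ ((L0 + c * Suc j) * D ^ Suc j)"
    proof (rule power_increasing)
      have "c * 1 \<le> c * D ^ Suc j" using D by (intro mult_le_mono2 one_le_power)
      then show "c + D * ((L0 + c * j) * D ^ j) \<le> (L0 + c * Suc j) * D ^ Suc j"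
        by (simp add: algebra_simps)
    qed simp
    finally show ?case .
  qed
  show ?thesis
  proof (rule that[of "L0 + c"])
    fix n i
    have "\<nu> (u (n mod q + q * (n div q)) $ i) \<le> 2 ^ ((L0 + c * (n div q)) * D ^ (n div q))"
      using q by (intro main) simp
    also have "\<dots> \<le> 2 ^ ((L0 + c) * ((n + 1) * D ^ (n div q)))"
    proof (rule power_increasing)
      have "L0 + c * (n div q) \<le> L0 * (n + 1) + c * (n + 1)"
        by (intro add_mono mult_le_mono2) (simp_all add: le_SucI)
      then have "(L0 + c * (n div q)) * D ^ (n div q) \<le> ((L0 + c) * (n + 1)) * D ^ (n div q)"
        by (intro mult_le_mono1) (simp add: algebra_simps)
      then show "(L0 + c * (n div q)) * D ^ (n div q) \<le> (L0 + c) * ((n + 1) * D ^ (n div q))"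
        by (simp only: mult.assoc)
    qed simp
    finally show "\<nu> ((pmap_eval T ^^ n) u0 $ i) \<le> 2 ^ ((L0 + c) * ((n + 1) * D ^ (n div q)))"
      by (simp add: u_def)
  qed
qed

text \<open>Each step adds at most a constant multiple of the logarithmic size of the base point;
  adding up n steps costs one more factor n + 1.\<close>

lemma cocycle_size:
  fixes M :: "('m::finite, 'a) mpoly ^ 'r::finite ^ 'r" and u :: "nat \<Rightarrow> 'a ^ 'm" and w :: "nat \<Rightarrow> 'a ^ 'r"
  assumes M: "mat_coeffs_in R M" and uR: "\<And>n i. u n $ i \<in> R" and wR: "\<And>j. w 0 $ j \<in> R"
    and w: "\<And>n. w (Suc n) = map_matrix (meval (u n)) M *v w n"
    and u: "\<And>n i. \<nu> (u n $ i) \<le> 2 ^ (C * (n + 1) * E n)"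
    and E: "mono E" "\<And>n. E n \<ge> 1"
  obtains C' where "\<And>n j. \<nu> (w n $ j) \<le> 2 ^ (C' * ((n + 1) * (n + 1) * E n))"
proof -
  define e where "e = (\<Sum>a\<in>UNIV. total_degree (M $ fst a $ snd a))"
  have "total_degree (M $ fst a $ snd a) \<le> e" for a
    unfolding e_def by (rule member_le_sum) auto
  then obtain c where c: "\<And>x L a. (\<And>i. x $ i \<in> R) \<Longrightarrow> (\<And>i. \<nu> (x $ i) \<le> 2 ^ L) \<Longrightarrow>
      \<nu> (meval x (M $ fst a $ snd a)) \<le> 2 ^ (c + e * L)"
    using meval_size_family[of "\<lambda>a. M $ fst a $ snd a" e] M unfolding mat_coeffs_in_def by blast
  have MR: "meval (u n) (M $ j $ l) \<in> R" for n j l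
    using M by (intro meval_mem uR) (auto simp: mat_coeffs_in_def)
  have w_nth: "w (Suc n) $ j = (\<Sum>l\<in>UNIV. meval (u n) (M $ j $ l) * w n $ l)" for n j
    by (simp add: w matrix_vector_mult_def map_matrix_def)
  have wR: "w n $ j \<in> R" for n j
  proof (induction n arbitrary: j)
    case (Suc n)
    show ?case unfolding w_nth by (intro sum_mem mult_mem MR Suc)
  qed (rule wR)
  define W0 where "W0 = (\<Sum>j\<in>UNIV. \<nu> (w 0 $ j))"
  define C' where "C' = W0 + (CARD('r) + c + e * C)"
  have "\<nu> (w n $ j) \<le> 2 ^ (C' * ((n + 1) * (n + 1) * E n))" for n j
  proof (induction n arbitrary: j)
    case 0
    have "\<nu> (w 0 $ j) \<le> W0" unfolding W0_def by (rule member_le_sum) auto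
    also have "W0 \<le> 2 ^ W0" by (rule less_imp_le[OF less_exp])
    also have "\<dots> \<le> 2 ^ (C' * ((0 + 1) * (0 + 1) * E 0))"
    proof (rule power_increasing)
      have "W0 * 1 \<le> C' * E 0" using E(2)[of 0] by (intro mult_le_mono) (simp_all add: C'_def)
      then show "W0 \<le> C' * ((0 + 1) * (0 + 1) * E 0)" by simp
    qed simp
    finally show ?case .
  next
    case (Suc n)
    define X where "X = C' * ((n + 1) * (n + 1) * E n)"
    define L where "L = C * (n + 1) * E n"
    have "\<nu> (w (Suc n) $ j) \<le> (\<Sum>l\<in>UNIV. \<nu> (meval (u n) (M $ j $ l) * w n $ l))"
      unfolding w_nth by (intro nu_sum mult_mem MR wR)
    also have "\<dots> \<le> (\<Sum>l\<in>(UNIV :: 'r set). 2 ^ (c + e * L) * 2 ^ X)"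
    proof (rule sum_mono)
      fix l
      have "\<nu> (meval (u n) (M $ j $ l) * w n $ l) \<le> \<nu> (meval (u n) (M $ j $ l)) * \<nu> (w n $ l)"
        by (intro nu_mult MR wR)
      also have "\<dots> \<le> 2 ^ (c + e * L) * 2 ^ X"
        using c[OF uR u, of n "(j, l)"] Suc[of l] by (intro mult_le_mono) (simp_all add: X_def L_def)
      finally show "\<nu> (meval (u n) (M $ j $ l) * w n $ l) \<le> 2 ^ (c + e * L) * 2 ^ X" .
    qed
    also have "\<dots> = CARD('r) * (2 ^ (c + e * L) * 2 ^ X)" by simp
    also have "\<dots> \<le> 2 ^ CARD('r) * (2 ^ (c + e * L) * 2 ^ X)"
      by (intro mult_le_mono1 less_imp_le[OF less_exp])
    also have "\<dots> = 2 ^ (CARD('r) + c + e * L + X)" by (simp add: power_add)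
    also have "\<dots> \<le> 2 ^ (C' * ((Suc n + 1) * (Suc n + 1) * E (Suc n)))"
    proof (rule power_increasing)
      have E': "E n \<le> E (Suc n)" using E(1) by (simp add: mono_def)
      have one: "1 \<le> (n + 1) * E n" using E(2)[of n] by simp
      have "(CARD('r) + c) * 1 \<le> (CARD('r) + c) * ((n + 1) * E n)" using one by (rule mult_le_mono2)
      then have "CARD('r) + c + e * L \<le> (CARD('r) + c + e * C) * ((n + 1) * E n)"
        by (simp add: L_def algebra_simps)
      also have "\<dots> \<le> C' * ((n + 1) * E n)" by (intro mult_le_mono1) (simp add: C'_def)
      finally have "CARD('r) + c + e * L + X \<le> C' * ((n + 1) * E n) + C' * ((n + 1) * (n + 1) * E n)"
        by (simp add: X_def)
      also have "\<dots> = C' * ((n + 2) * (n + 1) * E n)" by (simp add: algebra_simps)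
      also have "\<dots> \<le> C' * ((Suc n + 1) * (Suc n + 1) * E (Suc n))"
        using E' by (intro mult_le_mono2 mult_le_mono) auto
      finally show "CARD('r) + c + e * L + X \<le> C' * ((Suc n + 1) * (Suc n + 1) * E (Suc n))" .
    qed simp
    finally show ?case .
  qed
  then show ?thesis using that by blast
qed

end

text \<open>With j = n div q the point is that j^2 (D / d^q)^j tends to 0, because D < d^q.\<close>

lemma growth_comparison:
  fixes C D d q :: nat
  assumes "D \<ge> 1" "D < d ^ q" "q \<ge> 1" "d \<ge> 2"
  shows "\<exists>N. \<forall>n\<ge>N. C * ((n + 1) * (n + 1) * D ^ (n div q) + 1) \<le> d ^ n - 1"
proof -
  define B where "B = d ^ q"
  \<comment> \<open>The square root makes j^2 (D / B)^j the square of j s^j, a standard null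
    sequence.\<close>
  define s where "s = sqrt (real D / real B)"
  have B: "D < B" "B > 0" using assms by (auto simp: B_def)
  then have s: "0 \<le> s" "s < 1" "s ^ 2 = real D / real B"
    by (auto simp: s_def)
  \<comment> \<open>From (n + 1)^2 \<le> q^2 (j + 1)^2, doubled to absorb the summand 1 next to the
    power of D. The final 1 keeps \<open>K\<close> positive when C = 0.\<close>
  define K where "K = 2 * C * q\<^sup>2 + 1"
  have "(\<lambda>j. real j * s ^ j) \<longlonglongrightarrow> 0" using s by (intro powser_times_n_limit_0) simp
  then have "(\<lambda>j. (real j * s ^ j) ^ 2) \<longlonglongrightarrow> 0 ^ 2" by (rule tendsto_power)
  then have "(\<lambda>j. (real j * s ^ j) ^ 2) \<longlonglongrightarrow> 0" by simp
  \<comment> \<open>The estimate is used at j + 1, where one factor D/B is cancelled; hence this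
    threshold.\<close>
  then have "eventually (\<lambda>j. (real j * s ^ j) ^ 2 < real D / real B / real K) sequentially"
    by (rule order_tendstoD(2)) (use assms B in \<open>simp add: K_def add_pos_nonneg\<close>)
  then obtain j0 where j0: "\<And>j. j \<ge> j0 \<Longrightarrow> (real j * s ^ j) ^ 2 < real D / real B / real K"
    unfolding eventually_sequentially by blast
  show ?thesis
  proof (intro exI[of _ "q * j0"] allI impI)
    fix n assume n: "n \<ge> q * j0"
    define j where "j = n div q"
    have j: "j \<ge> j0" using n assms(3) by (simp add: j_def less_eq_div_iff_mult_less_eq mult.commute)
    have "(real (Suc j) * s ^ Suc j) ^ 2 < real D / real B / real K" using j0[of "Suc j"] j by simp
    moreover have "(real (Suc j) * s ^ Suc j) ^ 2 = real (Suc j) ^ 2 * (real D / real B) ^ Suc j"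
      by (simp add: power_mult_distrib s(3)[symmetric] power_even_eq[symmetric] flip: power_mult power_add)
        (simp add: mult_2_right mult.commute power_add power2_eq_square)
    ultimately have "real (Suc j) ^ 2 * (real D / real B) ^ j * (real D / real B) < 1 / real K * (real D / real B)"
      by (simp add: mult_ac)
    then have "real (Suc j) ^ 2 * (real D / real B) ^ j < 1 / real K"
      using assms B by (simp only: mult_less_cancel_right_pos divide_pos_pos of_nat_0_less_iff)
    then have "real (Suc j) ^ 2 * real D ^ j / real B ^ j < 1 / real K"
      by (simp add: power_divide)
    moreover have "K > 0" by (simp add: K_def)
    then have "real K > 0" by (simp only: of_nat_0_less_iff)
    moreover have "real B ^ j > 0" using B by simp
    ultimately have "real K * (real (Suc j) ^ 2 * real D ^ j) < real B ^ j"
      by (simp add: divide_less_eq less_divide_eq mult_ac)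
    then have "real (K * ((Suc j)\<^sup>2 * D ^ j)) < real (B ^ j)" by simp
    then have KB: "K * ((Suc j)\<^sup>2 * D ^ j) < B ^ j" by (simp only: of_nat_less_iff)
    have "n mod q < q" using assms(3) by simp
    moreover have "q * j + n mod q = n" unfolding j_def by (rule mult_div_mod_eq)
    ultimately have "n + 1 \<le> q + q * j" by linarith
    then have "n + 1 \<le> q * Suc j" by simp
    then have "(n + 1) * (n + 1) \<le> (q * Suc j) * (q * Suc j)" by (intro mult_le_mono)
    then have "(n + 1) * (n + 1) * D ^ j \<le> (q * Suc j) * (q * Suc j) * D ^ j" by (rule mult_le_mono1)
    also have "\<dots> = q\<^sup>2 * ((Suc j)\<^sup>2 * D ^ j)" by (simp only: power2_eq_square mult_ac)
    finally have "(n + 1) * (n + 1) * D ^ j \<le> q\<^sup>2 * ((Suc j)\<^sup>2 * D ^ j)" .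
    moreover have "1 * 1 * 1 \<le> (n + 1) * (n + 1) * D ^ j"
      by (intro mult_le_mono one_le_power assms(1)) simp_all
    ultimately have "(n + 1) * (n + 1) * D ^ j + 1 \<le> 2 * (q\<^sup>2 * ((Suc j)\<^sup>2 * D ^ j))"
      by linarith
    then have "C * ((n + 1) * (n + 1) * D ^ j + 1) \<le> C * (2 * (q\<^sup>2 * ((Suc j)\<^sup>2 * D ^ j)))" by (rule mult_le_mono2)
    moreover have "K * ((Suc j)\<^sup>2 * D ^ j) = C * (2 * (q\<^sup>2 * ((Suc j)\<^sup>2 * D ^ j))) + (Suc j)\<^sup>2 * D ^ j"
      by (simp add: K_def algebra_simps)
    ultimately have "C * ((n + 1) * (n + 1) * D ^ j + 1) < B ^ j" using KB by linarith
    also have "B ^ j = d ^ (q * j)" by (simp add: B_def power_mult)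
    also have "\<dots> \<le> d ^ n" using assms by (intro power_increasing) (auto simp: j_def)
    finally show "C * ((n + 1) * (n + 1) * D ^ (n div q) + 1) \<le> d ^ n - 1" by (simp add: j_def)
  qed
qed

section \<open>Superattracted orbits\<close>

definition fiber_degree :: "('m + 'r::finite \<Rightarrow>\<^sub>0 nat) \<Rightarrow> nat"
  where "fiber_degree e = (\<Sum>j\<in>UNIV. Poly_Mapping.lookup e (Inr j))"

definition fiber_hom_part :: "nat \<Rightarrow> ('m + 'r::finite, 'k::comm_monoid_add) mpoly \<Rightarrow> ('m + 'r, 'k) mpoly"
  where "fiber_hom_part j p = (\<Sum>e\<in>{e \<in> Poly_Mapping.keys p. fiber_degree e = j}.
    Poly_Mapping.single e (Poly_Mapping.lookup p e))"

lemma (in subring_of) mcoeffs_in_fiber_hom_part: "mcoeffs_in R p \<Longrightarrow> mcoeffs_in R (fiber_hom_part j p)"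
  unfolding fiber_hom_part_def by (intro mcoeffs_in_sum mcoeffs_in_single mcoeffs_inD)

lemma fiber_scaling:
  fixes g :: "('m::finite + 'r::finite, 'k::comm_semiring_1) mpoly"
  shows "\<exists>K. \<forall>u w c. meval (join u (c *s w)) g = (\<Sum>j\<le>K. c ^ j * meval (join u w) (fiber_hom_part j g))"
proof -
  define K where "K = (\<Sum>e\<in>Poly_Mapping.keys g. fiber_degree e)"
  let ?s = "\<lambda>e. Poly_Mapping.single e (Poly_Mapping.lookup g e)"
  have single: "meval (join u (c *s w)) (Poly_Mapping.single e a) =
      c ^ fiber_degree e * meval (join u w) (Poly_Mapping.single e a)" for u w c e a
    by (simp add: meval_single prod_UNIV_Plus fiber_degree_def power_mult_distrib prod.distrib power_sum mult_ac)
  have "meval (join u (c *s w)) g = (\<Sum>j\<le>K. c ^ j * meval (join u w) (fiber_hom_part j g))" for u w c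
  proof -
    have "meval (join u (c *s w)) g = (\<Sum>e\<in>Poly_Mapping.keys g. c ^ fiber_degree e * meval (join u w) (?s e))"
      by (subst poly_mapping_sum_singles[of g]) (simp add: single)
    also have "\<dots> = (\<Sum>j\<le>K. \<Sum>e\<in>{e \<in> Poly_Mapping.keys g. fiber_degree e = j}. c ^ fiber_degree e * meval (join u w) (?s e))"
    proof (rule sum.group[symmetric])
      have "fiber_degree e \<le> K" if "e \<in> Poly_Mapping.keys g" for e
        unfolding K_def using that by (intro member_le_sum) auto
      then show "fiber_degree ` Poly_Mapping.keys g \<subseteq> {..K}" by auto
    qed auto
    also have "\<dots> = (\<Sum>j\<le>K. c ^ j * meval (join u w) (fiber_hom_part j g))"
      by (simp add: fiber_hom_part_def sum_distrib_left)
    finally show ?thesis .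
  qed
  then show ?thesis by blast
qed

lemma total_degree_le_pmap_degree: "total_degree (f $ i) \<le> pmap_degree f"
proof (cases "f $ i = 0")
  case True
  then show ?thesis by (simp add: total_degree_def)
next
  case False
  have "{total_degree (f $ i) | i. f $ i \<noteq> 0} \<subseteq> range (\<lambda>i. total_degree (f $ i))" by auto
  then have "finite {total_degree (f $ i) | i. f $ i \<noteq> 0}" by (rule finite_subset) simp
  then show ?thesis unfolding pmap_degree_def using False by (intro Max_ge) auto
qed

lemma eventually_periodic_bounded_all:
  "(\<And>j. eventually_periodic {n. Q j n}) \<Longrightarrow> eventually_periodic {n. \<forall>j\<le>(K::nat). Q j n}"
proof (induction K)
  case (Suc K)
  have "{n. \<forall>j\<le>Suc K. Q j n} = {n. \<forall>j\<le>K. Q j n} \<inter> {n. Q (Suc K) n}"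
    by (auto simp: le_Suc_eq)
  then show ?case using Suc eventually_periodic_Int by simp
qed simp

context prime_frame
begin

text \<open>
  Write the fiber coordinate as \<open>\<lambda>\<^sub>n w\<^sub>n\<close>, where \<open>w\<^sub>n\<close> follows the linear cocycle \<open>M\<close> over the
  base orbit. The scalars \<open>\<lambda>\<^sub>n\<close> lie in \<open>J (d ^ n - 1)\<close>, while the sizes along the orbit of
  \<open>(u, w)\<close> grow more slowly, so by the Liouville inequality a polynomial can vanish at a late point
  only if all its homogeneous parts vanish at \<open>(u\<^sub>n, w\<^sub>n)\<close>.
\<close>

lemma superattracted_orbit:
  fixes T :: "('m::finite, 'a, 'm) pmap" and M N :: "('m, 'a) mpoly ^ 'r::finite ^ 'r"
  assumes T: "pmap_coeffs_in R T" and \<rho>: "mcoeffs_in R \<rho>" and M: "mat_coeffs_in R M" and N: "mat_coeffs_in R N"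
    and MN: "M ** N = mat 1"
    and det: "\<And>u. det (map_matrix (meval u) (jacobian T)) = c" "c \<noteq> 0" "1 / c \<in> R"
    and Tq: "pmap_coeffs_in R (pmap_iterate q T)" "pmap_degree (pmap_iterate q T) < d ^ q" "q \<ge> 1"
    and d: "\<rho> \<in> fiber_ideal_power (d - 1)" "d \<ge> 2"
    and x0: "\<And>i. x0 $ i \<in> R" "\<And>j. x0 $ Inr j \<in> J 1"
    and nz: "\<And>n. fiber ((pmap_eval (skew_product T \<rho> M) ^^ n) x0) \<noteq> 0"
    and g: "mcoeffs_in R g"
  shows "eventually_periodic {n. meval ((pmap_eval (skew_product T \<rho> M) ^^ n) x0) g = 0}"
proof -
  define x where "x n = (pmap_eval (skew_product T \<rho> M) ^^ n) x0" for n
  \<comment> \<open>The map that F shadows: without \<rho> the fiber follows the cocycle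
    \<open>M\<close>, and the map is etale.\<close>
  define G where "G = skew_product T 1 M"
  define y where "y n = (pmap_eval G ^^ n) x0" for n
  have x_Suc: "x (Suc n) = pmap_eval (skew_product T \<rho> M) (x n)" for n by (simp add: x_def)
  have y_Suc: "y (Suc n) = pmap_eval G (y n)" for n by (simp add: y_def)
  have xR: "x n $ i \<in> R" for n i
    unfolding x_def by (rule orbit_mem[OF mcoeffs_in_skew_product[OF T \<rho> M] x0(1)])
  have yR: "y n $ i \<in> R" for n i
    unfolding y_def G_def by (rule orbit_mem[OF mcoeffs_in_skew_product[OF T mcoeffs_in_1 M] x0(1)])
  have base_y: "base (y n) = (pmap_eval T ^^ n) (base x0)" for n
    by (induction n) (simp_all add: y_Suc G_def base_skew_product, simp add: y_def)
  have base_x: "base (x n) = base (y n)" for n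
    by (induction n) (simp_all add: x_Suc y_Suc G_def base_skew_product, simp add: y_def x_def)
  define lam where "lam = rec_nat 1 (\<lambda>n l. l * meval (x n) \<rho>)"
  have lam: "lam 0 = 1" "lam (Suc n) = lam n * meval (x n) \<rho>" for n by (simp_all add: lam_def)
  have lamR: "lam n \<in> R" for n
    by (induction n) (auto simp: lam intro: one_mem mult_mem meval_mem[OF \<rho> xR])
  have fiber_x: "fiber (x n) = lam n *s fiber (y n)" for n
  proof (induction n)
    case 0
    show ?case by (simp add: lam x_def y_def)
  next
    case (Suc n)
    show ?case
      by (simp add: x_Suc y_Suc G_def fiber_skew_product lam Suc base_x vector_scalar_commute vector_smult_assoc mult.commute)
  qed
  have x_eq: "x n = join (base (y n)) (lam n *s fiber (y n))" for n
    using join_base_fiber[of "x n"] by (simp add: fiber_x base_x)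
  have lam0: "lam n \<noteq> 0" for n using nz[of n] fiber_x[of n] by (auto simp: x_def)
  have xJ: "x n $ Inr j \<in> J (d ^ n)" for n j
    using fiber_superattraction[OF T \<rho> M d(1) _ x0, of n j] d(2) by (simp add: x_def)
  \<comment> \<open>The exponent is the sum of (d - 1) d^i over i < n, the orders of \<rho> along
    the orbit.\<close>
  have lamJ: "lam n \<in> J (d ^ n - 1)" for n
  proof (induction n)
    case 0
    show ?case by (simp add: lam fil_0 one_mem)
  next
    case (Suc n)
    have "lam n * meval (x n) \<rho> \<in> J (d ^ n - 1 + (d - 1) * d ^ n)"
      by (rule fil_mult[OF Suc fiber_ideal_eval[OF d(1) \<rho> xR xJ]])
    moreover have "d ^ n - 1 + (d - 1) * d ^ n = d ^ Suc n - 1"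
    proof -
      have "d ^ n \<ge> 1" using d(2) by simp
      moreover have "(d - 1) * d ^ n + d ^ n = d ^ Suc n"
        using d(2) by (cases d) (simp_all add: algebra_simps)
      ultimately show ?thesis by linarith
    qed
    ultimately show ?case by (simp only: lam)
  qed
  \<comment> \<open>The growth estimates require D \<ge> 1, and D stays below d^q because d^q >
    1.\<close>
  define D where "D = max 1 (pmap_degree (pmap_iterate q T))"
  define E where "E n = D ^ (n div q)" for n
  have "d ^ 1 \<le> d ^ q" using Tq(3) d(2) by (intro power_increasing) simp_all
  then have "1 < d ^ q" using d(2) by simp
  then have D: "D \<ge> 1" "D < d ^ q" using Tq(2) by (auto simp: D_def)
  have E: "mono E" "E n \<ge> 1" for n
    unfolding E_def using D(1) by (auto intro!: monoI power_increasing div_le_mono)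
  have deg: "total_degree (pmap_iterate q T $ i) \<le> D" for i
    using total_degree_le_pmap_degree[of "pmap_iterate q T" i] by (simp add: D_def)
  have base_x0: "base x0 $ i \<in> R" for i by (simp add: x0(1))
  obtain C1 where C1: "\<And>n i. \<nu> ((pmap_eval T ^^ n) (base x0) $ i) \<le> 2 ^ (C1 * ((n + 1) * D ^ (n div q)))"
    by (rule base_orbit_size[OF T Tq(1) deg D(1) Tq(3) base_x0]) blast
  have base_size: "\<nu> (base (y n) $ i) \<le> 2 ^ (C1 * (n + 1) * E n)" for n i
    using C1[of n i] unfolding base_y E_def by (simp only: mult.assoc)
  have base_R: "base (y n) $ i \<in> R" and fiber_R: "fiber (y n) $ j \<in> R" for n i j
    by (simp_all add: yR)
  have fiber_Suc: "fiber (y (Suc n)) = map_matrix (meval (base (y n))) M *v fiber (y n)" for n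
    by (simp add: y_Suc G_def fiber_skew_product)
  obtain C2 where C2: "\<And>n j. \<nu> (fiber (y n) $ j) \<le> 2 ^ (C2 * ((n + 1) * (n + 1) * E n))"
    by (rule cocycle_size[of M "\<lambda>n. base (y n)" "\<lambda>n. fiber (y n)",
          OF M base_R fiber_R fiber_Suc base_size E]) blast
  define L where "L n = (C1 + C2) * ((n + 1) * (n + 1) * E n)" for n
  have y_size: "\<nu> (y n $ i) \<le> 2 ^ L n" for n i
  proof (cases i)
    case (Inl a)
    have "C1 * (n + 1) * E n * 1 \<le> C1 * (n + 1) * E n * (n + 1)" by (intro mult_le_mono2) simp
    also have "\<dots> = C1 * ((n + 1) * (n + 1) * E n)" by (simp only: mult_ac)
    also have "\<dots> \<le> L n" unfolding L_def by (intro mult_le_mono1) simp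
    finally have "(2::nat) ^ (C1 * (n + 1) * E n) \<le> 2 ^ L n" by (intro power_increasing) simp_all
    with base_size[of n a] have "\<nu> (base (y n) $ a) \<le> 2 ^ L n" by (rule le_trans)
    then show ?thesis using Inl by simp
  next
    case (Inr j)
    have "(2::nat) ^ (C2 * ((n + 1) * (n + 1) * E n)) \<le> 2 ^ L n"
      unfolding L_def by (intro power_increasing mult_le_mono1) simp_all
    with C2[of n j] have "\<nu> (fiber (y n) $ j) \<le> 2 ^ L n" by (rule le_trans)
    then show ?thesis using Inr by simp
  qed
  obtain K where K: "\<And>u w c. meval (join u (c *s w)) g = (\<Sum>j\<le>K. c ^ j * meval (join u w) (fiber_hom_part j g))"
    using fiber_scaling[of g] by blast
  define h where "h j n = meval (y n) (fiber_hom_part j g)" for j n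
  have hR: "h j n \<in> R" for j n
    unfolding h_def by (intro meval_mem mcoeffs_in_fiber_hom_part g yR)
  have expand: "meval (x n) g = (\<Sum>j\<le>K. lam n ^ j * h j n)" for n
    by (subst x_eq) (simp add: K h_def)
  obtain C where C: "\<And>S b. b \<in> R \<Longrightarrow> \<nu> b \<le> 2 ^ S \<Longrightarrow> b \<in> J (C * (S + 1)) \<Longrightarrow> b = 0"
    using P_liouville by blast
  have small: "\<exists>N. \<forall>n\<ge>N. h j n \<in> J (d ^ n - 1) \<longrightarrow> h j n = 0" for j
  proof -
    obtain b where b: "\<forall>x L. (\<forall>i. x $ i \<in> R \<and> \<nu> (x $ i) \<le> 2 ^ L) \<longrightarrow>
        \<nu> (meval x (fiber_hom_part j g)) \<le> 2 ^ (b + total_degree (fiber_hom_part j g) * L)"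
      using meval_size_exp[OF mcoeffs_in_fiber_hom_part[OF g] order.refl, of j] by blast
    define t where "t = total_degree (fiber_hom_part j g)"
    define C' where "C' = C * (b + t * (C1 + C2) + 1)"
    obtain N where N: "\<And>n. n \<ge> N \<Longrightarrow> C' * ((n + 1) * (n + 1) * D ^ (n div q) + 1) \<le> d ^ n - 1"
      using growth_comparison[OF D Tq(3) d(2)] by blast
    have "h j n = 0" if n: "n \<ge> N" "h j n \<in> J (d ^ n - 1)" for n
    proof (rule C[OF hR])
      show "\<nu> (h j n) \<le> 2 ^ (b + t * L n)"
        unfolding h_def t_def using b yR y_size by blast
      define z where "z = (n + 1) * (n + 1) * E n"
      have "b + t * L n + 1 \<le> (b + t * (C1 + C2) + 1) * (z + 1)"
        unfolding L_def z_def[symmetric] by (simp add: algebra_simps)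
      then have "C * (b + t * L n + 1) \<le> C' * (z + 1)"
        unfolding C'_def mult.assoc by (rule mult_le_mono2)
      also have "\<dots> \<le> d ^ n - 1" using N[OF n(1)] by (simp only: z_def E_def)
      finally show "h j n \<in> J (C * (b + t * L n + 1))" by (rule fil_antimono[OF n(2)])
    qed
    then show ?thesis by blast
  qed
  then obtain N0 where N0: "\<And>j n. n \<ge> N0 j \<Longrightarrow> h j n \<in> J (d ^ n - 1) \<Longrightarrow> h j n = 0" by metis
  define N1 where "N1 = (\<Sum>j\<le>K. N0 j)"
  have "meval (x n) g = 0 \<longleftrightarrow> (\<forall>j\<le>K. h j n = 0)" if n: "n \<ge> N1" for n
  proof
    assume zero: "meval (x n) g = 0"
    \<comment> \<open>Once the lower parts vanish, the nonzero power of \<open>lam n\<close> can be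
      divided out. Every other term still contains \<open>lam n\<close>, so \<open>h j n\<close> has
      order d^n - 1 and must be 0 for late n.\<close>
    have "j \<le> K \<Longrightarrow> h j n = 0" for j
    proof (induction j rule: less_induct)
      case (less j)
      have "(\<Sum>i\<le>K. lam n ^ i * h i n) = (\<Sum>i\<in>{j..K}. lam n ^ i * h i n)"
        using less by (intro sum.mono_neutral_right) auto
      also have "\<dots> = (\<Sum>i\<in>{j..K}. lam n ^ j * (lam n ^ (i - j) * h i n))"
        by (intro sum.cong refl) (simp add: mult.assoc[symmetric] flip: power_add)
      also have "\<dots> = lam n ^ j * (\<Sum>i\<in>{j..K}. lam n ^ (i - j) * h i n)"
        by (simp add: sum_distrib_left)
      finally have "(\<Sum>i\<in>{j..K}. lam n ^ (i - j) * h i n) = 0"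
        using zero lam0 by (simp add: expand)
      moreover have "(\<Sum>i\<in>{j..K}. lam n ^ (i - j) * h i n) = h j n + (\<Sum>i\<in>{Suc j..K}. lam n ^ (i - j) * h i n)"
        using less.prems by (simp add: sum.atLeast_Suc_atMost)
      ultimately have hj: "h j n = - (\<Sum>i\<in>{Suc j..K}. lam n ^ (i - j) * h i n)"
        by (simp add: eq_neg_iff_add_eq_0)
      have "lam n ^ (i - j) * h i n \<in> J (d ^ n - 1)" if "i \<in> {Suc j..K}" for i
      proof -
        have "i - j = Suc (i - j - 1)" using that by auto
        then have "lam n ^ (i - j) = lam n * lam n ^ (i - j - 1)"
          by (metis power_Suc)
        then show ?thesis
          by (simp only: mult.assoc) (rule fil_mult_right[OF mult_mem[OF power_mem[OF lamR] hR] lamJ])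
      qed
      then have "h j n \<in> J (d ^ n - 1)" unfolding hj by (intro fil_uminus fil_sum)
      moreover have "N0 j \<le> n"
      proof -
        have "N0 j \<le> N1" unfolding N1_def using less.prems by (intro member_le_sum) auto
        then show ?thesis using n by linarith
      qed
      ultimately show ?case by (intro N0)
    qed
    then show "\<forall>j\<le>K. h j n = 0" by blast
  qed (simp add: expand)
  moreover have "eventually_periodic {n. \<forall>j\<le>K. h j n = 0}"
  proof (rule eventually_periodic_bounded_all)
    fix j
    have one: "(1::'a) \<notin> P" by (rule P_one)
    show "eventually_periodic {n. h j n = 0}"
      unfolding h_def y_def G_def
      by (rule skew_etale_orbit[OF T mcoeffs_in_1 M N MN det x0(1) _ _ mcoeffs_in_fiber_hom_part[OF g]])
        (simp_all add: one radial_derivative_one)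
  qed
  ultimately have "eventually_periodic {n. meval (x n) g = 0}"
    by (intro eventually_periodic_eventually[of "\<lambda>n. \<forall>j\<le>K. h j n = 0" N1 "\<lambda>n. meval (x n) g = 0" 0]) simp_all
  then show ?thesis by (simp add: x_def)
qed

lemma P_power: "a \<in> R \<Longrightarrow> a ^ n \<in> P \<Longrightarrow> a \<in> P"
proof (induction n)
  case 0
  then show ?case using P_one by simp
next
  case (Suc n)
  then show ?case using P_prime[of a "a ^ n"] power_mem[of a n] by auto
qed

end

text \<open>The determinant has no zero, so it is constant; hence the single element 1/c in
  \<open>R\<close> makes the base Jacobian invertible at every point of an orbit.\<close>

lemma etale_constant_jacobian:
  fixes T :: "('m::finite, 'k::{alg_closed_field, field_char_0}, 'm) pmap"
  assumes "etale T"
  obtains c where "c \<noteq> 0" "\<And>u. det (map_matrix (meval u) (jacobian T)) = c"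
proof -
  have nz: "meval u (det (jacobian T)) \<noteq> 0" for u
    using assms unfolding etale_def by (simp add: meval_det invertible_det_nz)
  show ?thesis
  proof (rule that[OF nz[of 0]])
    show "det (map_matrix (meval u) (jacobian T)) = meval 0 (det (jacobian T))" for u
      using nonvanishing_imp_constant[OF nz, of u 0] by (simp add: meval_det)
  qed
qed

theorem skew_product_orbit_zeros:
  fixes T :: "('m::finite, 'k::{alg_closed_field, field_char_0}, 'm) pmap"
    and M :: "('m, 'k) mpoly ^ 'r::finite ^ 'r"
  assumes "etale T" and "invertible M" and d: "d \<ge> 2"
    and \<rho>: "\<rho> \<in> fiber_ideal_power (d - 1)"
    and q: "q \<ge> 1" and deg: "pmap_degree (pmap_iterate q T) < d ^ q"
    and crit: "(pmap_eval (skew_product T \<rho> M) ^^ l) ` vertical_critical_locus \<rho> M \<subseteq> zero_section"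
  shows "eventually_periodic {n. meval ((pmap_eval (skew_product T \<rho> M) ^^ n) x0) g = 0}"
proof -
  define F where "F = skew_product T \<rho> M"
  define x where "x n = (pmap_eval F ^^ n) x0" for n
  obtain c where c: "c \<noteq> 0" "\<And>u. det (map_matrix (meval u) (jacobian T)) = c"
    using etale_constant_jacobian[OF assms(1)] by blast
  obtain N where MN: "M ** N = mat 1" using assms(2) unfolding invertible_def by blast
  define \<sigma> where "\<sigma> = radial_derivative \<rho>"
  \<comment> \<open>At a zero of \<sigma> either z = 0 or the point is critical, and in both cases
    its l-th iterate lies in \<open>Z\<close>. The hypothesis on the critical locus concerns points
    over \<open>k\<close>; the identity with cofactors is what carries it over to zeros modulo
    \<open>P\<close>.\<close>
  have "\<exists>D Q. \<forall>x. meval x (pmap_iterate l F $ Inr j) ^ D = meval x Q * meval x \<sigma>" for j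
  proof (rule principal_nullstellensatz)
    fix z assume z: "meval z \<sigma> = 0"
    have "(pmap_eval F ^^ l) z $ Inr j = 0"
    proof (cases "fiber z = 0")
      case True
      have "fiber ((pmap_eval F ^^ n) z) = 0" for n
        by (induction n) (simp_all add: True F_def fiber_skew_product)
      then have "fiber ((pmap_eval F ^^ l) z) $ j = 0 $ j" by simp
      then show ?thesis by simp
    next
      case False
      then have "z \<in> vertical_critical_locus \<rho> M"
        using z by (intro radial_derivative_zero_critical) (simp_all add: \<sigma>_def)
      then show ?thesis using crit by (auto simp: F_def zero_section_def)
    qed
    then show "meval z (pmap_iterate l F $ Inr j) = 0"
      by (simp flip: pmap_eval_iterate)
  qed
  then obtain D Q where DQ: "\<And>j x. meval x (pmap_iterate l F $ Inr j) ^ D j = meval x (Q j) * meval x \<sigma>" by metis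
  have DQ: "((pmap_eval F ^^ l) z $ Inr j) ^ D j = meval z (Q j) * meval z \<sigma>" for j z
    using DQ[of z j] by (simp flip: pmap_eval_iterate)
  \<comment> \<open>Besides the data of the problem, the ring must contain the inverse Jacobian
    constant, the inverse matrix and the cofactors \<open>Q j\<close>.\<close>
  define E where "E = {1 / c} \<union> range (\<lambda>i. x0 $ i) \<union> Poly_Mapping.range g \<union> Poly_Mapping.range \<rho>
    \<union> (\<Union>i. Poly_Mapping.range (T $ i)) \<union> (\<Union>i. Poly_Mapping.range (pmap_iterate q T $ i))
    \<union> (\<Union>i j. Poly_Mapping.range (M $ i $ j)) \<union> (\<Union>i j. Poly_Mapping.range (N $ i $ j))
    \<union> (\<Union>j. Poly_Mapping.range (Q j))"
  have "finite E" unfolding E_def by (intro finite_UnI finite_UN_I) auto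
  then obtain R J p \<nu> P where frame: "prime_frame R J p \<nu> P" and E: "E \<subseteq> R"
    by (rule prime_frame_containing)
  interpret prime_frame R J p \<nu> P by (rule frame)
  have coeffs: "mcoeffs_in R f" if "Poly_Mapping.range f \<subseteq> E" for f :: "('v, 'k) mpoly"
    unfolding mcoeffs_in_def
  proof
    fix e
    show "Poly_Mapping.lookup f e \<in> R"
    proof (cases "Poly_Mapping.lookup f e = 0")
      case False
      then have "Poly_Mapping.lookup f e \<in> Poly_Mapping.range f" by (simp add: in_keys_iff in_keys_lookup_in_range)
      then show ?thesis using that E by blast
    qed (simp add: zero_mem)
  qed
  have gR: "mcoeffs_in R g" and \<rho>R: "mcoeffs_in R \<rho>" and QR: "mcoeffs_in R (Q j)" for j
    by (rule coeffs, auto simp: E_def)+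
  have TR: "pmap_coeffs_in R T" and TqR: "pmap_coeffs_in R (pmap_iterate q T)"
    unfolding pmap_coeffs_in_def by (intro allI coeffs, auto simp: E_def)+
  have MR: "mat_coeffs_in R M" and NR: "mat_coeffs_in R N"
    unfolding mat_coeffs_in_def by (intro allI coeffs, auto simp: E_def)+
  have cR: "1 / c \<in> R" and x0R: "x0 $ i \<in> R" for i
    using E by (auto simp: E_def)
  have FR: "mcoeffs_in R (F $ i)" for i unfolding F_def by (rule mcoeffs_in_skew_product[OF TR \<rho>R MR])
  have xR: "x n $ i \<in> R" for n i unfolding x_def by (rule orbit_mem[OF FR x0R])
  have \<sigma>R: "mcoeffs_in R \<sigma>" unfolding \<sigma>_def by (rule mcoeffs_in_radial_derivative[OF \<rho>R])
  have x_add: "x (m + n) = (pmap_eval F ^^ n) (x m)" for m n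
    unfolding x_def by (subst add.commute) (simp add: funpow_add)
  have tail: "eventually_periodic {n. meval (x n) g = 0}"
    if "eventually_periodic {n. meval ((pmap_eval F ^^ n) (x m)) g = 0}" for m
    by (rule eventually_periodic_eventually[OF that, of 0 _ m]) (simp add: x_add[symmetric] add.commute)
  have "eventually_periodic {n. meval (x n) g = 0}"
  proof (cases "\<exists>m. fiber (x m) = 0")
    case True
    then obtain m where m: "fiber (x m) = 0" by blast
    \<comment> \<open>Both maps send (u, 0) to (T(u), 0), so once the orbit is in \<open>Z\<close>
      the factor \<rho> may be replaced by 1.\<close>
    have "(pmap_eval F ^^ n) (x m) = (pmap_eval (skew_product T 1 M) ^^ n) (x m) \<and>
        fiber ((pmap_eval F ^^ n) (x m)) = 0" for n
    proof (induction n)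
      case (Suc n)
      define z where "z = (pmap_eval F ^^ n) (x m)"
      have z: "fiber z = 0" unfolding z_def by (rule conjunct2[OF Suc])
      have "base (pmap_eval F z) = base (pmap_eval (skew_product T 1 M) z)"
        by (simp add: F_def base_skew_product)
      moreover have "fiber (pmap_eval F z) = 0" "fiber (pmap_eval (skew_product T 1 M) z) = 0"
        by (simp_all add: F_def fiber_skew_product z)
      ultimately show ?case using Suc join_base_fiber by (metis funpow.simps(2) o_apply z_def)
    qed (simp add: m)
    then have eq: "(pmap_eval F ^^ n) (x m) = (pmap_eval (skew_product T 1 M) ^^ n) (x m)" for n by blast
    have one: "(1::'k) \<notin> P" by (rule P_one)
    have "eventually_periodic {n. meval ((pmap_eval (skew_product T 1 M) ^^ n) (x m)) g = 0}"
      by (rule skew_etale_orbit[OF TR mcoeffs_in_1 MR NR MN c(2,1) cR xR _ _ gR])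
        (simp_all add: one radial_derivative_one)
    then show ?thesis by (intro tail[of m]) (simp only: eq)
  next
    case nz: False
    show ?thesis
    proof (cases "\<forall>n. meval (x n) \<rho> \<notin> P \<and> meval (x n) \<sigma> \<notin> P")
      case True
      then have "eventually_periodic {n. meval ((pmap_eval (skew_product T \<rho> M) ^^ n) x0) g = 0}"
        by (intro skew_etale_orbit[OF TR \<rho>R MR NR MN c(2,1) cR x0R _ _ gR]) (simp_all add: x_def F_def \<sigma>_def)
      then show ?thesis by (simp add: x_def F_def)
    next
      case False
      then obtain m where m: "meval (x m) \<rho> \<in> P \<or> meval (x m) \<sigma> \<in> P" by blast
      \<comment> \<open>If \<rho> lies in \<open>P\<close>, so does the next fiber; if \<sigma>
        does, a power of each fiber coordinate lies in \<open>P\<close> after l steps, and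
        \<open>P\<close> is prime.\<close>
      have "\<exists>m. \<forall>j. x m $ Inr j \<in> P" using m
      proof
        assume \<rho>P: "meval (x m) \<rho> \<in> P"
        have "x (Suc m) $ Inr j \<in> P" for j
        proof -
          have "x (Suc m) $ Inr j = (\<Sum>l\<in>UNIV. meval (base (x m)) (M $ j $ l) * x m $ Inr l) * meval (x m) \<rho>"
            by (simp add: x_def F_def skew_product_nth mult.commute)
          also have "\<dots> \<in> P"
            using MR by (intro P_mult[OF sum_mem \<rho>P] mult_mem meval_mem) (auto simp: mat_coeffs_in_def xR)
          finally show ?thesis .
        qed
        then show ?thesis by blast
      next
        assume \<sigma>P: "meval (x m) \<sigma> \<in> P"
        have "x (m + l) $ Inr j \<in> P" for j
        proof (rule P_power[OF xR])
          have "(x (m + l) $ Inr j) ^ D j = meval (x m) (Q j) * meval (x m) \<sigma>"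
            unfolding x_add by (rule DQ)
          also have "\<dots> \<in> P" by (rule P_mult[OF meval_mem[OF QR xR] \<sigma>P])
          finally show "(x (m + l) $ Inr j) ^ D j \<in> P" .
        qed
        then show ?thesis by blast
      qed
      then obtain m1 where m1: "\<And>j. x m1 $ Inr j \<in> P" by blast
      obtain n where n: "\<And>j. (pmap_eval F ^^ n) (x m1) $ Inr j \<in> J 1"
        using fiber_enters_J1[OF TR \<rho>R MR \<rho> d xR m1] unfolding F_def by blast
      define m2 where "m2 = m1 + n"
      have m2: "x m2 $ Inr j \<in> J 1" for j using n by (simp add: m2_def x_add)
      have nz2: "fiber ((pmap_eval F ^^ k) (x m2)) \<noteq> 0" for k
        using nz by (simp add: x_add[symmetric])
      show ?thesis
      proof (rule tail[of m2])
        show "eventually_periodic {n. meval ((pmap_eval F ^^ n) (x m2)) g = 0}"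
          unfolding F_def
          by (rule superattracted_orbit[OF TR \<rho>R MR NR MN c(2,1) cR TqR deg q \<rho> d xR m2 nz2[unfolded F_def] gR])
      qed
    qed
  qed
  then show ?thesis by (simp add: x_def F_def)
qed

theorem corollary6p4:
  fixes T :: "('m::finite, 'k::{alg_closed_field, field_char_0}, 'm) pmap"
    and M :: "('m, 'k) mpoly ^ 'r::finite ^ 'r"
    and \<rho> :: "('m + 'r, 'k) mpoly"
    and F :: "('m + 'r, 'k, 'm + 'r) pmap"
    and d q l :: nat
  assumes "etale T"
    and "invertible M"
    and "d \<ge> 2"
    and "\<rho> \<noteq> 0"
    and "\<rho> \<in> fiber_ideal_power (d - 1)"
    and "F = skew_product T \<rho> M"
    and "q \<ge> 1"
    and "l \<ge> 1"
    and "pmap_degree (pmap_iterate q T) < d ^ q"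
    and "(pmap_eval F ^^ l) ` vertical_critical_locus \<rho> M \<subseteq> zero_section"
  shows "dynamical_Mordell_Lang F"
  unfolding dynamical_Mordell_Lang_def
proof (intro allI impI)
  fix x and V :: "('k ^ ('m + 'r)) set"
  assume "closed_subvariety V"
  then obtain B where B: "finite B" "V = zero_locus B"
    unfolding closed_subvariety_def using zero_locus_finite by metis
  have "eventually_periodic {n. \<forall>g\<in>B. meval ((pmap_eval F ^^ n) x) g = 0}"
    using B(1)
  proof (induction B rule: finite_induct)
    case empty
    then show ?case using eventually_periodic_UNIV by simp
  next
    case (insert g B)
    have "eventually_periodic {n. meval ((pmap_eval F ^^ n) x) g = 0}"
      unfolding assms(6) using assms by (intro skew_product_orbit_zeros) simp_all
    then have "eventually_periodic ({n. meval ((pmap_eval F ^^ n) x) g = 0} \<inter>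
        {n. \<forall>g\<in>B. meval ((pmap_eval F ^^ n) x) g = 0})"
      using insert.IH by (rule eventually_periodic_Int)
    then show ?case by (simp add: Collect_conj_eq)
  qed
  then show "finite_union_of_progressions {n. (pmap_eval F ^^ n) x \<in> V}"
    by (intro eventually_periodic_imp_progressions) (simp add: B(2) zero_locus_def)
qed

end
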